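(* Let $G$ be a locally compact Hausdorff étale groupoid, $\Gamma$ a discrete group and $\sigma\colon G\to\Gamma$ a surjective continuous cocycle. Assume that $G$ is effective and $\ker\sigma$ is topologically transitive. Then the restricted Weyl group $\mathfrak{RW}_{G,\ker\sigma}$ is isomorphic to $$\{\Phi\in\mathrm{Aut}(G)\mid \tau\circ\sigma=\sigma\circ\Phi\text{ for some }\tau\in\mathrm{Aut}(\Gamma)\}$$ as a topological group.
   Context: For a groupoid $G$, $G^{(0)}$ is the unit space, and $d,r$ are the domain and range maps. A topological groupoid is étale if $d$ is a local homeomorphism. $G$ is effective if $G^{(0)}$ equals the interior of $\{\alpha\in G: d(\alpha)=r(\alpha)\}$. A cocycle is a groupoid homomorphism into a group, and $\ker\sigma=\sigma^{-1}(\{e\})$, an open subgroupoid containing $G^{(0)}$. An étale groupoid $H$ is topologically transitive if $r(d^{-1}(U))$ is dense in $H^{(0)}$ for every nonempty open $U\subset H^{(0)}$. $C^*_r(G)$ is the reduced groupoid C*-algebra, containing $C_0(G^{(0)})$ canonically. For an open subgroupoid $G^{(0)}\subset H\subset G$, $C^*_r(H)$ is identified with the closure of $C_c(H)$ in $C^*_r(G)$. For C*-subalgebras $B,B_1,B_2\subset A$, $\mathrm{Aut}(A;B_1,B_2)=\{\varphi\in\mathrm{Aut}(A):\varphi(B_i)=B_i,\ i=1,2\}$ and $\mathrm{Aut}_B(A)=\{\varphi\in\mathrm{Aut}(A):\varphi(b)=b\ \forall b\in B\}$, with the point-norm topology. For $G$ effective, the restricted Weyl group is $$\mathfrak{RW}_{G,H}=\mathrm{Aut}(C^*_r(G);C^*_r(H),C_0(G^{(0)}))/\mathrm{Aut}_{C_0(G^{(0)})}(C^*_r(G))$$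 (the denominator is a normal subgroup of the numerator), with the quotient topology. $\mathrm{Aut}(G)$ is the group of topological groupoid automorphisms of $G$ (groupoid automorphisms that are homeomorphisms). It is topologized via the injective homomorphism $\Phi\mapsto\varphi_\Phi\in\mathrm{Aut}(C^*_r(G))$, $\varphi_\Phi(f)=f\circ\Phi^{-1}$ for $f\in C_c(G)$, i.e. it has the weakest topology making this map continuous for the point-norm topology; subgroups have the relative topology. *)

theory Defs
  imports "HOL-Analysis.Analysis" "HOL-Algebra.Bij" "HOL-Algebra.Coset"
begin

section \<open>Square-summable functions\<close>

lemma ell2_add:
  fixes f g :: "'a \<Rightarrow> complex"
  assumes "(\<lambda>x. (cmod (f x))\<^sup>2) summable_on A" "(\<lambda>x. (cmod (g x))\<^sup>2) summable_on A"
  shows "(\<lambda>x. (cmod (f x + g x))\<^sup>2) summable_on A"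
proof (rule summable_on_comparison_test)
  show "(\<lambda>x. 2 * (cmod (f x))\<^sup>2 + 2 * (cmod (g x))\<^sup>2) summable_on A"
    by (intro summable_on_add summable_on_cmult_right assms)
  fix x
  have "(cmod (f x + g x))\<^sup>2 \<le> (cmod (f x) + cmod (g x))\<^sup>2"
    by (intro power_mono norm_triangle_ineq) auto
  also have "\<dots> \<le> 2 * (cmod (f x))\<^sup>2 + 2 * (cmod (g x))\<^sup>2"
    using sum_squares_bound[of "cmod (f x)" "cmod (g x)"] by (simp add: power2_sum)
  finally show "(cmod (f x + g x))\<^sup>2 \<le> 2 * (cmod (f x))\<^sup>2 + 2 * (cmod (g x))\<^sup>2" .
qed auto

lemma ell2_scale:
  fixes f :: "'a \<Rightarrow> complex"
  assumes "(\<lambda>x. (cmod (f x))\<^sup>2) summable_on A"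
  shows "(\<lambda>x. (cmod (c * f x))\<^sup>2) summable_on A"
  by (simp add: norm_mult power_mult_distrib) (intro summable_on_cmult_right assms)

lemma ell2_prod:
  fixes f g :: "'a \<Rightarrow> complex"
  assumes "(\<lambda>x. (cmod (f x))\<^sup>2) summable_on A" "(\<lambda>x. (cmod (g x))\<^sup>2) summable_on A"
  shows "(\<lambda>x. cnj (f x) * g x) summable_on A"
proof (rule abs_summable_summable, rule summable_on_comparison_test)
  show "(\<lambda>x. (cmod (f x))\<^sup>2 + (cmod (g x))\<^sup>2) summable_on A"
    by (intro summable_on_add assms)
  fix x
  have "0 \<le> cmod (f x) * cmod (g x)" by simp
  then show "norm (cnj (f x) * g x) \<le> (cmod (f x))\<^sup>2 + (cmod (g x))\<^sup>2"
    using sum_squares_bound[of "cmod (f x)" "cmod (g x)"]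
    unfolding norm_mult complex_mod_cnj by linarith
qed auto

typedef 'a ell2 = "{f :: 'a \<Rightarrow> complex. (\<lambda>x. (cmod (f x))\<^sup>2) summable_on UNIV}"
  by (rule exI[of _ "\<lambda>_. 0"]) auto

setup_lifting type_definition_ell2

lift_definition scaleC_ell2 :: "complex \<Rightarrow> 'a ell2 \<Rightarrow> 'a ell2" is "\<lambda>c f x. c * f x"
  by (rule ell2_scale)

lift_definition cinner_ell2 :: "'a ell2 \<Rightarrow> 'a ell2 \<Rightarrow> complex"
  is "\<lambda>f g. \<Sum>\<^sub>\<infinity>x\<in>UNIV. cnj (f x) * g x" .

instantiation ell2 :: (type) real_inner
begin

lift_definition zero_ell2 :: "'a ell2" is "\<lambda>_. 0" by simp
lift_definition plus_ell2 :: "'a ell2 \<Rightarrow> 'a ell2 \<Rightarrow> 'a ell2" is "\<lambda>f g x. f x + g x"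
  by (rule ell2_add)
lift_definition uminus_ell2 :: "'a ell2 \<Rightarrow> 'a ell2" is "\<lambda>f x. - f x" by simp
lift_definition minus_ell2 :: "'a ell2 \<Rightarrow> 'a ell2 \<Rightarrow> 'a ell2" is "\<lambda>f g x. f x - g x"
proof -
  fix f g :: "'a \<Rightarrow> complex"
  assume "(\<lambda>x. (cmod (f x))\<^sup>2) summable_on UNIV" "(\<lambda>x. (cmod (g x))\<^sup>2) summable_on UNIV"
  then show "(\<lambda>x. (cmod (f x - g x))\<^sup>2) summable_on UNIV"
    using ell2_add[of f UNIV "\<lambda>x. - g x"] by simp
qed
lift_definition scaleR_ell2 :: "real \<Rightarrow> 'a ell2 \<Rightarrow> 'a ell2" is "\<lambda>c f x. of_real c * f x"
  by (rule ell2_scale)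

definition inner_ell2 :: "'a ell2 \<Rightarrow> 'a ell2 \<Rightarrow> real"
  where "inner_ell2 x y = Re (cinner_ell2 x y)"
definition norm_ell2 :: "'a ell2 \<Rightarrow> real"
  where "norm_ell2 x = sqrt (inner x x)"
definition dist_ell2 :: "'a ell2 \<Rightarrow> 'a ell2 \<Rightarrow> real"
  where "dist_ell2 x y = norm (x - y)"
definition sgn_ell2 :: "'a ell2 \<Rightarrow> 'a ell2"
  where "sgn_ell2 x = inverse (norm x) *\<^sub>R x"
definition uniformity_ell2 :: "('a ell2 \<times> 'a ell2) filter"
  where "uniformity_ell2 = (INF e\<in>{0 <..}. principal {(x, y). dist x y < e})"
definition open_ell2 :: "'a ell2 set \<Rightarrow> bool"
  where "open_ell2 U \<longleftrightarrow> (\<forall>x\<in>U. \<forall>\<^sub>F (x', y) in uniformity. x' = x \<longrightarrow> y \<in> U)"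

lemma cinner_ell2_self: "cinner_ell2 x x = of_real (\<Sum>\<^sub>\<infinity>a\<in>UNIV. (cmod (Rep_ell2 x a))\<^sup>2)"
proof -
  let ?f = "Rep_ell2 x"
  have "((\<lambda>a. complex_of_real ((cmod (?f a))\<^sup>2)) has_sum
      of_real (\<Sum>\<^sub>\<infinity>a. (cmod (?f a))\<^sup>2)) UNIV"
    using Rep_ell2[of x] by (simp only: has_sum_of_real_iff has_sum_infsum mem_Collect_eq)
  then show ?thesis
    unfolding cinner_ell2.rep_eq
    by (intro infsumI) (simp only: complex_norm_square mult.commute[of "cnj _"])
qed

lemma cinner_ell2_add: "cinner_ell2 (x + y) z = cinner_ell2 x z + cinner_ell2 y z"
  by transfer (simp add: distrib_right infsum_add ell2_prod)

lemma cinner_ell2_commute: "cinner_ell2 x y = cnj (cinner_ell2 y x)"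
  by transfer (simp add: infsum_cnj[symmetric] mult.commute)

lemma cinner_ell2_scaleR: "cinner_ell2 (r *\<^sub>R x) y = of_real r * cinner_ell2 x y"
  by transfer (simp add: mult.assoc infsum_cmult_right')

instance
proof
  fix x y z :: "'a ell2" and a b r :: real
  show "x + y + z = x + (y + z)" by transfer (simp add: add.assoc)
  show "x + y = y + x" by transfer (simp add: add.commute)
  show "0 + x = x" by transfer simp
  show "- x + x = 0" by transfer simp
  show "x - y = x + - y" by transfer simp
  show "a *\<^sub>R (x + y) = a *\<^sub>R x + a *\<^sub>R y" by transfer (simp add: distrib_left)
  show "(a + b) *\<^sub>R x = a *\<^sub>R x + b *\<^sub>R x" by transfer (simp add: distrib_right)
  show "a *\<^sub>R b *\<^sub>R x = (a * b) *\<^sub>R x" by transfer (simp add: mult.assoc)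
  show "1 *\<^sub>R x = x" by transfer simp
  show "dist x y = norm (x - y)" by (rule dist_ell2_def)
  show "sgn x = inverse (norm x) *\<^sub>R x" by (rule sgn_ell2_def)
  show "(uniformity :: ('a ell2 \<times> 'a ell2) filter) = (INF e\<in>{0 <..}. principal {(x, y). dist x y < e})"
    by (rule uniformity_ell2_def)
  show "open U \<longleftrightarrow> (\<forall>x\<in>U. \<forall>\<^sub>F (x', y) in uniformity. x' = x \<longrightarrow> y \<in> U)" for U :: "'a ell2 set"
    by (rule open_ell2_def)
  show "inner x y = inner y x"
    using arg_cong[OF cinner_ell2_commute[of x y], of Re] by (simp add: inner_ell2_def)
  show "inner (x + y) z = inner x z + inner y z"
    by (simp add: inner_ell2_def cinner_ell2_add)
  show "inner (r *\<^sub>R x) y = r * inner x y"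
    by (simp add: inner_ell2_def cinner_ell2_scaleR)
  show "0 \<le> inner x x"
    by (simp add: inner_ell2_def cinner_ell2_self infsum_nonneg)
  show "inner x x = 0 \<longleftrightarrow> x = 0"
  proof
    assume "inner x x = 0"
    then have *: "(\<Sum>\<^sub>\<infinity>a\<in>UNIV. (cmod (Rep_ell2 x a))\<^sup>2) = 0"
      by (simp add: inner_ell2_def cinner_ell2_self)
    have "(\<lambda>a. (cmod (Rep_ell2 x a))\<^sup>2) summable_on UNIV"
      using Rep_ell2[of x] by simp
    then have "(cmod (Rep_ell2 x a))\<^sup>2 = 0" for a
      using nonneg_infsum_le_0D[of "\<lambda>a. (cmod (Rep_ell2 x a))\<^sup>2" UNIV a] * by simp
    then show "x = 0"
      by (simp add: Rep_ell2_inject[symmetric] zero_ell2.rep_eq fun_eq_iff)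
  next
    assume "x = 0"
    then show "inner x x = 0"
      by (simp add: inner_ell2_def cinner_ell2_self zero_ell2.rep_eq)
  qed
  show "norm x = sqrt (inner x x)" by (rule norm_ell2_def)
qed

end

lemma norm_ell2_square: "(norm x)\<^sup>2 = (\<Sum>\<^sub>\<infinity>a\<in>UNIV. (cmod (Rep_ell2 x a))\<^sup>2)"
  by (simp add: power2_norm_eq_inner inner_ell2_def cinner_ell2_self)


lemma ell2_bounded_sums:
  fixes f :: "'a \<Rightarrow> complex"
  assumes "\<And>F. finite F \<Longrightarrow> (\<Sum>a\<in>F. (cmod (f a))\<^sup>2) \<le> C"
  shows "(\<lambda>x. (cmod (f x))\<^sup>2) summable_on UNIV" "(\<Sum>\<^sub>\<infinity>x. (cmod (f x))\<^sup>2) \<le> C"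
proof -
  show "(\<lambda>x. (cmod (f x))\<^sup>2) summable_on UNIV"
    by (rule nonneg_bdd_above_summable_on) (auto intro!: bdd_aboveI2 assms)
  then show "(\<Sum>\<^sub>\<infinity>x. (cmod (f x))\<^sup>2) \<le> C"
    by (rule infsum_le_finite_sums) (rule assms)
qed

lemma ell2_finite_sum_le: "finite F \<Longrightarrow> (\<Sum>a\<in>F. (cmod (Rep_ell2 x a))\<^sup>2) \<le> (norm x)\<^sup>2"
  unfolding norm_ell2_square
  using Rep_ell2[of x] by (intro finite_sum_le_infsum) auto

lemma ell2_operatorI:
  fixes t :: "('a \<Rightarrow> complex) \<Rightarrow> 'a \<Rightarrow> complex"
  assumes bd: "\<And>x F. finite F \<Longrightarrow> (\<Sum>a\<in>F. (cmod (t (Rep_ell2 x) a))\<^sup>2) \<le> C\<^sup>2 * (norm x)\<^sup>2"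
    and add: "\<And>x y. t (\<lambda>a. x a + y a) = (\<lambda>a. t x a + t y a)"
    and scale: "\<And>c x. t (\<lambda>a. c * x a) = (\<lambda>a. c * t x a)"
    and "0 \<le> C"
  shows "Rep_ell2 (blinfun_apply (Blinfun (\<lambda>x. Abs_ell2 (t (Rep_ell2 x)))) x) = t (Rep_ell2 x)"
proof -
  have Rep: "Rep_ell2 (Abs_ell2 (t (Rep_ell2 x))) = t (Rep_ell2 x)" for x
    by (rule Abs_ell2_inverse) (use ell2_bounded_sums[OF bd[of _ x]] in auto)
  have "bounded_linear (\<lambda>x. Abs_ell2 (t (Rep_ell2 x)))"
  proof (rule bounded_linear_intro)
    fix x y :: "'a ell2" and r :: real
    show "Abs_ell2 (t (Rep_ell2 (x + y))) = Abs_ell2 (t (Rep_ell2 x)) + Abs_ell2 (t (Rep_ell2 y))"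
      unfolding Rep_ell2_inject[symmetric]
      by (simp only: Rep) (simp add: plus_ell2.rep_eq add Rep)
    show "Abs_ell2 (t (Rep_ell2 (r *\<^sub>R x))) = r *\<^sub>R Abs_ell2 (t (Rep_ell2 x))"
      unfolding Rep_ell2_inject[symmetric]
      by (simp only: Rep) (simp add: scaleR_ell2.rep_eq scale Rep)
    have "(norm (Abs_ell2 (t (Rep_ell2 x))))\<^sup>2 \<le> (norm x * C)\<^sup>2"
      unfolding norm_ell2_square Rep
      using ell2_bounded_sums(2)[OF bd[of _ x]] by (simp add: power_mult_distrib mult.commute)
    then show "norm (Abs_ell2 (t (Rep_ell2 x))) \<le> norm x * C"
      by (rule power2_le_imp_le) (simp add: \<open>0 \<le> C\<close>)
  qed
  then show ?thesis
    by (simp add: bounded_linear_Blinfun_apply Rep)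
qed

section \<open>Operators\<close>

type_synonym 'a op = "'a ell2 \<Rightarrow>\<^sub>L 'a ell2"

lemma norm_scaleC_ell2: "norm (scaleC_ell2 c x) = cmod c * norm x"
proof (rule power2_eq_imp_eq)
  show "(norm (scaleC_ell2 c x))\<^sup>2 = (cmod c * norm x)\<^sup>2"
    by (simp add: power_mult_distrib norm_ell2_square scaleC_ell2.rep_eq norm_mult infsum_cmult_right')
qed auto

lemma bounded_linear_scaleC_ell2: "bounded_linear (scaleC_ell2 c)"
proof (rule bounded_linear_intro)
  show "scaleC_ell2 c (x + y) = scaleC_ell2 c x + scaleC_ell2 c y" for x y :: "'a ell2"
    by transfer (simp add: distrib_left)
  show "scaleC_ell2 c (r *\<^sub>R x) = r *\<^sub>R scaleC_ell2 c x" for r and x :: "'a ell2"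
    by transfer (simp add: mult_ac)
  show "norm (scaleC_ell2 c x) \<le> norm x * cmod c" for x :: "'a ell2"
    by (simp add: norm_scaleC_ell2 mult.commute)
qed

definition scaleC_op :: "complex \<Rightarrow> 'a op \<Rightarrow> 'a op"
  where "scaleC_op c T = Blinfun (\<lambda>x. scaleC_ell2 c (blinfun_apply T x))"

lemma scaleC_op_apply: "blinfun_apply (scaleC_op c T) x = scaleC_ell2 c (blinfun_apply T x)"
  unfolding scaleC_op_def
  by (subst bounded_linear_Blinfun_apply)
    (rule bounded_linear_compose[OF bounded_linear_scaleC_ell2 blinfun.bounded_linear_right], rule refl)

definition is_adjoint :: "'a op \<Rightarrow> 'a op \<Rightarrow> bool"
  where "is_adjoint S T \<longleftrightarrow> (\<forall>x y. cinner_ell2 (T x) y = cinner_ell2 x (S y))"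

text \<open>
  The library's bounded operators are only real-linear, but all operators in the algebras below
  are complex-linear. Automorphisms of \<open>A\<close> are extensional functions, undefined outside \<open>A\<close>, so
  they are determined by their values on \<open>A\<close>.
\<close>

definition star_aut :: "'a op set \<Rightarrow> ('a op \<Rightarrow> 'a op) set"
  where "star_aut A = {\<phi> \<in> Bij A.
    (\<forall>S\<in>A. \<forall>T\<in>A. \<phi> (S + T) = \<phi> S + \<phi> T) \<and>
    (\<forall>c. \<forall>T\<in>A. \<phi> (scaleC_op c T) = scaleC_op c (\<phi> T)) \<and>
    (\<forall>S\<in>A. \<forall>T\<in>A. \<phi> (S o\<^sub>L T) = \<phi> S o\<^sub>L \<phi> T) \<and>
    (\<forall>S\<in>A. \<forall>T\<in>A. is_adjoint S T \<longrightarrow> is_adjoint (\<phi> S) (\<phi> T))}"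

definition star_aut_preserving :: "'a op set \<Rightarrow> 'a op set \<Rightarrow> 'a op set \<Rightarrow> ('a op \<Rightarrow> 'a op) set"
  where "star_aut_preserving A B\<^sub>1 B\<^sub>2 = {\<phi> \<in> star_aut A. \<phi> ` B\<^sub>1 = B\<^sub>1 \<and> \<phi> ` B\<^sub>2 = B\<^sub>2}"

definition star_aut_fixing :: "'a op set \<Rightarrow> 'a op set \<Rightarrow> ('a op \<Rightarrow> 'a op) set"
  where "star_aut_fixing A B = {\<phi> \<in> star_aut A. \<forall>b\<in>B. \<phi> b = b}"

definition point_norm_topology :: "'a op set \<Rightarrow> ('a op \<Rightarrow> 'a op) topology"
  where "point_norm_topology A = subtopology (product_topology (\<lambda>_. euclidean) A) (star_aut A)"

section \<open>Topological groups\<close>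

definition topological_group :: "('a, 'm) monoid_scheme \<Rightarrow> 'a topology \<Rightarrow> bool"
  where "topological_group K X \<longleftrightarrow> group K \<and> topspace X = carrier K \<and>
    continuous_map (prod_topology X X) X (\<lambda>(x, y). x \<otimes>\<^bsub>K\<^esub> y) \<and>
    continuous_map X X (\<lambda>x. inv\<^bsub>K\<^esub> x)"

text \<open>That both sides are topological groups is part of being isomorphic as topological groups.\<close>

definition topological_group_isomorphic ::
    "('a, 'm) monoid_scheme \<Rightarrow> 'a topology \<Rightarrow> ('b, 'n) monoid_scheme \<Rightarrow> 'b topology \<Rightarrow> bool"
  where "topological_group_isomorphic K X L Y \<longleftrightarrow>
    topological_group K X \<and> topological_group L Y \<and> (\<exists>h \<in> iso K L. homeomorphic_map X Y h)"

definition quotient_topology :: "'a topology \<Rightarrow> ('a \<Rightarrow> 'b) \<Rightarrow> 'b topology"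
  where "quotient_topology X f =
    topology (\<lambda>U. U \<subseteq> f ` topspace X \<and> openin X {x \<in> topspace X. f x \<in> U})"

lemma openin_quotient_topology:
  "openin (quotient_topology X f) U \<longleftrightarrow>
    U \<subseteq> f ` topspace X \<and> openin X {x \<in> topspace X. f x \<in> U}"
proof -
  let ?L = "\<lambda>U. U \<subseteq> f ` topspace X \<and> openin X {x \<in> topspace X. f x \<in> U}"
  have "istopology ?L"
    unfolding istopology_def
  proof (rule conjI; intro allI impI)
    fix S T assume "?L S" "?L T"
    moreover have "{x \<in> topspace X. f x \<in> S \<inter> T} =
        {x \<in> topspace X. f x \<in> S} \<inter> {x \<in> topspace X. f x \<in> T}" by auto
    ultimately show "?L (S \<inter> T)" by auto
  next
    fix \<K> assume \<K>: "\<forall>K\<in>\<K>. ?L K"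
    have "{x \<in> topspace X. f x \<in> \<Union>\<K>} = (\<Union>K\<in>\<K>. {x \<in> topspace X. f x \<in> K})" by auto
    with \<K> show "?L (\<Union>\<K>)" by auto
  qed
  then show ?thesis
    unfolding quotient_topology_def by (simp add: topology_inverse')
qed

lemma quotient_map_quotient_topology: "quotient_map X (quotient_topology X f) f"
proof -
  have "topspace (quotient_topology X f) = f ` topspace X"
  proof
    show "topspace (quotient_topology X f) \<subseteq> f ` topspace X"
      using openin_topspace[of "quotient_topology X f"] openin_quotient_topology by metis
    have "{x \<in> topspace X. f x \<in> f ` topspace X} = topspace X" by auto
    then show "f ` topspace X \<subseteq> topspace (quotient_topology X f)"
      by (intro openin_subset) (simp add: openin_quotient_topology)
  qed
  then show ?thesis
    by (auto simp: quotient_map_def openin_quotient_topology)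
qed

section \<open>Etale groupoids\<close>

text \<open>
  The arrows of a groupoid are all elements of the type \<open>'g\<close>, and units are identified with
  identity arrows. The product \<^term>\<open>gmult G a b\<close> is meaningful only if
  \<^prop>\<open>gdom G a = grng G b\<close>.
\<close>

record 'g groupoid =
  gdom :: "'g \<Rightarrow> 'g"
  grng :: "'g \<Rightarrow> 'g"
  gmult :: "'g \<Rightarrow> 'g \<Rightarrow> 'g"
  ginv :: "'g \<Rightarrow> 'g"

definition gunits :: "'g groupoid \<Rightarrow> 'g set"
  where "gunits G = range (gdom G)"

definition groupoid :: "'g groupoid \<Rightarrow> bool"
  where "groupoid G \<longleftrightarrow>
    (\<forall>a. gdom G (gdom G a) = gdom G a \<and> grng G (gdom G a) = gdom G a) \<and>
    (\<forall>a. gdom G (grng G a) = grng G a \<and> grng G (grng G a) = grng G a) \<and>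
    (\<forall>a b. gdom G a = grng G b \<longrightarrow>
      gdom G (gmult G a b) = gdom G b \<and> grng G (gmult G a b) = grng G a) \<and>
    (\<forall>a b c. gdom G a = grng G b \<and> gdom G b = grng G c \<longrightarrow>
      gmult G (gmult G a b) c = gmult G a (gmult G b c)) \<and>
    (\<forall>a. gmult G a (gdom G a) = a \<and> gmult G (grng G a) a = a) \<and>
    (\<forall>a. gdom G (ginv G a) = grng G a \<and> grng G (ginv G a) = gdom G a \<and>
      gmult G (ginv G a) a = gdom G a \<and> gmult G a (ginv G a) = grng G a)"

definition topological_groupoid :: "'g::topological_space groupoid \<Rightarrow> bool"
  where "topological_groupoid G \<longleftrightarrow> groupoid G \<and>
    continuous_on {(a, b). gdom G a = grng G b} (\<lambda>(a, b). gmult G a b) \<and>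
    continuous_on UNIV (ginv G)"

definition etale :: "'g::topological_space groupoid \<Rightarrow> bool"
  where "etale G \<longleftrightarrow>
    (\<forall>a. \<exists>U. open U \<and> a \<in> U \<and> openin (top_of_set (gunits G)) (gdom G ` U) \<and>
      (\<exists>s. homeomorphism U (gdom G ` U) (gdom G) s))"

definition effective :: "'g::topological_space groupoid \<Rightarrow> bool"
  where "effective G \<longleftrightarrow> gunits G = interior {a. gdom G a = grng G a}"

text \<open>Here \<open>H\<close> is (the set of arrows of) a subgroupoid of \<open>G\<close>, with the relative topology.\<close>

definition topologically_transitive :: "'g::topological_space groupoid \<Rightarrow> 'g set \<Rightarrow> bool"
  where "topologically_transitive G H \<longleftrightarrow>
    (\<forall>U. openin (top_of_set (gunits G \<inter> H)) U \<and> U \<noteq> {} \<longrightarrow>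
      gunits G \<inter> H \<subseteq> closure (grng G ` {a \<in> H. gdom G a \<in> U}))"

definition cocycle :: "'g groupoid \<Rightarrow> ('c, 'm) monoid_scheme \<Rightarrow> ('g \<Rightarrow> 'c) \<Rightarrow> bool"
  where "cocycle G \<Gamma> \<sigma> \<longleftrightarrow> range \<sigma> \<subseteq> carrier \<Gamma> \<and>
    (\<forall>a b. gdom G a = grng G b \<longrightarrow> \<sigma> (gmult G a b) = \<sigma> a \<otimes>\<^bsub>\<Gamma>\<^esub> \<sigma> b)"

definition cocycle_kernel :: "('c, 'm) monoid_scheme \<Rightarrow> ('g \<Rightarrow> 'c) \<Rightarrow> 'g set"
  where "cocycle_kernel \<Gamma> \<sigma> = {a. \<sigma> a = \<one>\<^bsub>\<Gamma>\<^esub>}"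

definition groupoid_aut :: "'g::topological_space groupoid \<Rightarrow> ('g \<Rightarrow> 'g) set"
  where "groupoid_aut G = {\<Phi>. homeomorphic_map euclidean euclidean \<Phi> \<and>
    (\<forall>a. gdom G (\<Phi> a) = \<Phi> (gdom G a) \<and> grng G (\<Phi> a) = \<Phi> (grng G a)) \<and>
    (\<forall>a b. gdom G a = grng G b \<longrightarrow> \<Phi> (gmult G a b) = gmult G (\<Phi> a) (\<Phi> b))}"

section \<open>The reduced groupoid C*-algebra\<close>

text \<open>
  Functions in \<open>C\<^sub>c(H)\<close>, for an open set \<open>H\<close> of arrows, extended by zero to all arrows.
\<close>

definition Cc :: "'g::topological_space set \<Rightarrow> ('g \<Rightarrow> complex) set"
  where "Cc H = {f. continuous_on UNIV f \<and> compact (closure {a. f a \<noteq> 0}) \<and>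
    closure {a. f a \<noteq> 0} \<subseteq> H}"

definition C0 :: "'g::topological_space set \<Rightarrow> ('g \<Rightarrow> complex) set"
  where "C0 X = {f. continuous_on X f \<and> (\<forall>e>0. compact {x \<in> X. e \<le> cmod (f x)})}"

text \<open>
  The space \<open>\<ell>\<^sup>2\<close> of all arrows is the direct sum, over the units \<open>x\<close>, of the spaces
  \<open>\<ell>\<^sup>2(G\<^sub>x)\<close> with \<open>G\<^sub>x = d\<^sup>-\<^sup>1(x)\<close>. On it, \<open>reg_rep G\<close> is the direct sum of the left regular
  representations \<open>\<lambda>\<^sub>x\<close>, so its operator norm is the reduced norm. Lemma \<open>reg_rep_apply\<close>
  confirms that its values on \<open>C\<^sub>c(G)\<close> are the intended bounded operators.
\<close>

definition gconv :: "'g groupoid \<Rightarrow> ('g \<Rightarrow> complex) \<Rightarrow> ('g \<Rightarrow> complex) \<Rightarrow> 'g \<Rightarrow> complex"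
  where "gconv G f x a = (\<Sum>\<^sub>\<infinity>b\<in>{b. gdom G b = gdom G a}. f (gmult G a (ginv G b)) * x b)"

definition reg_rep :: "'g groupoid \<Rightarrow> ('g \<Rightarrow> complex) \<Rightarrow> 'g op"
  where "reg_rep G f = Blinfun (\<lambda>x. Abs_ell2 (gconv G f (Rep_ell2 x)))"

definition reduced_algebra :: "'g::topological_space groupoid \<Rightarrow> 'g set \<Rightarrow> 'g op set"
  where "reduced_algebra G H = closure (reg_rep G ` Cc H)"

abbreviation Cr :: "'g::topological_space groupoid \<Rightarrow> 'g op set"
  where "Cr G \<equiv> reduced_algebra G UNIV"

text \<open>
  For \<open>f \<in> C\<^sub>c(G)\<close> supported in the units, \<^term>\<open>reg_rep G f\<close> is multiplication by \<open>f \<circ> r\<close>;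
  this extends to the canonical embedding of the \<open>C\<^sub>0\<close>-functions on the unit space.
\<close>

definition diag_op :: "'g groupoid \<Rightarrow> ('g \<Rightarrow> complex) \<Rightarrow> 'g op"
  where "diag_op G f = Blinfun (\<lambda>x. Abs_ell2 (\<lambda>a. f (grng G a) * Rep_ell2 x a))"

definition C0_units :: "'g::topological_space groupoid \<Rightarrow> 'g op set"
  where "C0_units G = diag_op G ` C0 (gunits G)"

lemma diag_op_apply:
  assumes "groupoid G" "f \<in> C0 (gunits G)"
  shows "Rep_ell2 (diag_op G f x) a = f (grng G a) * Rep_ell2 x a"
proof -
  have "grng G a \<in> gunits G" for a
    using assms(1) unfolding groupoid_def gunits_def by (metis rangeI)
  moreover have "\<exists>C\<ge>0. \<forall>u\<in>gunits G. cmod (f u) \<le> C"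
  proof -
    let ?K = "{u \<in> gunits G. 1 \<le> cmod (f u)}"
    have "compact ?K" "continuous_on ?K f"
      using assms(2) by (auto simp: C0_def intro: continuous_on_subset)
    then have "bounded (f ` ?K)"
      by (intro compact_imp_bounded compact_continuous_image)
    then obtain C where "\<forall>u\<in>?K. cmod (f u) \<le> C"
      by (auto simp: bounded_iff)
    then show ?thesis
      by (intro exI[of _ "max 1 C"]) force
  qed
  ultimately obtain C where C: "0 \<le> C" "\<And>a. cmod (f (grng G a)) \<le> C" by blast
  have "(\<Sum>a\<in>F. (cmod (f (grng G a) * Rep_ell2 x a))\<^sup>2) \<le> C\<^sup>2 * (norm x)\<^sup>2" if "finite F" for F x
  proof -
    have "(\<Sum>a\<in>F. (cmod (f (grng G a) * Rep_ell2 x a))\<^sup>2) \<le> (\<Sum>a\<in>F. C\<^sup>2 * (cmod (Rep_ell2 x a))\<^sup>2)"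
      using C by (intro sum_mono) (auto simp: norm_mult power_mult_distrib intro!: mult_right_mono power_mono)
    also have "\<dots> \<le> C\<^sup>2 * (norm x)\<^sup>2"
      by (simp add: sum_distrib_left[symmetric] ell2_finite_sum_le[OF that] mult_left_mono)
    finally show ?thesis .
  qed
  then show ?thesis
    unfolding diag_op_def
    using ell2_operatorI[of "\<lambda>x a. f (grng G a) * x a" C x] C(1)
    by (simp add: distrib_left mult_ac)
qed

lemma finite_fibres:
  assumes inj: "\<And>a. \<exists>U. open U \<and> a \<in> U \<and> inj_on p U" and K: "compact K"
  obtains n :: nat where "\<And>u. finite {c \<in> K. p c = u}" "\<And>u. card {c \<in> K. p c = u} \<le> n"
proof -
  obtain U where U: "\<And>a. open (U a)" "\<And>a. a \<in> U a" "\<And>a. inj_on p (U a)"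
    using inj by metis
  have "K \<subseteq> \<Union>(range U)" using U(2) by blast
  then obtain \<D> where \<D>: "\<D> \<subseteq> range U" "finite \<D>" "K \<subseteq> \<Union>\<D>"
    using compactE[OF K, of "range U"] U(1) by auto
  have V: "finite (p -` {u} \<inter> V) \<and> card (p -` {u} \<inter> V) \<le> 1" if "V \<in> \<D>" for V u
  proof -
    have "inj_on p V" using that \<D>(1) U(3) by auto
    then have "a = b" if "a \<in> p -` {u} \<inter> V" "b \<in> p -` {u} \<inter> V" for a b
      using that by (auto dest: inj_onD)
    then have "p -` {u} \<inter> V = {} \<or> (\<exists>a. p -` {u} \<inter> V = {a})" by blast
    then show ?thesis by auto
  qed
  have sub: "{c \<in> K. p c = u} \<subseteq> (\<Union>V\<in>\<D>. p -` {u} \<inter> V)" for u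
    using \<D>(3) by auto
  have fin: "finite (\<Union>V\<in>\<D>. p -` {u} \<inter> V)" for u
    using \<D>(2) V by blast
  have "card {c \<in> K. p c = u} \<le> card \<D>" for u
  proof -
    have "card {c \<in> K. p c = u} \<le> card (\<Union>V\<in>\<D>. p -` {u} \<inter> V)"
      by (rule card_mono[OF fin sub])
    also have "\<dots> \<le> (\<Sum>V\<in>\<D>. card (p -` {u} \<inter> V))"
      by (rule card_UN_le[OF \<D>(2)])
    also have "\<dots> \<le> (\<Sum>V\<in>\<D>. 1)"
      by (intro sum_mono) (use V in blast)
    finally show ?thesis by simp
  qed
  with that finite_subset[OF sub fin] show ?thesis by blast
qed

lemma groupoidD:
  assumes "groupoid G"
  shows "gdom G (gdom G a) = gdom G a" "grng G (gdom G a) = gdom G a"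
    "gdom G (grng G a) = grng G a" "grng G (grng G a) = grng G a"
    "gdom G a = grng G b \<Longrightarrow> gdom G (gmult G a b) = gdom G b"
    "gdom G a = grng G b \<Longrightarrow> grng G (gmult G a b) = grng G a"
    "gdom G a = grng G b \<Longrightarrow> gdom G b = grng G c \<Longrightarrow>
      gmult G (gmult G a b) c = gmult G a (gmult G b c)"
    "gmult G a (gdom G a) = a" "gmult G (grng G a) a = a"
    "gdom G (ginv G a) = grng G a" "grng G (ginv G a) = gdom G a"
    "gmult G (ginv G a) a = gdom G a" "gmult G a (ginv G a) = grng G a"
  using assms unfolding groupoid_def by blast+

lemma groupoid_right_quotient:
  assumes "groupoid G" "gdom G b = gdom G a"
  shows "gmult G (gmult G a (ginv G b)) b = a"
    and "gmult G (ginv G (gmult G a (ginv G b))) a = b"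
    and "gdom G (gmult G a (ginv G b)) = grng G b"
    and "grng G (gmult G a (ginv G b)) = grng G a"
proof -
  note G = groupoidD[OF assms(1)]
  let ?c = "gmult G a (ginv G b)"
  show c: "gdom G ?c = grng G b" "grng G ?c = grng G a"
    using assms(2) by (simp_all add: G)
  have "gmult G ?c b = gmult G a (gmult G (ginv G b) b)"
    using assms(2) by (intro G(7)) (simp_all add: G)
  also have "\<dots> = gmult G a (gdom G a)" by (simp add: G assms(2))
  finally show cb: "gmult G ?c b = a" by (simp add: G)
  have "gmult G (ginv G ?c) (gmult G ?c b) = gmult G (gmult G (ginv G ?c) ?c) b"
    using c by (intro G(7)[symmetric]) (simp_all add: G)
  also have "\<dots> = b" by (simp only: G(12) c(1) G(9))
  finally show "gmult G (ginv G ?c) a = b" using cb by simp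
qed

theorem reg_rep_apply:
  fixes G :: "'g::t2_space groupoid"
  assumes top: "topological_groupoid G" and etale: "etale G" and f: "f \<in> Cc UNIV"
  shows "Rep_ell2 (reg_rep G f x) a =
    (\<Sum>\<^sub>\<infinity>b\<in>{b. gdom G b = gdom G a}. f (gmult G a (ginv G b)) * Rep_ell2 x b)"
proof -
  have G: "groupoid G" and cinv: "continuous_on UNIV (ginv G)"
    using top by (auto simp: topological_groupoid_def)
  define K where "K = closure {a. f a \<noteq> 0}"
  have K: "compact K" using f by (simp add: K_def Cc_def)
  have fK: "f c = 0" if "c \<notin> K" for c
    using that closure_subset[of "{a. f a \<noteq> 0}"] by (auto simp: K_def)
  have "bounded (f ` K)"
    using f K by (intro compact_imp_bounded compact_continuous_image)
      (auto simp: Cc_def intro: continuous_on_subset)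
  then obtain M where M: "\<And>c. c \<in> K \<Longrightarrow> cmod (f c) \<le> M"
    by (auto simp: bounded_iff)
  have injd: "\<exists>U. open U \<and> a \<in> U \<and> inj_on (gdom G) U" for a
    using etale unfolding etale_def homeomorphism_def by (metis inj_on_inverseI)
  have injr: "\<exists>U. open U \<and> a \<in> U \<and> inj_on (grng G) U" for a
  proof -
    obtain W where W: "open W" "ginv G a \<in> W" "inj_on (gdom G) W"
      using injd by blast
    have inv_inv: "ginv G (ginv G a) = a" for a
    proof -
      note G' = groupoidD[OF G]
      have "gmult G (gmult G (ginv G (ginv G a)) (ginv G a)) a =
          gmult G (ginv G (ginv G a)) (gmult G (ginv G a) a)"
        by (intro G'(7)) (simp_all add: G')
      then show ?thesis
        using G'(8)[of "ginv G (ginv G a)"] by (simp add: G'(9-12))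
    qed
    have "inj_on (grng G) (ginv G -` W)"
    proof (rule inj_onI)
      fix a b assume *: "a \<in> ginv G -` W" "b \<in> ginv G -` W" "grng G a = grng G b"
      then have "gdom G (ginv G a) = gdom G (ginv G b)"
        by (simp add: groupoidD[OF G])
      with * W(3) have "ginv G a = ginv G b" by (auto dest: inj_onD)
      then show "a = b" using inv_inv by metis
    qed
    moreover have "open (ginv G -` W)"
      using cinv W(1) by (simp add: continuous_on_open_vimage)
    ultimately show ?thesis using W(2) by blast
  qed
  obtain m where m: "\<And>u. finite {c \<in> K. gdom G c = u}" "\<And>u. card {c \<in> K. gdom G c = u} \<le> m"
    using finite_fibres[OF injd K] by metis
  obtain n where n: "\<And>u. finite {c \<in> K. grng G c = u}" "\<And>u. card {c \<in> K. grng G c = u} \<le> n"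
    using finite_fibres[OF injr K] by metis
  let ?q = "\<lambda>a b. gmult G a (ginv G b)"
  define B where "B a = {b. gdom G b = gdom G a \<and> ?q a b \<in> K}" for a
  define B' where "B' b = {a. gdom G b = gdom G a \<and> ?q a b \<in> K}" for b
  have B: "finite (B a) \<and> card (B a) \<le> n" for a
  proof -
    have inj: "inj_on (?q a) (B a)"
      by (rule inj_on_inverseI[of _ "\<lambda>c. gmult G (ginv G c) a"])
        (auto simp: B_def groupoid_right_quotient[OF G])
    have sub: "?q a ` B a \<subseteq> {c \<in> K. grng G c = grng G a}"
      by (auto simp: B_def groupoid_right_quotient[OF G])
    show ?thesis
      using inj_on_finite[OF inj sub n(1)] order_trans[OF card_inj_on_le[OF inj sub n(1)] n(2)]
      by simp
  qed
  have B': "card (F \<inter> B' b) \<le> m" if "finite F" for F b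
  proof -
    have inj: "inj_on (\<lambda>a. ?q a b) (B' b)"
      by (rule inj_on_inverseI[of _ "\<lambda>c. gmult G c b"])
        (auto simp: B'_def groupoid_right_quotient[OF G])
    have sub: "(\<lambda>a. ?q a b) ` B' b \<subseteq> {c \<in> K. gdom G c = grng G b}"
      by (auto simp: B'_def groupoid_right_quotient[OF G])
    have "card (F \<inter> B' b) \<le> card (B' b)"
      by (rule card_mono[OF inj_on_finite[OF inj sub m(1)]]) simp
    also have "\<dots> \<le> m"
      by (rule order_trans[OF card_inj_on_le[OF inj sub m(1)] m(2)])
    finally show ?thesis .
  qed
  have conv: "gconv G f y a = (\<Sum>b\<in>B a. f (?q a b) * y b)" for y a
  proof -
    have "gconv G f y a = (\<Sum>\<^sub>\<infinity>b\<in>B a. f (?q a b) * y b)"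
      unfolding gconv_def by (rule infsum_cong_neutral) (auto simp: B_def fK)
    then show ?thesis using B by simp
  qed
  have bound: "(\<Sum>a\<in>F. (cmod (gconv G f (Rep_ell2 y) a))\<^sup>2) \<le> (sqrt (real n * M\<^sup>2 * real m))\<^sup>2 * (norm y)\<^sup>2"
    if F: "finite F" for F y
  proof -
    let ?y = "\<lambda>b. (cmod (Rep_ell2 y b))\<^sup>2"
    have one: "(cmod (gconv G f (Rep_ell2 y) a))\<^sup>2 \<le> real n * M\<^sup>2 * (\<Sum>b\<in>B a. ?y b)" for a
    proof -
      have "(cmod (gconv G f (Rep_ell2 y) a))\<^sup>2 \<le> (\<Sum>b\<in>B a. cmod (f (?q a b) * Rep_ell2 y b))\<^sup>2"
        unfolding conv by (intro power_mono norm_sum) auto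
      also have "\<dots> \<le> (\<Sum>b\<in>B a. (cmod (f (?q a b) * Rep_ell2 y b))\<^sup>2) * real (card (B a))"
        by (rule sum_squared_le_sum_of_squares)
      also have "\<dots> \<le> (\<Sum>b\<in>B a. M\<^sup>2 * ?y b) * real n"
      proof (intro mult_mono sum_mono)
        fix b assume "b \<in> B a"
        then show "(cmod (f (?q a b) * Rep_ell2 y b))\<^sup>2 \<le> M\<^sup>2 * ?y b"
          unfolding norm_mult power_mult_distrib
          by (intro mult_right_mono power_mono M) (auto simp: B_def)
      qed (use B in \<open>auto intro: sum_nonneg\<close>)
      finally show ?thesis by (simp add: sum_distrib_left[symmetric] mult_ac)
    qed
    define E where "E = (\<Union>a\<in>F. B a)"
    have E: "finite E" using F B by (simp add: E_def)
    have "(\<Sum>a\<in>F. (cmod (gconv G f (Rep_ell2 y) a))\<^sup>2) \<le> (\<Sum>a\<in>F. real n * M\<^sup>2 * (\<Sum>b\<in>B a. ?y b))"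
      by (intro sum_mono one)
    also have "\<dots> = real n * M\<^sup>2 * (\<Sum>a\<in>F. \<Sum>b\<in>B a. ?y b)"
      by (simp add: sum_distrib_left)
    also have "(\<Sum>a\<in>F. \<Sum>b\<in>B a. ?y b) = (\<Sum>a\<in>F. \<Sum>b\<in>{b\<in>E. b \<in> B a}. ?y b)"
      by (intro sum.cong refl) (auto simp: E_def)
    also have "\<dots> = (\<Sum>b\<in>E. \<Sum>a\<in>{a\<in>F. b \<in> B a}. ?y b)"
      by (rule sum.swap_restrict[OF F E])
    also have "\<dots> \<le> (\<Sum>b\<in>E. real m * ?y b)"
    proof (rule sum_mono)
      fix b
      have "{a\<in>F. b \<in> B a} = F \<inter> B' b" by (auto simp: B_def B'_def)
      with B'[OF F, of b] show "(\<Sum>a\<in>{a\<in>F. b \<in> B a}. ?y b) \<le> real m * ?y b"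
        by (simp add: mult_right_mono)
    qed
    also have "\<dots> \<le> real m * (norm y)\<^sup>2"
      by (simp add: sum_distrib_left[symmetric] ell2_finite_sum_le[OF E] mult_left_mono)
    finally show ?thesis by (simp add: mult_left_mono mult.assoc)
  qed
  have "Rep_ell2 (reg_rep G f x) = gconv G f (Rep_ell2 x)"
    unfolding reg_rep_def
    by (rule ell2_operatorI[OF bound])
      (auto simp: conv fun_eq_iff ring_distribs sum.distrib sum_distrib_left mult_ac)
  then show ?thesis by (simp add: gconv_def)
qed

section \<open>The restricted Weyl group and the topology on groupoid automorphisms\<close>

definition weyl_numerator :: "'g::topological_space groupoid \<Rightarrow> 'g set \<Rightarrow> ('g op \<Rightarrow> 'g op) monoid"
  where "weyl_numerator G H =
    BijGroup (Cr G) \<lparr>carrier := star_aut_preserving (Cr G) (reduced_algebra G H) (C0_units G)\<rparr>"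

definition weyl_denominator :: "'g::topological_space groupoid \<Rightarrow> ('g op \<Rightarrow> 'g op) set"
  where "weyl_denominator G = star_aut_fixing (Cr G) (C0_units G)"

definition restricted_weyl_group ::
    "'g::topological_space groupoid \<Rightarrow> 'g set \<Rightarrow> ('g op \<Rightarrow> 'g op) set monoid"
  where "restricted_weyl_group G H = weyl_numerator G H Mod weyl_denominator G"

definition restricted_weyl_topology ::
    "'g::topological_space groupoid \<Rightarrow> 'g set \<Rightarrow> ('g op \<Rightarrow> 'g op) set topology"
  where "restricted_weyl_topology G H =
    quotient_topology
      (subtopology (point_norm_topology (Cr G)) (carrier (weyl_numerator G H)))
      (\<lambda>\<phi>. weyl_denominator G #>\<^bsub>weyl_numerator G H\<^esub> \<phi>)"

text \<open>
  Since *-automorphisms are continuous, the values on the dense image of \<open>C\<^sub>c(G)\<close> determine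
  the automorphism.
\<close>

definition induced_star_aut :: "'g::topological_space groupoid \<Rightarrow> ('g \<Rightarrow> 'g) \<Rightarrow> 'g op \<Rightarrow> 'g op"
  where "induced_star_aut G \<Phi> = (THE \<phi>. \<phi> \<in> star_aut (Cr G) \<and>
    (\<forall>f\<in>Cc UNIV. \<phi> (reg_rep G f) = reg_rep G (f \<circ> inv_into UNIV \<Phi>)))"

definition groupoid_aut_topology :: "'g::topological_space groupoid \<Rightarrow> ('g \<Rightarrow> 'g) topology"
  where "groupoid_aut_topology G =
    pullback_topology (groupoid_aut G) (induced_star_aut G) (point_norm_topology (Cr G))"

definition cocycle_preserving_aut ::
    "'g::topological_space groupoid \<Rightarrow> ('c, 'm) monoid_scheme \<Rightarrow> ('g \<Rightarrow> 'c) \<Rightarrow> ('g \<Rightarrow> 'g) set"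
  where "cocycle_preserving_aut G \<Gamma> \<sigma> =
    {\<Phi> \<in> groupoid_aut G. \<exists>\<tau> \<in> auto \<Gamma>. \<tau> \<circ> \<sigma> = \<sigma> \<circ> \<Phi>}"

end

theory Submission
  imports Defs
begin

text \<open>
  Every automorphism \<open>\<phi>\<close> of the reduced algebra that preserves the diagonal arises from a groupoid
  automorphism \<open>\<Phi>\<close> and a circle-valued weight. Indeed, effectiveness implies that the normalizers of
  the diagonal are exactly the elements whose coefficient function is supported on a bisection, so
  \<open>\<phi>\<close> permutes them; \<open>\<Phi>\<close> maps an arrow \<open>a\<close> to the arrow, lying over the image of the source of
  \<open>a\<close>, at which \<open>\<phi> n\<close> does not vanish, for any normalizer \<open>n\<close> that does not vanish at \<open>a\<close>. The
  kernel of \<open>\<phi> \<mapsto> \<Phi>\<close> consists of the automorphisms fixing the diagonal, and \<open>\<Phi> \<mapsto> \<phi>\<^sub>\<Phi>\<close> is a section.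
  For a nonnegative \<open>f\<close> supported on a bisection, \<open>\<phi>\<^sub>\<Phi>(f)\<close> is the modulus of \<open>\<phi>(f)\<close>, so its
  norm variation is at most twice that of \<open>\<phi>(f)\<close>; hence \<open>\<phi> \<mapsto> \<Phi>\<close> is continuous, and it is a quotient
  map. Finally, \<open>\<phi>\<close> preserves the subalgebra of the kernel of the cocycle if and only if \<open>\<Phi>\<close>
  preserves the kernel, which by topological transitivity means that \<open>\<Phi>\<close> is compatible with an
  automorphism of the group.
\<close>

section \<open>Hilbert space preliminaries\<close>

text \<open>Two obstacles shape the argument. First, the reduced norm is not controlled by the
  supremum of the coefficients, except for elements supported on a bounded number of bisections.
  Functions are therefore cut into pieces living on bisections, and the pieces are made nonnegative
  because a modulus gives back a function only if the function equals its modulus. Second, an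
  automorphism is given as a bijection respecting algebraic operations and nothing analytic. Its
  isometry has to be extracted from algebra, through a square root built as a fixed point, and its
  action on units from the fact that characters of the diagonal are point evaluations. Effectiveness
  always enters in the same way: the products of two open sets of arrows form an open set, so if all
  of them are isotropy arrows, they are units. Transitivity of the kernel is what allows the degrees
  of arrows that cannot be composed to be multiplied: an arrow of the kernel bridges the
  gap.\<close>

lemma cmod_Rep_ell2_le: "cmod (Rep_ell2 x a) \<le> norm x"
proof -
  have "(cmod (Rep_ell2 x a))\<^sup>2 \<le> (norm x)\<^sup>2"
    using ell2_finite_sum_le[of "{a}" x] by simp
  then show ?thesis by (rule power2_le_imp_le) simp
qed

lemma ell2I:
  assumes "\<And>F. finite F \<Longrightarrow> (\<Sum>a\<in>F. (cmod (f a))\<^sup>2) \<le> C\<^sup>2" and "0 \<le> C"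
  shows "Rep_ell2 (Abs_ell2 f) = f" and "norm (Abs_ell2 f) \<le> C"
proof -
  show R: "Rep_ell2 (Abs_ell2 f) = f"
    by (rule Abs_ell2_inverse) (use ell2_bounded_sums(1)[OF assms(1)] in auto)
  have "(norm (Abs_ell2 f))\<^sup>2 \<le> C\<^sup>2"
    unfolding norm_ell2_square R by (rule ell2_bounded_sums(2)[OF assms(1)])
  then show "norm (Abs_ell2 f) \<le> C" by (rule power2_le_imp_le) (rule assms(2))
qed

lemma norm_ell2_leI:
  assumes "\<And>F. finite F \<Longrightarrow> (\<Sum>a\<in>F. (cmod (Rep_ell2 x a))\<^sup>2) \<le> C\<^sup>2" and "0 \<le> C"
  shows "norm x \<le> C"
  using ell2I(2)[of "Rep_ell2 x" C] assms by (simp add: Rep_ell2_inverse)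

text \<open>Completeness is inherited by the operator space, where it yields adjoints of norm limits
  and Banach's fixed point theorem. Pointwise limits exist because coordinates are dominated by the
  norm, and the Cauchy estimate survives on each finite set of coordinates.\<close>

instance ell2 :: (type) complete_space
proof
  fix X :: "nat \<Rightarrow> 'a ell2"
  assume X: "Cauchy X"
  have "Cauchy (\<lambda>n. Rep_ell2 (X n) a)" for a
  proof (rule metric_CauchyI)
    fix e :: real assume "0 < e"
    then obtain M where M: "\<And>m n. m \<ge> M \<Longrightarrow> n \<ge> M \<Longrightarrow> dist (X m) (X n) < e"
      using X by (metis Cauchy_def)
    have "dist (Rep_ell2 (X m) a) (Rep_ell2 (X n) a) < e" if "m \<ge> M" "n \<ge> M" for m n
      using cmod_Rep_ell2_le[of "X m - X n" a] M[OF that]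
      by (simp add: minus_ell2.rep_eq dist_norm)
    then show "\<exists>M. \<forall>m\<ge>M. \<forall>n\<ge>M. dist (Rep_ell2 (X m) a) (Rep_ell2 (X n) a) < e" by blast
  qed
  then have "\<exists>l. (\<lambda>n. Rep_ell2 (X n) a) \<longlonglongrightarrow> l" for a
    using Cauchy_convergent convergent_def by blast
  then obtain f where f: "\<And>a. (\<lambda>n. Rep_ell2 (X n) a) \<longlonglongrightarrow> f a" by metis
  have bound: "(\<Sum>a\<in>F. (cmod (f a - Rep_ell2 (X n) a))\<^sup>2) \<le> e\<^sup>2"
    if M: "\<And>m n. m \<ge> M \<Longrightarrow> n \<ge> M \<Longrightarrow> dist (X m) (X n) < e" and "n \<ge> M" "finite F" for M n e F
  proof (rule LIMSEQ_le_const2)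
    show "(\<lambda>m. \<Sum>a\<in>F. (cmod (Rep_ell2 (X m) a - Rep_ell2 (X n) a))\<^sup>2) \<longlonglongrightarrow>
        (\<Sum>a\<in>F. (cmod (f a - Rep_ell2 (X n) a))\<^sup>2)"
      by (intro tendsto_intros f)
    have "(\<Sum>a\<in>F. (cmod (Rep_ell2 (X m) a - Rep_ell2 (X n) a))\<^sup>2) \<le> e\<^sup>2" if "m \<ge> M" for m
    proof -
      have "(\<Sum>a\<in>F. (cmod (Rep_ell2 (X m) a - Rep_ell2 (X n) a))\<^sup>2) \<le> (norm (X m - X n))\<^sup>2"
        using ell2_finite_sum_le[OF \<open>finite F\<close>, of "X m - X n"] by (simp add: minus_ell2.rep_eq)
      also have "\<dots> \<le> e\<^sup>2"
        using M[OF that \<open>n \<ge> M\<close>] by (intro power_mono) (auto simp: dist_norm)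
      finally show ?thesis .
    qed
    then show "\<exists>N. \<forall>m\<ge>N. (\<Sum>a\<in>F. (cmod (Rep_ell2 (X m) a - Rep_ell2 (X n) a))\<^sup>2) \<le> e\<^sup>2" by blast
  qed
  have ev: "\<exists>M. \<forall>n\<ge>M. \<exists>y. Rep_ell2 y = (\<lambda>a. f a - Rep_ell2 (X n) a) \<and> norm y \<le> e" if e: "0 < e" for e
  proof -
    obtain M where M: "\<And>m n. m \<ge> M \<Longrightarrow> n \<ge> M \<Longrightarrow> dist (X m) (X n) < e"
      using X e by (metis Cauchy_def)
    have "Rep_ell2 (Abs_ell2 (\<lambda>a. f a - Rep_ell2 (X n) a)) = (\<lambda>a. f a - Rep_ell2 (X n) a) \<and>
        norm (Abs_ell2 (\<lambda>a. f a - Rep_ell2 (X n) a)) \<le> e" if "n \<ge> M" for n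
      using ell2I[of "\<lambda>a. f a - Rep_ell2 (X n) a" e] bound[OF M that] e by simp
    then show ?thesis by blast
  qed
  obtain M y where y: "Rep_ell2 y = (\<lambda>a. f a - Rep_ell2 (X M) a)"
    using ev[of 1] by auto
  define l where "l = y + X M"
  have l: "Rep_ell2 l = f" by (simp add: l_def plus_ell2.rep_eq y)
  have "X \<longlonglongrightarrow> l"
  proof (rule metric_LIMSEQ_I)
    fix e :: real assume "0 < e"
    then obtain M where M: "\<And>n. n \<ge> M \<Longrightarrow> \<exists>y. Rep_ell2 y = (\<lambda>a. f a - Rep_ell2 (X n) a) \<and> norm y \<le> e/2"
      using ev[of "e/2"] by auto
    have "dist (X n) l < e" if n: "n \<ge> M" for n
    proof -
      obtain y where y: "Rep_ell2 y = (\<lambda>a. f a - Rep_ell2 (X n) a)" "norm y \<le> e/2"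
        using M[OF n] by blast
      have "y = l - X n" by (simp add: Rep_ell2_inject[symmetric] minus_ell2.rep_eq l y)
      then show ?thesis using y(2) \<open>0 < e\<close> by (simp add: dist_norm norm_minus_commute)
    qed
    then show "\<exists>M. \<forall>n\<ge>M. dist (X n) l < e" by blast
  qed
  then show "convergent X" by (auto simp: convergent_def)
qed

section \<open>Standard basis vectors and the density of their span\<close>

lift_definition ket :: "'a \<Rightarrow> 'a ell2" is "\<lambda>a b. if b = a then 1 else 0"
proof -
  fix a :: 'a
  have "(\<lambda>x. (cmod (if x = a then 1 else 0))\<^sup>2) summable_on UNIV
      \<longleftrightarrow> (\<lambda>x. (cmod (if x = a then 1 else 0))\<^sup>2) summable_on {a}"
    by (rule summable_on_cong_neutral) auto
  then show "(\<lambda>x. (cmod (if x = a then 1 else 0))\<^sup>2) summable_on UNIV" by simp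
qed

lemma infsum_single:
  fixes f :: "'a \<Rightarrow> 'b::{comm_monoid_add,t2_space}"
  assumes "\<And>x. x \<in> A \<Longrightarrow> x \<noteq> a \<Longrightarrow> f x = 0" "a \<in> A"
  shows "(\<Sum>\<^sub>\<infinity>x\<in>A. f x) = f a"
proof -
  have "(\<Sum>\<^sub>\<infinity>x\<in>A. f x) = (\<Sum>\<^sub>\<infinity>x\<in>{a}. f x)"
    by (rule infsum_cong_neutral) (use assms in auto)
  then show ?thesis by simp
qed

lemma cinner_ket: "cinner_ell2 (ket a) x = Rep_ell2 x a"
  unfolding cinner_ell2.rep_eq
  by (subst infsum_single[of _ a]) (auto simp: ket.rep_eq)

lemma cinner_ket_right: "cinner_ell2 x (ket a) = cnj (Rep_ell2 x a)"
  by (subst cinner_ell2_commute) (simp add: cinner_ket)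

lemma norm_ket [simp]: "norm (ket a) = 1"
proof -
  have "(norm (ket a))\<^sup>2 = 1"
    unfolding norm_ell2_square
    by (subst infsum_single[of _ a]) (auto simp: ket.rep_eq)
  then show ?thesis by (simp add: power2_eq_1_iff) (use norm_ge_zero[of "ket a"] in linarith)
qed

lemma cinner_self: "cinner_ell2 x x = of_real ((norm x)\<^sup>2)"
  by (simp add: cinner_ell2_self norm_ell2_square)

lemma cinner_add_right: "cinner_ell2 x (y + z) = cinner_ell2 x y + cinner_ell2 x z"
  using cinner_ell2_add[of y z x] by (metis cinner_ell2_commute complex_cnj_add)

lemma cinner_scaleC_right: "cinner_ell2 x (scaleC_ell2 c y) = c * cinner_ell2 x y"
  by transfer (simp add: infsum_cmult_right' mult.left_commute)

lemma cinner_scaleC_left: "cinner_ell2 (scaleC_ell2 c x) y = cnj c * cinner_ell2 x y"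
  by (metis cinner_scaleC_right cinner_ell2_commute complex_cnj_mult)

lemma cinner_minus_left: "cinner_ell2 (x - y) z = cinner_ell2 x z - cinner_ell2 y z"
  using cinner_ell2_add[of "x - y" y z] by simp

lemma cinner_minus_right: "cinner_ell2 z (x - y) = cinner_ell2 z x - cinner_ell2 z y"
  using cinner_add_right[of z "x - y" y] by simp

text \<open>Two real inner products carry the complex one, so limits and the Cauchy-Schwarz
  inequality transfer from the real inner product space.\<close>

lemma cinner_eq_inner:
  "cinner_ell2 x y = Complex (inner x y) (inner (scaleC_ell2 \<i> x) y)"
  by (simp add: complex_eq_iff inner_ell2_def cinner_scaleC_left)

lemma cinner_ext:
  assumes "\<And>y. cinner_ell2 y x = cinner_ell2 y x'"
  shows "x = x'"
  using assms[of "ket _"] by (simp add: cinner_ket Rep_ell2_inject[symmetric] fun_eq_iff)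

lemma bounded_linear_Rep_ell2: "bounded_linear (\<lambda>x. Rep_ell2 x a)"
  by (rule bounded_linear_intro[of _ 1])
    (use cmod_Rep_ell2_le in \<open>auto simp: plus_ell2.rep_eq scaleR_ell2.rep_eq scaleR_conv_of_real\<close>)

lemma Rep_ell2_sum: "Rep_ell2 (\<Sum>i\<in>F. x i) a = (\<Sum>i\<in>F. Rep_ell2 (x i) a)"
  by (rule bounded_linear.linear[OF bounded_linear_Rep_ell2, THEN linear_sum])

lemma ell2_finite_approximation:
  assumes "0 < e"
  shows "\<exists>F. finite F \<and> norm (x - (\<Sum>a\<in>F. scaleC_ell2 (Rep_ell2 x a) (ket a))) < e"
proof -
  let ?f = "\<lambda>a. (cmod (Rep_ell2 x a))\<^sup>2"
  have sm: "?f summable_on UNIV" using Rep_ell2[of x] by simp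
  obtain F where F: "finite F" "dist (sum ?f F) (infsum ?f UNIV) \<le> (e/2)\<^sup>2"
    using infsum_finite_approximation[OF sm, of "(e/2)\<^sup>2"] assms by auto
  let ?y = "x - (\<Sum>a\<in>F. scaleC_ell2 (Rep_ell2 x a) (ket a))"
  have y: "Rep_ell2 ?y a = (if a \<in> F then 0 else Rep_ell2 x a)" for a
    using F(1) by (simp add: minus_ell2.rep_eq Rep_ell2_sum scaleC_ell2.rep_eq ket.rep_eq if_distrib
        cong: if_cong)
  have "(norm ?y)\<^sup>2 = infsum ?f (UNIV - F)"
    unfolding norm_ell2_square y by (rule infsum_cong_neutral) auto
  also have "\<dots> = infsum ?f UNIV - infsum ?f F"
    by (rule infsum_Diff[OF sm]) (use F(1) in auto)
  also have "\<dots> \<le> (e/2)\<^sup>2" using F by (simp add: dist_real_def)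
  finally have "norm ?y \<le> e/2" by (rule power2_le_imp_le) (use assms in simp)
  with assms F(1) show ?thesis by (intro exI[of _ F]) linarith
qed

text \<open>The finite sums of \<open>ell2_finite_approximation\<close> are dense. Agreement is
  demanded on complex multiples of basis vectors because \<open>L\<close> and \<open>M\<close> are
  only real-linear.\<close>

lemma ell2_bounded_linear_eqI:
  fixes L M :: "'a ell2 \<Rightarrow> 'b::real_normed_vector"
  assumes L: "bounded_linear L" and M: "bounded_linear M"
    and eq: "\<And>c a. L (scaleC_ell2 c (ket a)) = M (scaleC_ell2 c (ket a))"
  shows "L x = M x"
proof -
  interpret D: bounded_linear "\<lambda>x. L x - M x" by (rule bounded_linear_sub[OF L M])
  obtain K where K: "K > 0" "\<And>x. norm (L x - M x) \<le> norm x * K"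
    using D.pos_bounded by blast
  have "norm (L x - M x) \<le> 0 + e" if "0 < e" for e
  proof -
    obtain F where F: "finite F" "norm (x - (\<Sum>a\<in>F. scaleC_ell2 (Rep_ell2 x a) (ket a))) < e / K"
      using ell2_finite_approximation[of "e/K" x] divide_pos_pos[OF \<open>0 < e\<close> K(1)] by blast
    let ?s = "\<Sum>a\<in>F. scaleC_ell2 (Rep_ell2 x a) (ket a)"
    have "L ?s - M ?s = 0"
      by (subst D.sum) (simp add: eq)
    then have "L x - M x = L (x - ?s) - M (x - ?s)"
      using D.diff[of x ?s] by simp
    then have "norm (L x - M x) \<le> norm (x - ?s) * K" using K(2) by metis
    also have "\<dots> \<le> e" using F(2) K(1) by (simp add: field_simps)
    finally show ?thesis by simp
  qed
  then have "norm (L x - M x) \<le> 0" by (rule field_le_epsilon)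
  then show ?thesis by simp
qed

section \<open>Complex-linear operators and adjoints\<close>

text \<open>The operator type guarantees real linearity only, and the values on basis vectors
  determine an operator only among the complex-linear ones.\<close>

definition complex_linear_op :: "'a op \<Rightarrow> bool"
  where "complex_linear_op T \<longleftrightarrow> (\<forall>c x. T (scaleC_ell2 c x) = scaleC_ell2 c (T x))"

lemma op_eqI:
  assumes "complex_linear_op S" "complex_linear_op T" "\<And>a. S (ket a) = T (ket a)"
  shows "S = T"
proof (rule blinfun_eqI)
  show "S x = T x" for x
    by (rule ell2_bounded_linear_eqI[OF blinfun.bounded_linear_right blinfun.bounded_linear_right])
      (use assms in \<open>simp add: complex_linear_op_def\<close>)
qed

lemma Rep_scaleC_op: "Rep_ell2 (scaleC_op c T x) a = c * Rep_ell2 (T x) a"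
  by (simp add: scaleC_op_apply scaleC_ell2.rep_eq)

lemma scaleC_ell2_of_real: "scaleC_ell2 (of_real r) x = r *\<^sub>R x"
  by (simp add: Rep_ell2_inject[symmetric] scaleC_ell2.rep_eq scaleR_ell2.rep_eq)

lemma scaleC_op_of_real: "scaleC_op (of_real r) T = r *\<^sub>R T"
  by (rule blinfun_eqI) (simp add: scaleC_op_apply scaleC_ell2_of_real scaleR_blinfun.rep_eq)

lemma scaleC_op_scaleC_op: "scaleC_op c (scaleC_op d T) = scaleC_op (c * d) T"
  by (rule blinfun_eqI) (simp add: Rep_ell2_inject[symmetric] fun_eq_iff Rep_scaleC_op)

lemma scaleC_op_0 [simp]: "scaleC_op 0 T = 0"
  using scaleC_op_of_real[of 0 T] by simp

lemma scaleC_op_add: "scaleC_op c (S + T) = scaleC_op c S + scaleC_op c T"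
  by (rule blinfun_eqI)
    (simp add: scaleC_op_apply plus_blinfun.rep_eq linear_simps[OF bounded_linear_scaleC_ell2])

lemma norm_scaleC_op_le: "norm (scaleC_op c T) \<le> cmod c * norm T"
  by (rule norm_blinfun_bound)
    (use norm_blinfun[of T] in \<open>auto simp: scaleC_op_apply norm_scaleC_ell2 mult.assoc intro!: mult_left_mono\<close>)

lemma bounded_linear_scaleC_op: "bounded_linear (scaleC_op c)"
proof (rule bounded_linear_intro)
  show "scaleC_op c (r *\<^sub>R T) = r *\<^sub>R scaleC_op c T" for r and T :: "'a op"
    by (simp add: scaleC_op_of_real[symmetric] scaleC_op_scaleC_op mult.commute)
  show "norm (scaleC_op c T) \<le> norm T * cmod c" for T :: "'a op"
    using norm_scaleC_op_le[of c T] by (simp add: mult.commute)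
qed (rule scaleC_op_add)

lemma is_adjoint_commute: "is_adjoint S T \<longleftrightarrow> is_adjoint T S"
  unfolding is_adjoint_def by (metis cinner_ell2_commute complex_cnj_cnj)

lemma is_adjoint_unique: "is_adjoint S T \<Longrightarrow> is_adjoint S' T \<Longrightarrow> S = S'"
  unfolding is_adjoint_def by (intro blinfun_eqI cinner_ext) metis

lemma is_adjoint_add: "is_adjoint S T \<Longrightarrow> is_adjoint S' T' \<Longrightarrow> is_adjoint (S + S') (T + T')"
  by (simp add: is_adjoint_def plus_blinfun.rep_eq cinner_add_right cinner_ell2_add)

lemma is_adjoint_minus: "is_adjoint S T \<Longrightarrow> is_adjoint S' T' \<Longrightarrow> is_adjoint (S - S') (T - T')"
  by (simp add: is_adjoint_def minus_blinfun.rep_eq cinner_minus_right cinner_minus_left)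

lemma is_adjoint_scaleC: "is_adjoint S T \<Longrightarrow> is_adjoint (scaleC_op (cnj c) S) (scaleC_op c T)"
  by (simp add: is_adjoint_def scaleC_op_apply cinner_scaleC_right cinner_scaleC_left)

lemma is_adjoint_scaleR: "is_adjoint S T \<Longrightarrow> is_adjoint (r *\<^sub>R S) (r *\<^sub>R T)"
  using is_adjoint_scaleC[of S T "of_real r"] by (simp add: scaleC_op_of_real)

lemma is_adjoint_compose: "is_adjoint S T \<Longrightarrow> is_adjoint S' T' \<Longrightarrow> is_adjoint (S' o\<^sub>L S) (T o\<^sub>L T')"
  by (simp add: is_adjoint_def blinfun_compose.rep_eq)

lemma is_adjoint_zero: "is_adjoint 0 0"
proof -
  have "cinner_ell2 0 y = 0" "cinner_ell2 y 0 = 0" for y :: "'a ell2"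
    using cinner_minus_left[of 0 0 y] cinner_minus_right[of y 0 0] by simp_all
  then show ?thesis by (simp add: is_adjoint_def)
qed

lemma is_adjoint_limit:
  assumes "\<And>n. is_adjoint (S n) (T n)" "S \<longlonglongrightarrow> S'" "T \<longlonglongrightarrow> T'"
  shows "is_adjoint S' T'"
proof -
  have eq: "Complex (inner (T' x) y) (inner (scaleC_ell2 \<i> (T' x)) y) =
      Complex (inner x (S' y)) (inner (scaleC_ell2 \<i> x) (S' y))" for x y
  proof (rule LIMSEQ_unique)
    note [tendsto_intros] = bounded_linear.tendsto[OF bounded_linear_scaleC_ell2]
    have T: "(\<lambda>n. T n x) \<longlonglongrightarrow> T' x"
      by (intro tendsto_intros assms)
    have S: "(\<lambda>n. S n y) \<longlonglongrightarrow> S' y"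
      by (intro tendsto_intros assms)
    show "(\<lambda>n. cinner_ell2 (T n x) y) \<longlonglongrightarrow> Complex (inner (T' x) y) (inner (scaleC_ell2 \<i> (T' x)) y)"
      unfolding cinner_eq_inner by (intro tendsto_intros T)
    have "cinner_ell2 (T n x) y = cinner_ell2 x (S n y)" for n
      using assms(1) by (auto simp: is_adjoint_def)
    then show "(\<lambda>n. cinner_ell2 (T n x) y) \<longlonglongrightarrow>
        Complex (inner x (S' y)) (inner (scaleC_ell2 \<i> x) (S' y))"
      unfolding cinner_eq_inner[symmetric] by (simp only:) (simp only: cinner_eq_inner, intro tendsto_intros S)
  qed
  then show ?thesis by (simp add: is_adjoint_def cinner_eq_inner)
qed

lemma norm_square_adjoint_apply:
  assumes "is_adjoint S T"
  shows "of_real ((norm (T x))\<^sup>2) = cinner_ell2 x (S (T x))"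
  using assms cinner_self[of "T x"] by (simp add: is_adjoint_def)

lemma norm_square_apply_le:
  assumes "is_adjoint S T"
  shows "(norm (T x))\<^sup>2 \<le> norm (S o\<^sub>L T) * (norm x)\<^sup>2"
proof -
  have "(norm (T x))\<^sup>2 = inner x ((S o\<^sub>L T) x)"
    using arg_cong[OF norm_square_adjoint_apply[OF assms, of x], of Re]
    by (simp add: inner_ell2_def blinfun_compose.rep_eq)
  also have "\<dots> \<le> norm x * norm ((S o\<^sub>L T) x)" by (rule norm_cauchy_schwarz)
  also have "\<dots> \<le> norm x * (norm (S o\<^sub>L T) * norm x)"
    by (intro mult_left_mono norm_blinfun) auto
  finally show ?thesis by (simp add: power2_eq_square mult_ac)
qed

lemma norm_square_le_adjoint: "is_adjoint S T \<Longrightarrow> (norm T)\<^sup>2 \<le> norm (S o\<^sub>L T)"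
proof -
  assume *: "is_adjoint S T"
  have "norm T \<le> sqrt (norm (S o\<^sub>L T))"
  proof (rule norm_blinfun_bound)
    show "norm (T x) \<le> sqrt (norm (S o\<^sub>L T)) * norm x" for x
      using norm_square_apply_le[OF *, of x]
      by (rule_tac power2_le_imp_le) (simp_all add: power_mult_distrib)
  qed auto
  then have "(norm T)\<^sup>2 \<le> (sqrt (norm (S o\<^sub>L T)))\<^sup>2" by (intro power_mono) auto
  then show ?thesis by simp
qed

text \<open>In \<open>(norm T)\<^sup>2 \<le> norm (S o\<^sub>L T) \<le> norm S * norm T\<close> a
  factor cancels; the relation is symmetric, so the reverse inequality follows as well.\<close>

lemma norm_adjoint: "is_adjoint S T \<Longrightarrow> norm S = norm T"
proof -
  have le: "norm T \<le> norm S" if "is_adjoint S T" for S T :: "'a op"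
  proof (cases "norm T = 0")
    case False
    have "norm T * norm T \<le> norm S * norm T"
      using norm_square_le_adjoint[OF that] norm_blinfun_compose[of S T] by (simp add: power2_eq_square)
    then show ?thesis using False by simp
  qed simp
  show "is_adjoint S T \<Longrightarrow> norm S = norm T"
    using le[of S T] le[of T S] is_adjoint_commute by fastforce
qed

text \<open>This is the C*-identity.\<close>

lemma norm_adjoint_compose: "is_adjoint S T \<Longrightarrow> norm (S o\<^sub>L T) = (norm T)\<^sup>2"
  using norm_square_le_adjoint[of S T] norm_blinfun_compose[of S T] norm_adjoint[of S T]
  by (simp add: power2_eq_square)

section \<open>Compactly supported functions\<close>

lemma CcI:
  fixes f :: "'g::t2_space \<Rightarrow> complex"
  assumes "continuous_on UNIV f" "compact K" "\<And>a. f a \<noteq> 0 \<Longrightarrow> a \<in> K" "K \<subseteq> W"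
  shows "f \<in> Cc W"
proof -
  have sub: "closure {a. f a \<noteq> 0} \<subseteq> K"
    by (rule closure_minimal) (use assms compact_imp_closed in auto)
  then have "compact (closure {a. f a \<noteq> 0})"
    using compact_Int_closed[OF assms(2) closed_closure, of "{a. f a \<noteq> 0}"] by (simp add: Int_absorb1)
  with sub assms show ?thesis by (auto simp: Cc_def)
qed

lemma CcD:
  fixes f :: "'g::t2_space \<Rightarrow> complex"
  assumes "f \<in> Cc W"
  shows "continuous_on UNIV f" "compact (closure {a. f a \<noteq> 0})" "closure {a. f a \<noteq> 0} \<subseteq> W"
    "f a \<noteq> 0 \<Longrightarrow> a \<in> closure {a. f a \<noteq> 0}" "f a \<noteq> 0 \<Longrightarrow> a \<in> W"
  using assms closure_subset[of "{a. f a \<noteq> 0}"] by (auto simp: Cc_def)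

lemma Cc_mono: "f \<in> Cc V \<Longrightarrow> V \<subseteq> W \<Longrightarrow> f \<in> Cc W"
  by (auto simp: Cc_def)

lemma Cc_zero: "(\<lambda>_. 0) \<in> Cc W"
  by (simp add: Cc_def)

lemma Cc_add:
  fixes f g :: "'g::t2_space \<Rightarrow> complex"
  assumes "f \<in> Cc W" "g \<in> Cc W"
  shows "(\<lambda>x. f x + g x) \<in> Cc W"
proof (rule CcI[where K = "closure {a. f a \<noteq> 0} \<union> closure {a. g a \<noteq> 0}"])
  fix a assume "f a + g a \<noteq> 0"
  then have "f a \<noteq> 0 \<or> g a \<noteq> 0" by auto
  then show "a \<in> closure {a. f a \<noteq> 0} \<union> closure {a. g a \<noteq> 0}"
    using CcD(4)[OF assms(1)] CcD(4)[OF assms(2)] by blast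
qed (use CcD[OF assms(1)] CcD[OF assms(2)] in \<open>auto intro!: continuous_intros compact_Un\<close>)

lemma Cc_mult:
  fixes f :: "'g::t2_space \<Rightarrow> complex"
  shows "f \<in> Cc W \<Longrightarrow> continuous_on UNIV g \<Longrightarrow> (\<lambda>x. f x * g x) \<in> Cc W"
  by (rule CcI[where K = "closure {a. f a \<noteq> 0}"])
    (auto intro!: continuous_intros dest: CcD)

lemma Cc_cmult:
  fixes f :: "'g::t2_space \<Rightarrow> complex"
  shows "f \<in> Cc W \<Longrightarrow> (\<lambda>x. c * f x) \<in> Cc W"
  using Cc_mult[of f W "\<lambda>_. c"] by (simp add: mult.commute)

text \<open>Continuity is local: \<open>U\<close> and the complement of \<open>C\<close> form an
  open cover, and the function vanishes on the second set.\<close>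

lemma continuous_extend_zero:
  fixes f :: "'a::topological_space \<Rightarrow> 'b::{topological_space,zero}"
  assumes "open U" "continuous_on U f" "closed C" "C \<subseteq> U" "\<And>x. x \<notin> C \<Longrightarrow> f x = 0"
  shows "continuous_on UNIV f"
proof -
  have "continuous_on (- C) f"
    by (rule continuous_on_eq[OF continuous_on_const[of _ 0]]) (use assms(5) in auto)
  then have "continuous_on (U \<union> - C) f"
    using assms by (intro continuous_on_open_Un) auto
  moreover have "U \<union> - C = UNIV" using assms(4) by auto
  ultimately show ?thesis by simp
qed

locale effective_etale_groupoid =
  fixes G :: "'g::t2_space groupoid"
  assumes lc: "locally_compact_space (euclidean :: 'g topology)"
    and top: "topological_groupoid G"
    and etale: "etale G"
    and effective: "effective G"
begin

abbreviation "d \<equiv> gdom G"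
abbreviation "r \<equiv> grng G"
abbreviation "iv \<equiv> ginv G"
abbreviation "U\<^sub>0 \<equiv> gunits G"
abbreviation gm (infixl "\<diamondop>" 70) where "a \<diamondop> b \<equiv> gmult G a b"

section \<open>The algebra and topology of the groupoid\<close>

lemma grpd: "groupoid G" using top by (simp add: topological_groupoid_def)

lemmas gr [simp] = groupoidD[OF grpd]

lemma inv_inv [simp]: "iv (iv a) = a"
proof -
  have "(iv (iv a) \<diamondop> iv a) \<diamondop> a = iv (iv a) \<diamondop> (iv a \<diamondop> a)"
    by (intro gr(7)) simp_all
  then show ?thesis using gr(8)[of "iv (iv a)"] by simp
qed

lemma cancel_right [simp]: "d a = d b \<Longrightarrow> (a \<diamondop> iv b) \<diamondop> b = a"
  and cancel_left [simp]: "r a = r b \<Longrightarrow> a \<diamondop> (iv a \<diamondop> b) = b"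
  and cancel_right' [simp]: "d a = r b \<Longrightarrow> (a \<diamondop> b) \<diamondop> iv b = a"
  and cancel_left' [simp]: "d a = r b \<Longrightarrow> iv a \<diamondop> (a \<diamondop> b) = b"
proof -
  show "d a = d b \<Longrightarrow> (a \<diamondop> iv b) \<diamondop> b = a"
    by (rule groupoid_right_quotient[OF grpd]) simp
  show "r a = r b \<Longrightarrow> a \<diamondop> (iv a \<diamondop> b) = b"
    by (subst gr(7)[symmetric]) simp_all
  assume ab: "d a = r b"
  then have "(a \<diamondop> b) \<diamondop> iv b = a \<diamondop> (b \<diamondop> iv b)" "iv a \<diamondop> (a \<diamondop> b) = (iv a \<diamondop> a) \<diamondop> b"
    by (simp_all del: gr(12,13))
  then show "(a \<diamondop> b) \<diamondop> iv b = a" "iv a \<diamondop> (a \<diamondop> b) = b"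
    using gr(8)[of a] gr(9)[of b] ab by simp_all
qed

lemma left_cancel: "d a = r b \<Longrightarrow> d a = r c \<Longrightarrow> a \<diamondop> b = a \<diamondop> c \<Longrightarrow> b = c"
  by (metis cancel_left')

lemma inv_mult: "d a = r b \<Longrightarrow> iv (a \<diamondop> b) = iv b \<diamondop> iv a"
proof -
  assume ab: "d a = r b"
  have "(a \<diamondop> b) \<diamondop> (iv b \<diamondop> iv a) = a \<diamondop> (b \<diamondop> (iv b \<diamondop> iv a))"
    using ab by (intro gr(7)) simp_all
  also have "\<dots> = (a \<diamondop> b) \<diamondop> iv (a \<diamondop> b)" using ab by simp
  finally have "iv b \<diamondop> iv a = iv (a \<diamondop> b)"
    by (rule left_cancel[rotated 2]) (simp_all add: ab)
  then show ?thesis by simp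
qed

lemma unit_iff: "u \<in> U\<^sub>0 \<longleftrightarrow> d u = u" and unit_iff': "u \<in> U\<^sub>0 \<longleftrightarrow> r u = u"
  by (metis gr(1,2,3) gunits_def rangeE rangeI)+

lemma d_unit [simp]: "d a \<in> U\<^sub>0" and r_unit [simp]: "r a \<in> U\<^sub>0"
  by (simp_all add: unit_iff)

lemma unitD: "u \<in> U\<^sub>0 \<Longrightarrow> d u = u" "u \<in> U\<^sub>0 \<Longrightarrow> r u = u"
  by (simp_all add: unit_iff unit_iff'[symmetric])

lemma inv_unit [simp]: "u \<in> U\<^sub>0 \<Longrightarrow> iv u = u"
  by (metis gr(9,12) inv_inv unitD gr(10))

lemma mult_unit [simp]: "u \<in> U\<^sub>0 \<Longrightarrow> d a = u \<Longrightarrow> a \<diamondop> u = a"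
  "u \<in> U\<^sub>0 \<Longrightarrow> r a = u \<Longrightarrow> u \<diamondop> a = a"
  using gr(8)[of a] gr(9)[of a] by metis+

text \<open>Turns the conclusion of \<open>effectiveD\<close>, that a quotient is a unit, into an
  equality of arrows.\<close>

lemma quotient_unit_iff: "d a = d b \<Longrightarrow> a \<diamondop> iv b \<in> U\<^sub>0 \<longleftrightarrow> a = b"
  by (metis cancel_right gr(10,13) groupoid_right_quotient(3)[OF grpd] mult_unit(2) r_unit unitD(1))

lemma continuous_iv: "continuous_on S iv"
  using top continuous_on_subset by (auto simp: topological_groupoid_def)

lemma open_iv: "open U \<Longrightarrow> open (iv ` U)"
proof -
  assume "open U"
  then have "open (iv -` U)"
    using continuous_iv[of UNIV] by (simp add: continuous_on_open_vimage)
  moreover have "iv ` U = iv -` U" by (force simp: image_iff)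
  ultimately show ?thesis by simp
qed

lemma continuous_gm:
  assumes "continuous_on S f" "continuous_on S g" "\<And>x. x \<in> S \<Longrightarrow> d (f x) = r (g x)"
  shows "continuous_on S (\<lambda>x. f x \<diamondop> g x)"
proof -
  have "continuous_on {(a, b). d a = r b} (\<lambda>(a, b). a \<diamondop> b)"
    using top by (simp add: topological_groupoid_def)
  then have "continuous_on S ((\<lambda>(a, b). a \<diamondop> b) \<circ> (\<lambda>x. (f x, g x)))"
    using assms by (intro continuous_on_compose continuous_intros) (auto elim!: continuous_on_subset)
  then show ?thesis by (simp add: o_def)
qed

lemma open_units: "open U\<^sub>0"
  using effective by (simp add: effective_def)

lemma etale_nhd:
  obtains U s where "open U" "a \<in> U" "open (d ` U)" "homeomorphism U (d ` U) d s"
proof -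
  obtain U s where "open U" "a \<in> U" "openin (top_of_set U\<^sub>0) (d ` U)" "homeomorphism U (d ` U) d s"
    using etale unfolding etale_def by meson
  then show ?thesis using that open_units by (meson openin_open_eq)
qed

lemma continuous_d: "continuous_on S d"
proof -
  have "isCont d a" for a
  proof -
    obtain U s where "open U" "a \<in> U" "homeomorphism U (d ` U) d s" by (rule etale_nhd)
    then show ?thesis by (metis continuous_on_eq_continuous_at homeomorphism_cont1)
  qed
  then show ?thesis by (simp add: continuous_at_imp_continuous_on)
qed

lemma continuous_r: "continuous_on S r"
proof -
  have "continuous_on S (d \<circ> iv)"
    by (intro continuous_on_compose continuous_iv continuous_d)
  then show ?thesis by (simp add: o_def)
qed

lemma closed_units: "closed U\<^sub>0"
proof -
  have "closed {a. d a = a}"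
    by (intro closed_Collect_eq continuous_d continuous_on_id)
  moreover have "{a. d a = a} = U\<^sub>0" by (auto simp: unit_iff)
  ultimately show ?thesis by simp
qed

lemma open_image_d:
  assumes "open U"
  shows "open (d ` U)"
proof (subst open_subopen, intro ballI)
  fix y assume "y \<in> d ` U"
  then obtain a where a: "a \<in> U" "y = d a" by auto
  obtain V s where V: "open V" "a \<in> V" "open (d ` V)" "homeomorphism V (d ` V) d s"
    by (rule etale_nhd)
  have "openin (top_of_set (d ` V)) (d ` (V \<inter> U))"
    by (rule homeomorphism_imp_open_map[OF V(4)]) (use assms in \<open>auto simp: openin_open\<close>)
  then have "open (d ` (V \<inter> U))"
    using V(3) by (simp add: openin_open_eq)
  then show "\<exists>T. open T \<and> y \<in> T \<and> T \<subseteq> d ` U"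
    using a V(2) by blast
qed

lemma open_image_r: "open U \<Longrightarrow> open (r ` U)"
  using open_image_d[OF open_iv[of U]] by (simp add: image_image)

lemma open_vimage_r: "open U \<Longrightarrow> open (r -` U)"
  using continuous_r[of UNIV] by (simp add: continuous_on_open_vimage)

section \<open>Bisections and local inverses of the range map\<close>

definition bisection :: "'g set \<Rightarrow> bool"
  where "bisection U \<longleftrightarrow> inj_on d U \<and> inj_on r U"

lemma bisection_subset: "bisection U \<Longrightarrow> V \<subseteq> U \<Longrightarrow> bisection V"
  unfolding bisection_def by (meson inj_on_subset)

lemma bisectionD: "bisection U \<Longrightarrow> a \<in> U \<Longrightarrow> b \<in> U \<Longrightarrow> d a = d b \<Longrightarrow> a = b"
  "bisection U \<Longrightarrow> a \<in> U \<Longrightarrow> b \<in> U \<Longrightarrow> r a = r b \<Longrightarrow> a = b"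
  unfolding bisection_def by (meson inj_onD)+

text \<open>The source map is injective near \<open>a\<close> and near \<open>iv a\<close>. Since
  the range of an arrow is the source of its inverse, inverting the second neighbourhood makes the
  range map injective too.\<close>

lemma open_bisection_nhd:
  obtains U where "open U" "a \<in> U" "bisection U"
proof -
  obtain U s where U: "open U" "a \<in> U" "homeomorphism U (d ` U) d s" by (rule etale_nhd)
  obtain V t where V: "open V" "iv a \<in> V" "homeomorphism V (d ` V) d t" by (rule etale_nhd)
  have "inj_on d U" "inj_on d V"
    using U(3) V(3) by (metis homeomorphism_def inj_on_inverseI)+
  then have "inj_on d (U \<inter> iv ` V)"
    by (meson inj_on_subset inf_le1)
  moreover have "inj_on r (U \<inter> iv ` V)"
  proof (rule inj_onI)
    fix x y assume *: "x \<in> U \<inter> iv ` V" "y \<in> U \<inter> iv ` V" "r x = r y"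
    then have "iv x \<in> V" "iv y \<in> V" by auto
    then have "iv x = iv y" using inj_onD[OF \<open>inj_on d V\<close>, of "iv x" "iv y"] *(3) by simp
    then show "x = y" by (metis inv_inv)
  qed
  moreover have "a \<in> U \<inter> iv ` V" using U(2) V(2) by (metis IntI imageI inv_inv)
  ultimately show ?thesis
    using that[of "U \<inter> iv ` V"] U(1) open_iv[OF V(1)] by (auto simp: bisection_def)
qed

lemma bisection_units: "bisection U\<^sub>0"
  by (auto simp: bisection_def inj_on_def unitD)

lemma local_section:
  assumes "open U" "inj_on r U"
  shows "continuous_on (r ` U) (inv_into U r)" and "a \<in> U \<Longrightarrow> inv_into U r (r a) = a"
proof -
  show "continuous_on (r ` U) (inv_into U r)"
  proof (rule continuous_on_inverse_open_map[OF continuous_r refl])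
    show "openin (top_of_set (r ` U)) (r ` V)" if "openin (top_of_set U) V" for V
      using that open_image_r assms(1)
      by (metis image_mono open_subset openin_imp_subset openin_open_eq)
  qed (use assms in simp)
  show "a \<in> U \<Longrightarrow> inv_into U r (r a) = a" using assms(2) by simp
qed

text \<open>An arrow \<open>c\<close> with range in the image of \<open>U\<close> factors uniquely
  as \<open>w \<diamondop> (iv w \<diamondop> c)\<close> with \<open>w\<close> in \<open>U\<close>,
  and both factors vary continuously. This local division gives openness of multiplication and
  continuity of convolutions.\<close>

lemma local_quotient:
  assumes "open U" "inj_on r U"
  shows "continuous_on (r -` r ` U) (\<lambda>c. inv_into U r (r c))"
    and "continuous_on (r -` r ` U) (\<lambda>c. iv (inv_into U r (r c)) \<diamondop> c)"
proof -
  show 1: "continuous_on (r -` r ` U) (\<lambda>c. inv_into U r (r c))"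
    using continuous_on_compose[OF continuous_r[of "r -` r ` U"], of "inv_into U r"]
      continuous_on_subset[OF local_section(1)[OF assms]] by (auto simp: o_def)
  show "continuous_on (r -` r ` U) (\<lambda>c. iv (inv_into U r (r c)) \<diamondop> c)"
    by (intro continuous_gm continuous_on_compose2[OF continuous_iv 1] continuous_on_id)
      (auto simp: local_section(2)[OF assms])
qed

text \<open>Near the product of \<open>a\<close> and \<open>b\<close>, the first factor can be kept
  in a small bisection around \<open>a\<close> and chosen as a continuous function of the product;
  the second factor then stays in \<open>V\<close>.\<close>

lemma open_mult:
  assumes "open U" "open V"
  shows "open {a \<diamondop> b |a b. a \<in> U \<and> b \<in> V \<and> d a = r b}"
proof (subst open_subopen, intro ballI)
  fix c assume "c \<in> {a \<diamondop> b |a b. a \<in> U \<and> b \<in> V \<and> d a = r b}"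
  then obtain a b where ab: "c = a \<diamondop> b" "a \<in> U" "b \<in> V" "d a = r b" by blast
  obtain W where W: "open W" "a \<in> W" "bisection W" by (rule open_bisection_nhd)
  let ?W = "U \<inter> W"
  have oW: "open ?W" "inj_on r ?W"
    using assms W by (auto simp: bisection_def intro: inj_on_subset)
  define T where "T = (r -` r ` ?W) \<inter> (\<lambda>c. iv (inv_into ?W r (r c)) \<diamondop> c) -` V"
  have "open T"
    unfolding T_def
    by (rule continuous_open_preimage[OF local_quotient(2)[OF oW] open_vimage_r[OF open_image_r[OF oW(1)]] assms(2)])
  moreover have "c \<in> T"
    using ab W local_section(2)[OF oW, of a] by (auto simp: T_def)
  moreover have "T \<subseteq> {a \<diamondop> b |a b. a \<in> U \<and> b \<in> V \<and> d a = r b}"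
  proof
    fix t assume "t \<in> T"
    then obtain w where w: "w \<in> ?W" "r t = r w" "iv w \<diamondop> t \<in> V"
      using local_section(2)[OF oW] by (auto simp: T_def)
    then have "t = w \<diamondop> (iv w \<diamondop> t)" "d w = r (iv w \<diamondop> t)" by simp_all
    with w show "t \<in> {a \<diamondop> b |a b. a \<in> U \<and> b \<in> V \<and> d a = r b}" by blast
  qed
  ultimately show "\<exists>T. open T \<and> c \<in> T \<and> T \<subseteq> {a \<diamondop> b |a b. a \<in> U \<and> b \<in> V \<and> d a = r b}"
    by blast
qed

text \<open>Apart from openness of the units, effectiveness is used only in this form: the set of
  products is open and consists of isotropy by \<open>iso\<close>, so it lies in the interior that
  is the unit space.\<close>

lemma effectiveD:
  assumes "open U" "open V" and iso: "\<And>a b. a \<in> U \<Longrightarrow> b \<in> V \<Longrightarrow> d a = r b \<Longrightarrow> d b = r a"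
    and "a \<in> U" "b \<in> V" "d a = r b"
  shows "a \<diamondop> b \<in> U\<^sub>0"
proof -
  have "{a \<diamondop> b |a b. a \<in> U \<and> b \<in> V \<and> d a = r b} \<subseteq> interior {c. d c = r c}"
    by (rule interior_maximal[OF _ open_mult[OF assms(1,2)]]) (auto simp: iso)
  then show ?thesis using assms effective by (auto simp: effective_def)
qed

section \<open>Bump functions and decomposition into pieces on bisections\<close>

lemma bump:
  assumes "open W" "a \<in> W"
  obtains p :: "'g \<Rightarrow> real" where "continuous_on UNIV p" "\<And>x. 0 \<le> p x" "\<And>x. p x \<le> 1" "p a = 1"
    "compact (closure {x. p x \<noteq> 0})" "closure {x. p x \<noteq> 0} \<subseteq> W"
proof -
  let ?X = "euclidean :: 'g topology"
  have reg: "regular_space ?X"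
    by (rule locally_compact_Hausdorff_imp_regular_space[OF lc])
      (simp add: Hausdorff_space_def disjnt_def, metis hausdorff)
  have "neighbourhood_base_of (compactin ?X) ?X"
    by (rule locally_compact_imp_neighbourhood_base[OF lc reg])
  then obtain V K where K: "open V" "compact K" "a \<in> V" "V \<subseteq> K" "K \<subseteq> W"
    using assms unfolding neighbourhood_base_of by auto metis
  have cr: "completely_regular_space ?X"
    using reg completely_regular_eq_regular_space[OF lc] by blast
  have "compactin ?X {a}" "closedin ?X (- V)" "disjnt {a} (- V)"
    using K by auto
  from Urysohn_completely_regular_compact_closed[OF zero_le_one cr this]
  obtain f where f: "continuous_map ?X (subtopology euclidean {0..1::real}) f" "f ` (- V) \<subseteq> {0}" "f ` {a} \<subseteq> {1}"
    by metis
  have cont: "continuous_on UNIV f" and rng: "\<And>x. f x \<in> {0..1}"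
    using f(1) by (auto simp: continuous_map_in_subtopology)
  have sub: "closure {x. f x \<noteq> 0} \<subseteq> K"
    by (rule closure_minimal) (use f(2) K compact_imp_closed in auto)
  then have "compact (closure {x. f x \<noteq> 0})"
    using compact_Int_closed[OF K(2) closed_closure, of "{x. f x \<noteq> 0}"] by (simp add: Int_absorb1)
  with that[of f] cont rng sub f(3) K(5) show ?thesis by auto
qed

lemma bump_Cc:
  fixes W :: "'g set"
  assumes "open W" "a \<in> W"
  obtains f where "f \<in> Cc W" "f a = 1" "\<And>x. cnj (f x) = f x"
proof -
  obtain p :: "'g \<Rightarrow> real" where p: "continuous_on UNIV p" "\<And>x. 0 \<le> p x" "\<And>x. p x \<le> 1" "p a = 1"
    "compact (closure {x. p x \<noteq> 0})" "closure {x. p x \<noteq> 0} \<subseteq> W"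
    by (rule bump[OF assms]) blast
  then have "(\<lambda>x. complex_of_real (p x)) \<in> Cc W"
    by (auto simp: Cc_def intro!: continuous_intros)
  with p that[of "\<lambda>x. complex_of_real (p x)"] show ?thesis by simp
qed

text \<open>A partition of unity, combined with the positive and negative parts of the real and
  imaginary parts.\<close>

lemma Cc_induct [consumes 1, case_names bisection add scale]:
  assumes f: "f \<in> Cc W"
    and bis: "\<And>g U. open U \<Longrightarrow> bisection U \<Longrightarrow> (\<And>x. of_real (cmod (g x)) = g x) \<Longrightarrow>
        g \<in> Cc (U \<inter> W) \<Longrightarrow> P g"
    and add: "\<And>g h. g \<in> Cc W \<Longrightarrow> h \<in> Cc W \<Longrightarrow> P g \<Longrightarrow> P h \<Longrightarrow> P (\<lambda>x. g x + h x)"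
    and scale: "\<And>c g. g \<in> Cc W \<Longrightarrow> P g \<Longrightarrow> P (\<lambda>x. c * g x)"
  shows "P f"
proof -
  let ?Q = "\<lambda>g. g \<in> Cc W \<and> P g"
  have zero: "?Q (\<lambda>_. 0)"
    using bis[of "{}" "\<lambda>_. 0"] by (simp add: Cc_zero bisection_def)
  have one: "?Q g" if g: "g \<in> Cc (U \<inter> W)" and U: "open U" "bisection U" for g U
  proof -
    have gW: "g \<in> Cc W" by (rule Cc_mono[OF g]) simp
    \<comment> \<open>With \<open>q\<close> running through the real part, the imaginary part and
      their negatives, these pieces recombine to \<open>g\<close>.\<close>
    have pos: "?Q (\<lambda>x. complex_of_real (max 0 (q (g x))))"
      if q: "continuous_on UNIV q" "q 0 = 0" for q :: "complex \<Rightarrow> real"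
    proof -
      have "(\<lambda>x. complex_of_real (max 0 (q (g x)))) \<in> Cc (U \<inter> W)"
      proof (rule CcI[where K = "closure {a. g a \<noteq> 0}"])
        show "continuous_on UNIV (\<lambda>x. complex_of_real (max 0 (q (g x))))"
          by (intro continuous_intros continuous_on_compose2[OF q(1) CcD(1)[OF g]]) simp
        fix a assume "complex_of_real (max 0 (q (g a))) \<noteq> 0"
        then have "g a \<noteq> 0" using q(2) by auto
        then show "a \<in> closure {a. g a \<noteq> 0}" by (rule CcD(4)[OF g])
      qed (use CcD[OF g] in auto)
      then show ?thesis
        using bis[OF U, of "\<lambda>x. complex_of_real (max 0 (q (g x)))"] by (auto intro: Cc_mono)
    qed
    have [simp]: "continuous_on UNIV (\<lambda>z. - Re z)" "continuous_on UNIV (\<lambda>z. - Im z)"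
      by (intro continuous_intros)+
    have sc: "?Q (\<lambda>x. c * complex_of_real (max 0 (q (g x))))"
      if q: "continuous_on UNIV q" "q 0 = 0" for q c
      using pos[OF q] scale Cc_cmult by blast
    have ad: "?Q (\<lambda>x. g x + h x)" if "?Q g" "?Q h" for g h
      using that add Cc_add by blast
    have "?Q (\<lambda>x. ((1 * complex_of_real (max 0 (Re (g x)))
        + (-1) * complex_of_real (max 0 (- Re (g x))))
        + \<i> * complex_of_real (max 0 (Im (g x)))) + (-\<i>) * complex_of_real (max 0 (- Im (g x))))"
      by (intro ad sc continuous_intros) simp_all
    moreover have "(\<lambda>x. ((1 * complex_of_real (max 0 (Re (g x)))
        + (-1) * complex_of_real (max 0 (- Re (g x))))
        + \<i> * complex_of_real (max 0 (Im (g x)))) + (-\<i>) * complex_of_real (max 0 (- Im (g x)))) = g"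
      by (auto simp: fun_eq_iff complex_eq_iff)
    ultimately show ?thesis by simp
  qed
  define K where "K = closure {a. f a \<noteq> 0}"
  have K: "compact K" using CcD(2)[OF f] by (simp add: K_def)
  have "\<forall>a. \<exists>U p. open U \<and> bisection U \<and> continuous_on UNIV p \<and> (\<forall>x. 0 \<le> p x) \<and> p a = (1::real) \<and>
      closure {x. p x \<noteq> 0} \<subseteq> U"
  proof
    fix a
    obtain U where U: "open U" "a \<in> U" "bisection U" by (rule open_bisection_nhd)
    obtain p :: "'g \<Rightarrow> real" where "continuous_on UNIV p" "\<And>x. 0 \<le> p x" "\<And>x. p x \<le> 1" "p a = 1"
      "compact (closure {x. p x \<noteq> 0})" "closure {x. p x \<noteq> 0} \<subseteq> U"
      by (rule bump[OF U(1,2)]) blast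
    with U show "\<exists>U p. open U \<and> bisection U \<and> continuous_on UNIV p \<and> (\<forall>x. 0 \<le> p x) \<and> p a = (1::real) \<and>
      closure {x. p x \<noteq> 0} \<subseteq> U" by blast
  qed
  then obtain U p where Up: "\<And>a. open (U a)" "\<And>a. bisection (U a)" "\<And>a. continuous_on UNIV (p a)"
    "\<And>a x. 0 \<le> p a x" "\<And>a. p a a = (1::real)" "\<And>a. closure {x. p a x \<noteq> 0} \<subseteq> U a"
    by metis
  have "K \<subseteq> (\<Union>a\<in>K. {x. 0 < p a x})"
    by (intro subsetI UN_I) (auto simp: Up(5))
  moreover have "open {x. 0 < p a x}" for a
    by (intro open_Collect_less continuous_on_const Up)
  ultimately obtain I where I: "I \<subseteq> K" "finite I" "K \<subseteq> (\<Union>a\<in>I. {x. 0 < p a x})"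
    using compactE_image[OF K, of K "\<lambda>a. {x. 0 < p a x}"] by metis
  define S where "S x = (\<Sum>a\<in>I. p a x)" for x
  have S: "continuous_on UNIV S" unfolding S_def by (intro continuous_intros Up)
  have Spos: "S x > 0" if xK: "x \<in> K" for x
  proof -
    obtain a where a: "a \<in> I" "0 < p a x" using xK I(3) by auto
    show ?thesis unfolding S_def by (rule sum_pos2[OF I(2) a(1)]) (use a(2) Up(4) in auto)
  qed
  \<comment> \<open>Dividing by the sum \<open>S\<close> normalizes the weights \<open>p a\<close>.
    As \<open>S\<close> can vanish only off \<open>K\<close>, where \<open>f\<close> is zero, the
    quotient is continuous everywhere.\<close>
  define q where "q x = f x / complex_of_real (S x)" for x
  have q0: "q x = 0" if "x \<notin> K" for x
    using that CcD(4)[OF f, of x] by (auto simp: q_def K_def)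
  have q: "continuous_on UNIV q"
  proof (rule continuous_extend_zero[of "{x. S x \<noteq> 0}" _ K])
    show "open {x. S x \<noteq> 0}" using S by (intro open_Collect_neq continuous_on_const)
    show "continuous_on {x. S x \<noteq> 0} q" unfolding q_def
      using CcD(1)[OF f] S by (intro continuous_intros) (auto elim: continuous_on_subset)
  qed (use K compact_imp_closed Spos q0 in force)+
  have piece: "?Q (\<lambda>x. complex_of_real (p a x) * q x)" for a
  proof (rule one[OF _ Up(1,2)])
    show "(\<lambda>x. complex_of_real (p a x) * q x) \<in> Cc (U a \<inter> W)"
    proof (rule CcI[where K = "K \<inter> closure {x. p a x \<noteq> 0}"])
      show "compact (K \<inter> closure {x. p a x \<noteq> 0})" using K by (intro compact_Int_closed) auto
      show "K \<inter> closure {x. p a x \<noteq> 0} \<subseteq> U a \<inter> W"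
        using CcD(3)[OF f] Up(6)[of a] by (auto simp: K_def)
      fix x assume "complex_of_real (p a x) * q x \<noteq> 0"
      then show "x \<in> K \<inter> closure {x. p a x \<noteq> 0}"
        using q0[of x] closure_subset[of "{x. p a x \<noteq> 0}"] by auto
    qed (intro continuous_intros Up q)
  qed
  have "?Q (\<lambda>x. \<Sum>a\<in>J. complex_of_real (p a x) * q x)" if "finite J" for J
    using that
  proof induction
    case (insert a J)
    have "?Q (\<lambda>x. complex_of_real (p a x) * q x + (\<Sum>a\<in>J. complex_of_real (p a x) * q x))"
      using piece[of a] insert.IH by (intro conjI Cc_add add) auto
    then show ?case using insert.hyps by simp
  qed (simp add: zero)
  from this[OF I(2)] have "?Q (\<lambda>x. complex_of_real (S x) * q x)"
    by (simp add: S_def sum_distrib_right)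
  moreover have "(\<lambda>x. complex_of_real (S x) * q x) = f"
  proof
    fix x
    show "complex_of_real (S x) * q x = f x"
      using Spos[of x] q0[of x] CcD(4)[OF f, of x] by (cases "x \<in> K") (auto simp: q_def K_def)
  qed
  ultimately show ?thesis by simp
qed

end

section \<open>Matrix coefficients\<close>

instance ell2 :: (type) banach ..

text \<open>The factor 2 comes from adding the bounds for the real and the imaginary part; for
  continuity any constant serves.\<close>

lemma cmod_cinner_le: "cmod (cinner_ell2 x y) \<le> norm y * (2 * norm x)"
proof -
  have "cmod (cinner_ell2 x y) \<le> \<bar>inner x y\<bar> + \<bar>inner (scaleC_ell2 \<i> x) y\<bar>"
    unfolding cinner_eq_inner using cmod_le[of "Complex (inner x y) (inner (scaleC_ell2 \<i> x) y)"] by simp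
  also have "\<dots> \<le> norm x * norm y + norm (scaleC_ell2 \<i> x) * norm y"
    by (intro add_mono Cauchy_Schwarz_ineq2)
  finally show ?thesis by (simp add: norm_scaleC_ell2 algebra_simps)
qed

lemma bounded_linear_cinner_right: "bounded_linear (cinner_ell2 x)"
proof (rule bounded_linear_intro)
  show "cinner_ell2 x (y + z) = cinner_ell2 x y + cinner_ell2 x z" for y z
    by (rule cinner_add_right)
  show "cinner_ell2 x (t *\<^sub>R y) = t *\<^sub>R cinner_ell2 x y" for t y
    using cinner_scaleC_right[of x "of_real t" y]
    by (simp add: scaleC_ell2_of_real scaleR_conv_of_real)
qed (rule cmod_cinner_le)

text \<open>The matrix condition says that row \<open>a\<close> of \<open>T\<close> is the
  functional given by \<open>S (ket a)\<close>. Density of the span of the basis is used twice,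
  first in the argument \<open>x\<close>, then in \<open>y\<close>.\<close>

lemma is_adjoint_ketI:
  assumes S: "complex_linear_op S" and T: "complex_linear_op T"
    and eq: "\<And>a b. Rep_ell2 (T (ket b)) a = cnj (Rep_ell2 (S (ket a)) b)"
  shows "is_adjoint S T"
proof -
  note [simp] = S[unfolded complex_linear_op_def] T[unfolded complex_linear_op_def]
  note comp = bounded_linear_compose[OF _ blinfun.bounded_linear_right]
  have *: "Rep_ell2 (T x) a = cinner_ell2 (S (ket a)) x" for x a
    by (rule ell2_bounded_linear_eqI[OF comp[OF bounded_linear_Rep_ell2] bounded_linear_cinner_right])
      (simp add: scaleC_ell2.rep_eq cinner_scaleC_right cinner_ket_right eq)
  have "cinner_ell2 (T x) y = cinner_ell2 x (S y)" for x y
    by (rule ell2_bounded_linear_eqI[OF bounded_linear_cinner_right comp[OF bounded_linear_cinner_right]])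
      (simp add: cinner_scaleC_right cinner_ket_right * flip: cinner_ell2_commute)
  then show ?thesis by (simp add: is_adjoint_def)
qed

text \<open>The description is meaningful only when an adjoint exists; \<open>is_adjoint_adj\<close>
  supplies one for each element of the reduced algebra.\<close>

definition adj :: "'a op \<Rightarrow> 'a op"
  where "adj T = (THE S. is_adjoint S T)"

lemma adj_eq: "is_adjoint S T \<Longrightarrow> adj T = S"
  unfolding adj_def using is_adjoint_unique by blast

lemma Rep_adjoint_ket: "is_adjoint S T \<Longrightarrow> Rep_ell2 (S (ket a)) b = cnj (Rep_ell2 (T (ket b)) a)"
  using cinner_ket[of b "S (ket a)"] cinner_ket_right[of "T (ket b)" a] by (simp add: is_adjoint_def)

context effective_etale_groupoid
begin

abbreviation "L \<equiv> reg_rep G"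

text \<open>This is Renault's contractive map \<open>j\<close> from the reduced algebra into \<open>C\<^sub>0(G)\<close>.\<close>

definition coef :: "'g op \<Rightarrow> 'g \<Rightarrow> complex"
  where "coef T a = Rep_ell2 (T (ket (d a))) a"

lemma L_apply: "f \<in> Cc UNIV \<Longrightarrow> Rep_ell2 (L f x) a = gconv G f (Rep_ell2 x) a"
  unfolding gconv_def by (rule reg_rep_apply[OF top etale])

lemma L_ket: "f \<in> Cc UNIV \<Longrightarrow> Rep_ell2 (L f (ket b)) a = (if d a = d b then f (a \<diamondop> iv b) else 0)"
  unfolding L_apply gconv_def
  by (cases "d a = d b", subst infsum_single[of _ b]) (auto simp: ket.rep_eq intro!: infsum_0)

lemma coef_L [simp]: "f \<in> Cc UNIV \<Longrightarrow> coef (L f) = f"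
  by (simp add: coef_def L_ket fun_eq_iff)

lemma L_complex_linear: "f \<in> Cc UNIV \<Longrightarrow> complex_linear_op (L f)"
  unfolding complex_linear_op_def Rep_ell2_inject[symmetric]
  by (simp add: fun_eq_iff L_apply scaleC_ell2.rep_eq gconv_def mult.left_commute infsum_cmult_right')

lemma complex_linear_op_add: "complex_linear_op S \<Longrightarrow> complex_linear_op T \<Longrightarrow> complex_linear_op (S + T)"
  by (simp add: complex_linear_op_def plus_blinfun.rep_eq linear_simps[OF bounded_linear_scaleC_ell2])

lemma complex_linear_op_scaleC: "complex_linear_op T \<Longrightarrow> complex_linear_op (scaleC_op c T)"
  by (simp add: complex_linear_op_def scaleC_op_apply Rep_ell2_inject[symmetric] scaleC_ell2.rep_eq
      fun_eq_iff mult.left_commute)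

lemma complex_linear_op_compose: "complex_linear_op S \<Longrightarrow> complex_linear_op T \<Longrightarrow> complex_linear_op (S o\<^sub>L T)"
  by (simp add: complex_linear_op_def)

lemma L_add: "f \<in> Cc UNIV \<Longrightarrow> g \<in> Cc UNIV \<Longrightarrow> L (\<lambda>x. f x + g x) = L f + L g"
  by (intro op_eqI L_complex_linear complex_linear_op_add Cc_add)
    (auto simp: Rep_ell2_inject[symmetric] fun_eq_iff L_ket Cc_add plus_blinfun.rep_eq plus_ell2.rep_eq)

lemma L_scale: "f \<in> Cc UNIV \<Longrightarrow> L (\<lambda>x. c * f x) = scaleC_op c (L f)"
  by (intro op_eqI L_complex_linear complex_linear_op_scaleC Cc_cmult)
    (auto simp: Rep_ell2_inject[symmetric] fun_eq_iff L_ket Cc_cmult Rep_scaleC_op)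

lemma reduced_algebra_closed: "closed (reduced_algebra G H)"
  by (simp add: reduced_algebra_def)

lemma L_in: "f \<in> Cc H \<Longrightarrow> L f \<in> reduced_algebra G H"
  by (auto simp: reduced_algebra_def intro: closure_subset[THEN subsetD])

lemma reduced_algebra_mono: "H \<subseteq> K \<Longrightarrow> reduced_algebra G H \<subseteq> reduced_algebra G K"
  unfolding reduced_algebra_def by (intro closure_mono image_mono) (auto intro: Cc_mono)

lemma reduced_algebra_induct [consumes 1, case_names closed L]:
  assumes "T \<in> reduced_algebra G H" "closed {T. P T}" "\<And>f. f \<in> Cc H \<Longrightarrow> P (L f)"
  shows "P T"
proof -
  have "closure (L ` Cc H) \<subseteq> {T. P T}"
    by (rule closure_minimal) (use assms in auto)
  then show ?thesis using assms(1) by (auto simp: reduced_algebra_def)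
qed

lemma reduced_algebra_seq:
  assumes "T \<in> reduced_algebra G H"
  shows "\<exists>f. (\<forall>n. f n \<in> Cc H) \<and> (\<lambda>n. L (f n)) \<longlonglongrightarrow> T"
proof -
  obtain X where X: "\<And>n. X n \<in> L ` Cc H" "X \<longlonglongrightarrow> T"
    using assms by (auto simp: reduced_algebra_def closure_sequential)
  then have "\<forall>n. \<exists>f. f \<in> Cc H \<and> X n = L f" by auto
  then obtain f where f: "\<And>n. f n \<in> Cc H" "\<And>n. X n = L (f n)" by metis
  then have "X = (\<lambda>n. L (f n))" by auto
  with X(2) f(1) show ?thesis by auto
qed

lemma reduced_algebra_add:
  assumes "S \<in> reduced_algebra G H" "T \<in> reduced_algebra G H"
  shows "S + T \<in> reduced_algebra G H"
proof -
  obtain f where f: "\<And>n. f n \<in> Cc H" "(\<lambda>n. L (f n)) \<longlonglongrightarrow> S" using reduced_algebra_seq[OF assms(1)] by blast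
  obtain g where g: "\<And>n. g n \<in> Cc H" "(\<lambda>n. L (g n)) \<longlonglongrightarrow> T" using reduced_algebra_seq[OF assms(2)] by blast
  have "L (f n) + L (g n) = L (\<lambda>x. f n x + g n x)" for n
    using f(1) g(1) by (intro L_add[symmetric]) (auto intro: Cc_mono)
  then have "L (f n) + L (g n) \<in> reduced_algebra G H" for n
    using L_in[OF Cc_add[OF f(1) g(1)]] by simp
  then show ?thesis
    by (rule closed_sequentially[OF reduced_algebra_closed _ tendsto_add[OF f(2) g(2)]])
qed

lemma reduced_algebra_scaleC:
  assumes "T \<in> reduced_algebra G H"
  shows "scaleC_op c T \<in> reduced_algebra G H"
proof -
  obtain f where f: "\<And>n. f n \<in> Cc H" "(\<lambda>n. L (f n)) \<longlonglongrightarrow> T" using reduced_algebra_seq[OF assms(1)] by blast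
  have "scaleC_op c (L (f n)) = L (\<lambda>x. c * f n x)" for n
    using f(1) by (intro L_scale[symmetric]) (auto intro: Cc_mono)
  then have "scaleC_op c (L (f n)) \<in> reduced_algebra G H" for n
    using L_in[OF Cc_cmult[OF f(1)]] by simp
  then show ?thesis
    by (rule closed_sequentially[OF reduced_algebra_closed _ bounded_linear.tendsto[OF bounded_linear_scaleC_op f(2)]])
qed

abbreviation "A \<equiv> Cr G"

lemmas A_add = reduced_algebra_add[of _ UNIV]
lemmas A_scaleC = reduced_algebra_scaleC[of _ UNIV]

lemma A_scaleR: "T \<in> A \<Longrightarrow> t *\<^sub>R T \<in> A"
  using A_scaleC[of T "of_real t"] by (simp add: scaleC_op_of_real)

lemma A_diff: "S \<in> A \<Longrightarrow> T \<in> A \<Longrightarrow> S - T \<in> A"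
  using A_add[of S "(-1) *\<^sub>R T"] A_scaleR[of T "-1"] by simp

lemma A_zero: "0 \<in> A"
  using L_in[OF Cc_zero, of UNIV] A_scaleR[of _ 0] by fastforce

lemma bounded_linear_entry: "bounded_linear (\<lambda>T. Rep_ell2 (blinfun_apply T x) a)"
  by (rule bounded_linear_compose[OF bounded_linear_Rep_ell2 blinfun.bounded_linear_left])

lemma bounded_linear_coef: "bounded_linear (\<lambda>T. coef T a)"
  unfolding coef_def by (rule bounded_linear_entry)

lemma continuous_coef_op [continuous_intros]: "continuous_on S f \<Longrightarrow> continuous_on S (\<lambda>x. coef (f x) a)"
  by (rule bounded_linear.continuous_on[OF bounded_linear_coef])

lemma continuous_entry [continuous_intros]:
  "continuous_on S f \<Longrightarrow> continuous_on S (\<lambda>x. Rep_ell2 (blinfun_apply (f x) y) a)"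
  by (rule bounded_linear.continuous_on[OF bounded_linear_entry])

lemmas coef_linear = linear_simps[OF bounded_linear_coef]

lemma coef_scaleC: "coef (scaleC_op c T) a = c * coef T a"
  by (simp add: coef_def Rep_scaleC_op)

lemma coef_le_norm: "cmod (coef T a) \<le> norm T"
proof -
  have "cmod (coef T a) \<le> norm (T (ket (d a)))" unfolding coef_def by (rule cmod_Rep_ell2_le)
  also have "\<dots> \<le> norm T" using norm_blinfun[of T "ket (d a)"] by simp
  finally show ?thesis .
qed

lemma A_complex_linear: "T \<in> A \<Longrightarrow> complex_linear_op T"
proof (induction T rule: reduced_algebra_induct)
  case closed
  have eq: "{T. complex_linear_op T} = (\<Inter>c. \<Inter>x. {T. blinfun_apply T (scaleC_ell2 c x) = scaleC_ell2 c (T x)})"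
    by (auto simp: complex_linear_op_def)
  have cl: "closed {T. blinfun_apply T (scaleC_ell2 c x) = scaleC_ell2 c (T x)}" for c x
    by (intro closed_Collect_eq bounded_linear.continuous_on[OF bounded_linear_scaleC_ell2]
        bounded_linear.continuous_on[OF blinfun.bounded_linear_left] continuous_on_id)
  show ?case unfolding eq by (intro closed_INT ballI cl)
qed (rule L_complex_linear)

text \<open>That an entry depends only on the quotient of the row arrow by the column arrow is a
  closed condition, inherited from \<open>L_ket\<close>. Hence the coefficient function determines
  the operator, as \<open>coef_eqI\<close> records.\<close>

lemma A_ket: "T \<in> A \<Longrightarrow> Rep_ell2 (T (ket b)) a = (if d a = d b then coef T (a \<diamondop> iv b) else 0)"
proof (induction T rule: reduced_algebra_induct)
  case closed
  show ?case by (cases "d a = d b") (auto intro!: closed_Collect_eq continuous_intros)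
qed (simp add: L_ket)

lemma coef_eqI: "S \<in> A \<Longrightarrow> T \<in> A \<Longrightarrow> (\<And>a. coef S a = coef T a) \<Longrightarrow> S = T"
  by (intro op_eqI A_complex_linear) (simp_all add: Rep_ell2_inject[symmetric] fun_eq_iff A_ket)

lemma Cc_star: "f \<in> Cc UNIV \<Longrightarrow> (\<lambda>a. cnj (f (iv a))) \<in> Cc UNIV"
proof (rule CcI[where K = "iv ` closure {a. f a \<noteq> 0}"])
  assume f: "f \<in> Cc UNIV"
  show "continuous_on UNIV (\<lambda>a. cnj (f (iv a)))"
    by (intro continuous_intros continuous_on_compose2[OF CcD(1)[OF f] continuous_iv]) simp
  show "compact (iv ` closure {a. f a \<noteq> 0})"
    by (intro compact_continuous_image continuous_iv CcD(2)[OF f])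
  show "a \<in> iv ` closure {a. f a \<noteq> 0}" if "cnj (f (iv a)) \<noteq> 0" for a
    using that CcD(4)[OF f, of "iv a"] by (metis complex_cnj_zero imageI inv_inv)
qed simp

text \<open>The conjugate transpose of the matrix with entries
  \<open>f (a \<diamondop> iv b)\<close> has this form because inversion exchanges the two arrows in
  a quotient.\<close>

lemma is_adjoint_L:
  assumes f: "f \<in> Cc UNIV"
  shows "is_adjoint (L (\<lambda>a. cnj (f (iv a)))) (L f)"
  by (rule is_adjoint_ketI) (auto simp: f Cc_star L_complex_linear L_ket inv_mult)

text \<open>Passing to adjoints preserves norms, so the adjoints of the approximating
  \<open>L (f n)\<close> again form a Cauchy sequence, and its limit is the adjoint of
  \<open>T\<close>.\<close>

lemma is_adjoint_adj:
  assumes "T \<in> A"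
  shows "is_adjoint (adj T) T" "adj T \<in> A"
proof -
  obtain f where f: "\<And>n. f n \<in> Cc UNIV" "(\<lambda>n. L (f n)) \<longlonglongrightarrow> T" using reduced_algebra_seq[OF assms(1)] by blast
  let ?S = "\<lambda>n. L (\<lambda>a. cnj (f n (iv a)))"
  have *: "norm (?S m - ?S n) = norm (L (f m) - L (f n))" for m n
    by (intro norm_adjoint is_adjoint_minus is_adjoint_L f)
  have "Cauchy (\<lambda>n. L (f n))" using f(2) by (auto intro: LIMSEQ_imp_Cauchy)
  then have "Cauchy ?S" by (simp add: Cauchy_def dist_norm *)
  then have "convergent ?S" by (rule Cauchy_convergent)
  then obtain S where S: "?S \<longlonglongrightarrow> S" unfolding convergent_def by blast
  have "is_adjoint S T" by (rule is_adjoint_limit[OF is_adjoint_L[OF f(1)] S f(2)])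
  moreover have "S \<in> A"
    by (rule closed_sequentially[OF reduced_algebra_closed _ S]) (intro L_in Cc_star f)
  ultimately show "is_adjoint (adj T) T" "adj T \<in> A" by (simp_all add: adj_eq)
qed

lemma coef_adj: "T \<in> A \<Longrightarrow> coef (adj T) a = cnj (coef T (iv a))"
  unfolding coef_def[of "adj T"] by (simp add: Rep_adjoint_ket[OF is_adjoint_adj(1)] A_ket)

lemma adj_adj [simp]: "T \<in> A \<Longrightarrow> adj (adj T) = T"
  by (rule adj_eq) (rule is_adjoint_commute[THEN iffD1], rule is_adjoint_adj(1))

text \<open>Convolution with a general coefficient function still makes sense as a series: its terms
  are those of the inner product with the vector \<open>adj T (ket a)\<close>.\<close>

lemma A_apply: "T \<in> A \<Longrightarrow> Rep_ell2 (T x) a = gconv G (coef T) (Rep_ell2 x) a"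
proof -
  assume T: "T \<in> A"
  have "Rep_ell2 (T x) a = cinner_ell2 (adj T (ket a)) x"
    using is_adjoint_adj(1)[OF T] cinner_ket[of a "T x"] by (metis is_adjoint_commute is_adjoint_def)
  also have "\<dots> = (\<Sum>\<^sub>\<infinity>b. Rep_ell2 (T (ket b)) a * Rep_ell2 x b)"
    by (simp add: cinner_ell2.rep_eq Rep_adjoint_ket[OF is_adjoint_adj(1)[OF T]])
  also have "\<dots> = gconv G (coef T) (Rep_ell2 x) a"
    unfolding gconv_def by (rule infsum_cong_neutral) (auto simp: A_ket[OF T])
  finally show ?thesis .
qed

text \<open>Coefficients are dominated by the operator norm, so norm limits give uniform limits of
  coefficient functions.\<close>

lemma continuous_coef: "T \<in> A \<Longrightarrow> continuous_on S (coef T)"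
proof -
  assume T: "T \<in> A"
  obtain f where f: "\<And>n. f n \<in> Cc UNIV" "(\<lambda>n. L (f n)) \<longlonglongrightarrow> T" using reduced_algebra_seq[OF T] by blast
  have "uniform_limit UNIV f (coef T) sequentially"
  proof (rule uniform_limitI)
    fix e :: real assume "0 < e"
    then have "\<forall>\<^sub>F n in sequentially. dist (L (f n)) T < e" using f(2) by (rule tendstoD[rotated])
    then show "\<forall>\<^sub>F n in sequentially. \<forall>x\<in>UNIV. dist (f n x) (coef T x) < e"
    proof (rule eventually_mono, intro ballI)
      fix n x assume "dist (L (f n)) T < e"
      moreover have "dist (f n x) (coef T x) \<le> dist (L (f n)) T"
        using coef_le_norm[of "L (f n) - T" x] by (simp add: dist_norm coef_linear f(1))
      ultimately show "dist (f n x) (coef T x) < e" by simp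
    qed
  qed
  then have "continuous_on UNIV (coef T)"
    by (rule uniform_limit_theorem[rotated]) (auto intro!: always_eventually CcD(1) f)
  then show ?thesis by (rule continuous_on_subset) simp
qed

lemma open_support: "T \<in> A \<Longrightarrow> open {a. coef T a \<noteq> 0}"
  by (intro open_Collect_neq continuous_coef continuous_on_const)

section \<open>Products\<close>

text \<open>If \<open>f\<close> lives on a bisection, the convolution of \<open>f\<close> and
  \<open>g\<close> at \<open>c\<close> has at most one nonzero term: its first factor must be the
  arrow of \<open>U\<close> with the same range as \<open>c\<close>. Continuity and compact support
  can then be read off the formula \<open>k\<close>.\<close>

lemma L_compose_bisection:
  assumes U: "open U" "bisection U" and f: "f \<in> Cc U" and g: "g \<in> Cc UNIV"
  shows "L f o\<^sub>L L g \<in> A"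
proof -
  have f': "f \<in> Cc UNIV" by (rule Cc_mono[OF f]) simp
  have inj: "inj_on r U" using U(2) by (simp add: bisection_def)
  let ?s = "\<lambda>c. inv_into U r (r c)"
  note s = local_section(2)[OF U(1) inj]
  define k where "k c = (if r c \<in> r ` U then f (?s c) * g (iv (?s c) \<diamondop> c) else 0)" for c
  let ?K = "closure {a. f a \<noteq> 0}" and ?M = "closure {a. g a \<noteq> 0}"
  have kD: "\<exists>w. w \<in> ?K \<and> iv w \<diamondop> c \<in> ?M \<and> r w = r c" if "k c \<noteq> 0" for c
  proof -
    obtain w where "w \<in> U" "r c = r w" using \<open>k c \<noteq> 0\<close> unfolding k_def by (metis imageE)
    with that show ?thesis
      using CcD(4)[OF f, of w] CcD(4)[OF g, of "iv w \<diamondop> c"] s[of w]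
      by (intro exI[of _ w]) (auto simp: k_def)
  qed
  have k: "k \<in> Cc UNIV"
  proof (rule CcI[where K = "(\<lambda>x. fst x \<diamondop> snd x) ` ((?K \<times> ?M) \<inter> {x. d (fst x) = r (snd x)})"])
    show "continuous_on UNIV k"
    proof (rule continuous_extend_zero[of "r -` r ` U" _ "r -` r ` ?K"])
      show "open (r -` r ` U)" by (intro open_vimage_r open_image_r U)
      have "continuous_on (r -` r ` U) (\<lambda>c. f (?s c) * g (iv (?s c) \<diamondop> c))"
        by (intro continuous_intros continuous_on_compose2[OF CcD(1)[OF f] local_quotient(1)[OF U(1) inj]]
            continuous_on_compose2[OF CcD(1)[OF g] local_quotient(2)[OF U(1) inj]]) simp_all
      then show "continuous_on (r -` r ` U) k"
        by (rule continuous_on_eq) (auto simp: k_def)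
      have "closed (r ` ?K)"
        by (intro compact_imp_closed compact_continuous_image continuous_r CcD(2)[OF f])
      then show "closed (r -` r ` ?K)"
        using continuous_r[of UNIV] by (simp add: continuous_on_closed_vimage)
      show "r -` r ` ?K \<subseteq> r -` r ` U" using CcD(3)[OF f] by auto
      show "k c = 0" if "c \<notin> r -` r ` ?K" for c
        using kD[of c] that by (metis imageI vimageI)
    qed
    \<comment> \<open>Composability is a closed condition, so the composable pairs from the two
      compact supports form a compact set, and so do their products.\<close>
    have "closed {x. d (fst x) = r (snd x)}"
      by (intro closed_Collect_eq continuous_on_compose2[OF continuous_d] continuous_on_compose2[OF continuous_r]
          continuous_intros) auto
    then show "compact ((\<lambda>x. fst x \<diamondop> snd x) ` ((?K \<times> ?M) \<inter> {x. d (fst x) = r (snd x)}))"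
      by (intro compact_continuous_image continuous_gm continuous_intros compact_Int_closed compact_Times
          CcD(2)[OF f] CcD(2)[OF g]) auto
    show "c \<in> (\<lambda>x. fst x \<diamondop> snd x) ` ((?K \<times> ?M) \<inter> {x. d (fst x) = r (snd x)})" if k0: "k c \<noteq> 0" for c
    proof -
      obtain w where w: "w \<in> ?K" "iv w \<diamondop> c \<in> ?M" "r w = r c" using kD[OF k0] by blast
      show ?thesis
        by (rule image_eqI[where x = "(w, iv w \<diamondop> c)"]) (use w in auto)
    qed
  qed simp
  have "L f o\<^sub>L L g = L k"
  proof (rule op_eqI)
    fix b
    show "(L f o\<^sub>L L g) (ket b) = L k (ket b)"
      unfolding Rep_ell2_inject[symmetric]
    proof
      fix a
      have eq: "Rep_ell2 (L f (L g (ket b))) a =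
          (\<Sum>\<^sub>\<infinity>c\<in>{c. d c = d a}. f (a \<diamondop> iv c) * (if d c = d b then g (c \<diamondop> iv b) else 0))"
        by (simp add: L_apply[OF f'] gconv_def L_ket[OF g])
      show "Rep_ell2 ((L f o\<^sub>L L g) (ket b)) a = Rep_ell2 (L k (ket b)) a"
      proof (cases "d a = d b \<and> r a \<in> r ` U")
        case False
        have "f (a \<diamondop> iv c) * (if d c = d b then g (c \<diamondop> iv b) else 0) = 0" if "d c = d a" for c
          using False that CcD(5)[OF f, of "a \<diamondop> iv c"] imageI[of "a \<diamondop> iv c" U r] by auto
        then show ?thesis using False by (auto simp: eq L_ket[OF k] k_def intro!: infsum_0)
      next
        case True
        then obtain w where w: "w \<in> U" "r w = r a" by (metis imageE)
        have "(\<Sum>\<^sub>\<infinity>c\<in>{c. d c = d a}. f (a \<diamondop> iv c) * (if d c = d b then g (c \<diamondop> iv b) else 0)) =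
            f (a \<diamondop> iv (iv w \<diamondop> a)) * (if d (iv w \<diamondop> a) = d b then g ((iv w \<diamondop> a) \<diamondop> iv b) else 0)"
        proof (rule infsum_single)
          fix c assume c: "c \<in> {c. d c = d a}" "c \<noteq> iv w \<diamondop> a"
          have "f (a \<diamondop> iv c) = 0"
          proof (rule ccontr)
            assume "f (a \<diamondop> iv c) \<noteq> 0"
            then have "a \<diamondop> iv c \<in> U" by (rule CcD(5)[OF f])
            then have "a \<diamondop> iv c = w" using w c inj_onD[OF inj, of "a \<diamondop> iv c" w] by simp
            then show False using c groupoid_right_quotient(2)[OF grpd, of c a] by simp
          qed
          then show "f (a \<diamondop> iv c) * (if d c = d b then g (c \<diamondop> iv b) else 0) = 0" by simp
        qed (use w in simp)
        also have "\<dots> = k (a \<diamondop> iv b)"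
          using True w s[OF w(1)] imageI[OF w(1), of r] by (simp add: k_def inv_mult)
        finally show ?thesis using True by (simp add: eq L_ket[OF k])
      qed
    qed
  qed (intro complex_linear_op_compose L_complex_linear f' g k)+
  then show ?thesis using L_in[OF k] by simp
qed

text \<open>\<open>Cc_induct\<close> reduces the left factor to a function on a bisection.
  Closedness of the algebra and continuity of multiplication then remove compact support, first from
  the right factor and then from the left one.\<close>

lemma A_compose: "S \<in> A \<Longrightarrow> T \<in> A \<Longrightarrow> S o\<^sub>L T \<in> A"
proof -
  assume S: "S \<in> A" and T: "T \<in> A"
  have LL: "\<forall>g\<in>Cc UNIV. L f o\<^sub>L L g \<in> A" if "f \<in> Cc UNIV" for f
    using that
  proof (induction f rule: Cc_induct)
    case (bisection f U)
    then show ?case using L_compose_bisection[of U] by simp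
  next
    case (add f g)
    then show ?case by (simp add: L_add blinfun.bilinear_simps bounded_bilinear.add_left[OF bounded_bilinear_blinfun_compose] A_add)
  next
    case (scale c f)
    have "scaleC_op c (L f) o\<^sub>L T = scaleC_op c (L f o\<^sub>L T)" for T
      by (rule blinfun_eqI) (simp add: scaleC_op_apply)
    then show ?case using scale by (simp add: L_scale A_scaleC)
  qed
  have LT: "L f o\<^sub>L T \<in> A" if "f \<in> Cc UNIV" for f
    using T
  proof (induction T rule: reduced_algebra_induct)
    case closed
    show ?case
      using continuous_closed_vimage[OF reduced_algebra_closed linear_continuous_at,
          OF bounded_bilinear.bounded_linear_right[OF bounded_bilinear_blinfun_compose]]
      by (simp add: vimage_def)
  qed (use LL that in auto)
  from S show ?thesis
  proof (induction S rule: reduced_algebra_induct)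
    case closed
    show ?case
      using continuous_closed_vimage[OF reduced_algebra_closed linear_continuous_at,
          OF bounded_bilinear.bounded_linear_left[OF bounded_bilinear_blinfun_compose]]
      by (simp add: vimage_def)
  qed (rule LT)
qed

lemma coef_compose:
  assumes "S \<in> A" "T \<in> A"
  shows "coef (S o\<^sub>L T) a = (\<Sum>\<^sub>\<infinity>b\<in>{b. d b = d a}. coef S (a \<diamondop> iv b) * coef T b)"
proof -
  have "coef (S o\<^sub>L T) a = gconv G (coef S) (Rep_ell2 (T (ket (d a)))) a"
    by (simp only: coef_def[of "S o\<^sub>L T"] blinfun_apply_blinfun_compose A_apply[OF assms(1)])
  also have "\<dots> = (\<Sum>\<^sub>\<infinity>b\<in>{b. d b = d a}. coef S (a \<diamondop> iv b) * coef T b)"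
    unfolding gconv_def
  proof (rule infsum_cong)
    fix b assume "b \<in> {b. d b = d a}"
    then have "ket (d a) = ket (d b)" by simp
    then show "coef S (a \<diamondop> iv b) * Rep_ell2 (T (ket (d a))) b = coef S (a \<diamondop> iv b) * coef T b"
      by (simp only: coef_def[of T])
  qed
  finally show ?thesis .
qed

section \<open>Norm estimates\<close>

text \<open>At each arrow \<open>a\<close> at most one term of the convolution is nonzero, since two
  such terms would give two arrows of \<open>S\<close> with the common range
  \<open>r a\<close>.\<close>

lemma gconv_bisection:
  assumes S: "bisection S" "\<And>c. f c \<noteq> 0 \<Longrightarrow> c \<in> S"
  shows "gconv G f y a = 0 \<or> (\<exists>c. d c = d a \<and> a \<diamondop> iv c \<in> S \<and> gconv G f y a = f (a \<diamondop> iv c) * y c)"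
    and "(\<lambda>b. f (a \<diamondop> iv b) * y b) summable_on {b. d b = d a}"
proof -
  have uniq: "b = c" if "d b = d a" "d c = d a" "f (a \<diamondop> iv b) \<noteq> 0" "f (a \<diamondop> iv c) \<noteq> 0" for b c
  proof -
    have "a \<diamondop> iv b = a \<diamondop> iv c"
      by (rule bisectionD(2)[OF S(1) S(2)[OF that(3)] S(2)[OF that(4)]]) (use that in simp)
    then have "iv (a \<diamondop> iv b) \<diamondop> a = iv (a \<diamondop> iv c) \<diamondop> a" by simp
    then show ?thesis using that groupoid_right_quotient(2)[OF grpd] by simp
  qed
  consider (none) "\<forall>b. d b = d a \<longrightarrow> f (a \<diamondop> iv b) = 0"
    | (one) c where "d c = d a" "f (a \<diamondop> iv c) \<noteq> 0" by blast
  then show "gconv G f y a = 0 \<or> (\<exists>c. d c = d a \<and> a \<diamondop> iv c \<in> S \<and> gconv G f y a = f (a \<diamondop> iv c) * y c)"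
  proof cases
    case none
    then have "gconv G f y a = 0" unfolding gconv_def by (intro infsum_0) simp
    then show ?thesis ..
  next
    case one
    then have "gconv G f y a = f (a \<diamondop> iv c) * y c"
      unfolding gconv_def by (intro infsum_single) (use uniq in auto)
    with one S(2) show ?thesis by blast
  qed
  have "finite {b. d b = d a \<and> f (a \<diamondop> iv b) \<noteq> 0}"
    by (rule finite_subset[of _ "{SOME b. d b = d a \<and> f (a \<diamondop> iv b) \<noteq> 0}"])
      (use uniq in \<open>auto intro: someI2\<close>)
  then show "(\<lambda>b. f (a \<diamondop> iv b) * y b) summable_on {b. d b = d a}"
    by (intro finite_nonzero_values_imp_summable_on) (rule finite_subset[rotated], auto)
qed

text \<open>Convolution by a function on a bisection is a weighted partial permutation of the basis:
  the surviving index \<open>c a\<close> determines \<open>a\<close>, because the quotient lies in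
  \<open>S\<close> and its source is the range of \<open>c a\<close>. So the weights alone bound the
  norm.\<close>

lemma gconv_bisection_sum_le:
  assumes S: "bisection S" "\<And>c. f c \<noteq> 0 \<Longrightarrow> c \<in> S" and le: "\<And>c. cmod (f c) \<le> e" and F: "finite F"
  shows "(\<Sum>a\<in>F. (cmod (gconv G f (Rep_ell2 x) a))\<^sup>2) \<le> (e * norm x)\<^sup>2"
proof -
  let ?g = "gconv G f (Rep_ell2 x)"
  define F' where "F' = {a \<in> F. ?g a \<noteq> 0}"
  have "\<forall>a\<in>F'. \<exists>c. d c = d a \<and> a \<diamondop> iv c \<in> S \<and> ?g a = f (a \<diamondop> iv c) * Rep_ell2 x c"
    using gconv_bisection(1)[OF S, where y = "Rep_ell2 x"] by (auto simp: F'_def)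
  then obtain c where c: "\<And>a. a \<in> F' \<Longrightarrow> d (c a) = d a" "\<And>a. a \<in> F' \<Longrightarrow> a \<diamondop> iv (c a) \<in> S"
    "\<And>a. a \<in> F' \<Longrightarrow> ?g a = f (a \<diamondop> iv (c a)) * Rep_ell2 x (c a)"
    by metis
  have inj: "inj_on c F'"
  proof (rule inj_onI)
    fix a b assume ab: "a \<in> F'" "b \<in> F'" "c a = c b"
    have "d a = d b" using c(1)[OF ab(1)] c(1)[OF ab(2)] ab(3) by simp
    have "a \<diamondop> iv (c a) = b \<diamondop> iv (c b)"
      by (rule bisectionD(1)[OF S(1) c(2)[OF ab(1)] c(2)[OF ab(2)]])
        (use ab c(1)[OF ab(1)] c(1)[OF ab(2)] in simp)
    then have "(a \<diamondop> iv (c a)) \<diamondop> c a = (b \<diamondop> iv (c b)) \<diamondop> c b" using ab(3) by simp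
    then show "a = b" using c(1)[OF ab(1)] c(1)[OF ab(2)] by simp
  qed
  have "(\<Sum>a\<in>F. (cmod (?g a))\<^sup>2) = (\<Sum>a\<in>F'. (cmod (?g a))\<^sup>2)"
    by (rule sum.mono_neutral_right) (auto simp: F'_def F)
  also have "\<dots> \<le> (\<Sum>a\<in>F'. e\<^sup>2 * (cmod (Rep_ell2 x (c a)))\<^sup>2)"
    by (intro sum_mono) (auto simp: c(3) norm_mult power_mult_distrib intro!: mult_right_mono power_mono le)
  also have "\<dots> = e\<^sup>2 * (\<Sum>b\<in>c ` F'. (cmod (Rep_ell2 x b))\<^sup>2)"
    by (simp add: sum_distrib_left sum.reindex[OF inj])
  also have "\<dots> \<le> e\<^sup>2 * (norm x)\<^sup>2"
    by (intro mult_left_mono ell2_finite_sum_le) (simp_all add: F'_def F)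
  finally show ?thesis by (simp add: power_mult_distrib)
qed

text \<open>The supremum bound holds on each bisection separately, and the factor 2 is the number of
  bisections. The two parts of \<open>coef T\<close> may be discontinuous, so the splitting takes
  place on vectors instead of in \<open>A\<close>.\<close>

lemma norm_le_two_bisections:
  assumes T: "T \<in> A" and S: "bisection S" "bisection S'"
    and supp: "\<And>c. coef T c \<noteq> 0 \<Longrightarrow> c \<in> S \<union> S'" and le: "\<And>c. cmod (coef T c) \<le> e"
  shows "norm T \<le> 2 * e"
proof (rule norm_blinfun_bound)
  have e: "0 \<le> e" using le norm_ge_zero order_trans by blast
  then show "0 \<le> 2 * e" by simp
  fix x :: "'g ell2"
  define f g where "f c = (if c \<in> S then coef T c else 0)" and "g c = (if c \<in> S then 0 else coef T c)" for c
  have f: "f c \<noteq> 0 \<Longrightarrow> c \<in> S" "cmod (f c) \<le> e" for c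
    using le[of c] e by (auto simp: f_def split: if_splits)
  have g: "g c \<noteq> 0 \<Longrightarrow> c \<in> S'" "cmod (g c) \<le> e" for c
    using le[of c] supp[of c] e by (auto simp: g_def split: if_splits)
  have sum: "coef T c = f c + g c" for c by (simp add: f_def g_def)
  let ?x = "Rep_ell2 x"
  have eq: "Rep_ell2 (T x) a = gconv G f ?x a + gconv G g ?x a" for a
    unfolding A_apply[OF T] gconv_def sum distrib_right
    by (rule infsum_add[OF gconv_bisection(2)[OF S(1) f(1)] gconv_bisection(2)[OF S(2) g(1)]])
  have nn: "0 \<le> e * norm x" using e by simp
  note f' = ell2I[OF gconv_bisection_sum_le[OF S(1) f] nn]
  note g' = ell2I[OF gconv_bisection_sum_le[OF S(2) g] nn]
  have "T x = Abs_ell2 (gconv G f ?x) + Abs_ell2 (gconv G g ?x)"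
    by (simp add: Rep_ell2_inject[symmetric] fun_eq_iff plus_ell2.rep_eq f'(1) g'(1) eq)
  then have "norm (T x) \<le> norm (Abs_ell2 (gconv G f ?x)) + norm (Abs_ell2 (gconv G g ?x))"
    by (simp add: norm_triangle_ineq)
  also have "\<dots> \<le> e * norm x + e * norm x"
    by (intro add_mono f'(2) g'(2))
  finally show "norm (T x) \<le> 2 * e * norm x" by simp
qed

section \<open>The diagonal subalgebra\<close>

abbreviation "D \<equiv> C0_units G"

lemma gconv_units:
  assumes "\<And>c. c \<notin> U\<^sub>0 \<Longrightarrow> f c = 0"
  shows "gconv G f y a = f (r a) * y a"
  unfolding gconv_def
  by (subst infsum_single[of _ a]) (use assms quotient_unit_iff[of a] in auto)

lemma coef_diag_op: "g \<in> C0 U\<^sub>0 \<Longrightarrow> coef (diag_op G g) a = (if a \<in> U\<^sub>0 then g a else 0)"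
  unfolding coef_def by (auto simp: diag_op_apply[OF grpd] ket.rep_eq unit_iff unitD)

text \<open>Soft thresholding approximates functions in \<open>C\<^sub>0\<close> uniformly by compactly supported ones.\<close>

definition shrink :: "real \<Rightarrow> complex \<Rightarrow> complex"
  where "shrink e z = of_real (max 0 (cmod z - e) / max (cmod z) e) * z"

lemma shrink:
  assumes "0 < e"
  shows "continuous_on S (shrink e)" "shrink e z \<noteq> 0 \<Longrightarrow> e \<le> cmod z" "cmod (z - shrink e z) \<le> e"
proof -
  have "max (cmod z) e \<noteq> 0" for z using assms by linarith
  then show "continuous_on S (shrink e)" unfolding shrink_def by (intro continuous_intros) auto
  show "shrink e z \<noteq> 0 \<Longrightarrow> e \<le> cmod z" by (rule ccontr) (simp add: shrink_def)
  show "cmod (z - shrink e z) \<le> e"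
  proof (cases "e \<le> cmod z")
    case True
    have z: "0 < cmod z" using True assms by linarith
    have "z - shrink e z = of_real (1 - (cmod z - e) / cmod z) * z"
      using True by (simp add: shrink_def max_def algebra_simps)
    also have "1 - (cmod z - e) / cmod z = e / cmod z" using z by (simp add: field_simps)
    finally show ?thesis using z assms by (simp add: norm_mult norm_divide)
  qed (simp add: shrink_def)
qed

lemma D_subset_A: "D \<subseteq> A"
proof
  fix T assume "T \<in> D"
  then obtain g where g: "g \<in> C0 U\<^sub>0" "T = diag_op G g" by (auto simp: C0_units_def)
  have "\<exists>S\<in>L ` Cc UNIV. dist S T < e" if e: "0 < e" for e
  proof -
    define f where "f a = (if a \<in> U\<^sub>0 then shrink (e/2) (g a) else 0)" for a
    have e2: "0 < e/2" using e by simp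
    have f: "f \<in> Cc UNIV"
    proof (rule CcI)
      show "compact {x \<in> U\<^sub>0. e/2 \<le> cmod (g x)}" using g(1) e2 unfolding C0_def by blast
      have "continuous_on U\<^sub>0 f"
        by (rule continuous_on_eq[OF continuous_on_compose2[OF shrink(1)[OF e2, of UNIV], of U\<^sub>0 g]])
          (use g(1) in \<open>auto simp: C0_def f_def\<close>)
      then show "continuous_on UNIV f"
        by (rule continuous_extend_zero[OF open_units _ closed_units]) (auto simp: f_def)
    qed (use shrink(2)[OF e2] in \<open>auto simp: f_def split: if_splits\<close>)
    \<comment> \<open>The difference multiplies the coordinate at \<open>a\<close> by the value at
      \<open>r a\<close> of a function with modulus at most \<open>e/2\<close>.\<close>
    have "norm (T - L f) \<le> e/2"
    proof (rule norm_blinfun_bound)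
      fix x
      have entry: "Rep_ell2 ((T - L f) x) a = (g (r a) - shrink (e/2) (g (r a))) * Rep_ell2 x a" for a
        by (simp add: minus_blinfun.rep_eq minus_ell2.rep_eq g diag_op_apply[OF grpd] L_apply[OF f]
            gconv_units f_def left_diff_distrib)
      show "norm ((T - L f) x) \<le> e/2 * norm x"
      proof (rule norm_ell2_leI)
        fix F :: "'g set" assume F: "finite F"
        have "(\<Sum>a\<in>F. (cmod (Rep_ell2 ((T - L f) x) a))\<^sup>2) \<le> (\<Sum>a\<in>F. (e/2)\<^sup>2 * (cmod (Rep_ell2 x a))\<^sup>2)"
          unfolding entry norm_mult power_mult_distrib
          by (intro sum_mono mult_right_mono power_mono shrink(3) e2) auto
        also have "\<dots> \<le> (e/2)\<^sup>2 * (norm x)\<^sup>2"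
          unfolding sum_distrib_left[symmetric] by (intro mult_left_mono ell2_finite_sum_le F) simp
        finally show "(\<Sum>a\<in>F. (cmod (Rep_ell2 ((T - L f) x) a))\<^sup>2) \<le> (e/2 * norm x)\<^sup>2"
          by (simp only: power_mult_distrib)
      qed (use e in simp)
    qed (use e in simp)
    then show ?thesis using f e by (intro bexI[of _ "L f"]) (auto simp: dist_norm norm_minus_commute)
  qed
  then show "T \<in> A" by (simp add: reduced_algebra_def closure_approachable)
qed

text \<open>From here on the diagonal is recognized by supports. Vanishing at infinity follows by
  approximating \<open>T\<close> within \<open>e\<close> by some \<open>L f\<close>: where the
  coefficient has modulus at least \<open>e\<close>, the function \<open>f\<close> cannot
  vanish.\<close>

lemma D_iff: "T \<in> D \<longleftrightarrow> T \<in> A \<and> (\<forall>a. a \<notin> U\<^sub>0 \<longrightarrow> coef T a = 0)"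
proof
  assume "T \<in> D"
  moreover obtain g where "g \<in> C0 U\<^sub>0" "T = diag_op G g" using calculation by (auto simp: C0_units_def)
  ultimately show "T \<in> A \<and> (\<forall>a. a \<notin> U\<^sub>0 \<longrightarrow> coef T a = 0)"
    using D_subset_A by (auto simp: coef_diag_op)
next
  assume T: "T \<in> A \<and> (\<forall>a. a \<notin> U\<^sub>0 \<longrightarrow> coef T a = 0)"
  have g: "coef T \<in> C0 U\<^sub>0"
    unfolding C0_def
  proof (intro CollectI conjI allI impI)
    show "continuous_on U\<^sub>0 (coef T)" using T by (intro continuous_coef) simp
    fix e :: real assume e: "0 < e"
    have "\<exists>S\<in>L ` Cc UNIV. dist S T < e"
      using T e by (simp add: reduced_algebra_def closure_approachable)
    then obtain f where f: "f \<in> Cc UNIV" "norm (L f - T) < e" by (auto simp: dist_norm)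
    have sub: "{x \<in> U\<^sub>0. e \<le> cmod (coef T x)} \<subseteq> closure {a. f a \<noteq> 0}"
    proof
      fix x assume x: "x \<in> {x \<in> U\<^sub>0. e \<le> cmod (coef T x)}"
      have "cmod (f x - coef T x) < e"
        using coef_le_norm[of "L f - T" x] f by (simp add: coef_linear)
      with x have "f x \<noteq> 0" by auto
      then show "x \<in> closure {a. f a \<noteq> 0}" by (rule CcD(4)[OF f(1)])
    qed
    have "closed {x \<in> U\<^sub>0. e \<le> cmod (coef T x)}"
    proof -
      have "closed {x. e \<le> cmod (coef T x)}"
        using T by (intro closed_Collect_le continuous_intros continuous_coef) auto
      then have "closed (U\<^sub>0 \<inter> {x. e \<le> cmod (coef T x)})" using closed_units by (intro closed_Int)
      then show ?thesis by (simp add: Collect_conj_eq)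
    qed
    from compact_Int_closed[OF CcD(2)[OF f(1)] this] show "compact {x \<in> U\<^sub>0. e \<le> cmod (coef T x)}"
      unfolding Int_absorb1[OF sub] .
  qed
  have "T = diag_op G (coef T)"
    by (rule blinfun_eqI)
      (use T in \<open>simp add: Rep_ell2_inject[symmetric] fun_eq_iff A_apply gconv_units diag_op_apply[OF grpd g]\<close>)
  with g show "T \<in> D" by (auto simp: C0_units_def)
qed

lemma D_A: "T \<in> D \<Longrightarrow> T \<in> A" and D_off: "T \<in> D \<Longrightarrow> a \<notin> U\<^sub>0 \<Longrightarrow> coef T a = 0"
  by (simp_all add: D_iff)

lemma D_apply: "g \<in> D \<Longrightarrow> Rep_ell2 (g x) a = coef g (r a) * Rep_ell2 x a"
  by (simp add: A_apply D_A gconv_units D_off)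

lemma D_ket: "g \<in> D \<Longrightarrow> g (ket a) = scaleC_ell2 (coef g (r a)) (ket a)"
  by (auto simp: Rep_ell2_inject[symmetric] fun_eq_iff D_apply scaleC_ell2.rep_eq ket.rep_eq)

lemma coef_D_left: "g \<in> D \<Longrightarrow> coef (g o\<^sub>L T) a = coef g (r a) * coef T a"
  by (simp add: coef_def[of "g o\<^sub>L T"] D_apply) (simp add: coef_def)

lemma coef_D_right: "g \<in> D \<Longrightarrow> T \<in> A \<Longrightarrow> coef (T o\<^sub>L g) a = coef T a * coef g (d a)"
  using A_complex_linear[of T]
  by (simp add: coef_def[of "T o\<^sub>L g"] D_ket complex_linear_op_def scaleC_ell2.rep_eq)
    (simp add: coef_def)

lemma L_in_D: "f \<in> Cc U\<^sub>0 \<Longrightarrow> L f \<in> D"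
proof -
  assume f: "f \<in> Cc U\<^sub>0"
  then have "f \<in> Cc UNIV" by (rule Cc_mono) simp
  then show ?thesis using CcD(5)[OF f] by (auto simp: D_iff L_in)
qed

text \<open>Self-adjointness is included so that \<open>normalizes_same_range\<close> can read a
  square of the bump as a product with its adjoint.\<close>

lemma D_bump:
  assumes "open W" "u \<in> W" "u \<in> U\<^sub>0"
  obtains g where "g \<in> D" "coef g u = 1" "\<And>v. coef g v \<noteq> 0 \<Longrightarrow> v \<in> W" "adj g = g"
proof -
  obtain f where f: "f \<in> Cc (W \<inter> U\<^sub>0)" "f u = 1" "\<And>x. cnj (f x) = f x"
    using bump_Cc[of "W \<inter> U\<^sub>0" u] assms open_units by blast
  have fU: "f \<in> Cc UNIV" "f \<in> Cc U\<^sub>0" using f(1) by (auto intro: Cc_mono)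
  have fz: "f x \<noteq> 0 \<Longrightarrow> x \<in> W \<and> x \<in> U\<^sub>0" for x using CcD(5)[OF f(1), of x] by simp
  have "adj (L f) = L f"
  proof (rule coef_eqI)
    fix a
    have "f (iv a) = f a"
    proof (cases "a \<in> U\<^sub>0")
      case False
      then have "iv a \<notin> U\<^sub>0" by (metis inv_inv inv_unit)
      with False fz[of a] fz[of "iv a"] show ?thesis by (cases "f a = 0"; cases "f (iv a) = 0") auto
    qed simp
    then show "coef (adj (L f)) a = coef (L f) a" by (simp add: coef_adj L_in fU f(3))
  qed (simp_all add: L_in fU is_adjoint_adj)
  with that[of "L f"] L_in_D[OF fU(2)] f(2) fz show ?thesis by (simp add: fU(1))
qed

lemma D_I: "T \<in> A \<Longrightarrow> (\<And>a. a \<notin> U\<^sub>0 \<Longrightarrow> coef T a = 0) \<Longrightarrow> T \<in> D"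
  by (simp add: D_iff)

lemma D_compose: "g \<in> D \<Longrightarrow> h \<in> D \<Longrightarrow> g o\<^sub>L h \<in> D"
  by (intro D_I A_compose) (simp_all add: D_A coef_D_left D_off)

lemma D_adj: "g \<in> D \<Longrightarrow> adj g \<in> D"
  by (metis D_A D_iff coef_adj complex_cnj_zero inv_inv inv_unit is_adjoint_adj(2))

lemma D_add: "g \<in> D \<Longrightarrow> h \<in> D \<Longrightarrow> g + h \<in> D"
  by (intro D_I A_add) (simp_all add: D_A coef_linear D_off)

lemma D_scaleC: "g \<in> D \<Longrightarrow> scaleC_op c g \<in> D"
  by (intro D_I A_scaleC) (simp_all add: D_A coef_scaleC D_off)

section \<open>Automorphisms are isometric\<close>

text \<open>The fixed point is \<open>1 - sqrt (1 - T\<^sup>2)\<close>; the map is a contraction of a ball of radius less than one.\<close>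

lemma sqrt_exists:
  assumes T: "T \<in> A" "is_adjoint T T" and lt: "norm T < 1"
  obtains b where "b \<in> A" "is_adjoint b b" "(T o\<^sub>L T) + (b o\<^sub>L b) = b + b"
proof -
  define t where "t = (norm T)\<^sup>2"
  have t: "0 \<le> t" "t < 1" using lt by (simp_all add: t_def power_less_one_iff)
  \<comment> \<open>\<open>\<rho>\<close> is the smaller root of
    \<open>t + \<rho>\<^sup>2 = 2 * \<rho>\<close>. This makes the ball of radius
    \<open>\<rho>\<close> invariant under \<open>F\<close>, and \<open>\<rho>\<close> is also the
    contraction constant.\<close>
  define \<rho> where "\<rho> = 1 - sqrt (1 - t)"
  have \<rho>: "0 \<le> \<rho>" "\<rho> < 1" using t by (auto simp: \<rho>_def)
  have \<rho>2: "t + \<rho>\<^sup>2 = 2 * \<rho>"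
    using t by (simp add: \<rho>_def power2_diff)
  define s where "s = {b \<in> A. is_adjoint b b \<and> norm b \<le> \<rho>}"
  define F where "F b = (1/2) *\<^sub>R ((T o\<^sub>L T) + (b o\<^sub>L b))" for b
  have "closed s"
    unfolding closed_sequential_limits
  proof (intro allI impI)
    fix X l assume X: "(\<forall>n. X n \<in> s) \<and> X \<longlonglongrightarrow> l"
    then have "l \<in> A" using closed_sequentially[OF reduced_algebra_closed] by (auto simp: s_def)
    moreover have "is_adjoint l l" using X is_adjoint_limit[of X X l l] by (auto simp: s_def)
    moreover have "norm l \<le> \<rho>"
      using X by (auto simp: s_def intro: Lim_norm_ubound[of sequentially X l] always_eventually)
    ultimately show "l \<in> s" by (simp add: s_def)
  qed
  then have "complete s" by (simp add: complete_eq_closed)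
  moreover have "0 \<in> s" using \<rho> by (simp add: s_def A_zero is_adjoint_zero)
  moreover have "F ` s \<subseteq> s"
  proof (rule image_subsetI)
    fix b assume b: "b \<in> s"
    have "norm (F b) = (1/2) * norm ((T o\<^sub>L T) + (b o\<^sub>L b))" by (simp add: F_def)
    also have "\<dots> \<le> (1/2) * (norm T * norm T + norm b * norm b)"
      using norm_triangle_mono[OF norm_blinfun_compose norm_blinfun_compose] by (intro mult_left_mono) auto
    also have "\<dots> \<le> (1/2) * (t + \<rho>\<^sup>2)"
      using b mult_mono[of "norm b" \<rho> "norm b" \<rho>] by (auto simp: s_def t_def power2_eq_square)
    finally have "norm (F b) \<le> \<rho>" using \<rho>2 by simp
    then show "F b \<in> s" using b T
      by (auto simp: s_def F_def intro!: A_scaleR A_add A_compose is_adjoint_scaleR is_adjoint_add is_adjoint_compose)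
  qed
  moreover have "\<forall>x\<in>s. \<forall>y\<in>s. dist (F x) (F y) \<le> \<rho> * dist x y"
  proof (intro ballI)
    fix x y assume xy: "x \<in> s" "y \<in> s"
    \<comment> \<open>The elements \<open>x\<close> and \<open>y\<close> need not commute, so the
      difference of their squares is telescoped.\<close>
    have "(x o\<^sub>L (x - y)) + ((x - y) o\<^sub>L y) = (x o\<^sub>L x) - (y o\<^sub>L y)"
      unfolding bounded_bilinear.diff_left[OF bounded_bilinear_blinfun_compose]
          bounded_bilinear.diff_right[OF bounded_bilinear_blinfun_compose] by simp
    then have "F x - F y = (1/2) *\<^sub>R ((x o\<^sub>L (x - y)) + ((x - y) o\<^sub>L y))"
      by (simp only: F_def scaleR_diff_right[symmetric] add_diff_cancel_left)
    then have "norm (F x - F y) = (1/2) * norm ((x o\<^sub>L (x - y)) + ((x - y) o\<^sub>L y))" by simp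
    also have "\<dots> \<le> (1/2) * (norm x * norm (x - y) + norm (x - y) * norm y)"
      using norm_triangle_mono[OF norm_blinfun_compose norm_blinfun_compose] by (intro mult_left_mono) auto
    also have "\<dots> \<le> (1/2) * (\<rho> * norm (x - y) + norm (x - y) * \<rho>)"
      using xy by (intro mult_left_mono add_mono mult_right_mono) (auto simp: s_def)
    finally show "dist (F x) (F y) \<le> \<rho> * dist x y" by (simp add: dist_norm)
  qed
  ultimately have "\<exists>!x\<in>s. F x = x"
    using \<rho> by (intro Banach_fix) auto
  then obtain b where b: "b \<in> s" "F b = b" by blast
  have "(T o\<^sub>L T) + (b o\<^sub>L b) = 2 *\<^sub>R F b" by (simp add: F_def)
  then have "(T o\<^sub>L T) + (b o\<^sub>L b) = b + b" using b(2) by (simp add: scaleR_2)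
  with b that show ?thesis by (auto simp: s_def)
qed

lemma star_autD:
  assumes "\<phi> \<in> star_aut A"
  shows "bij_betw \<phi> A A" "\<phi> \<in> extensional A" "T \<in> A \<Longrightarrow> \<phi> T \<in> A"
    "S \<in> A \<Longrightarrow> T \<in> A \<Longrightarrow> \<phi> (S + T) = \<phi> S + \<phi> T"
    "T \<in> A \<Longrightarrow> \<phi> (scaleC_op c T) = scaleC_op c (\<phi> T)"
    "S \<in> A \<Longrightarrow> T \<in> A \<Longrightarrow> \<phi> (S o\<^sub>L T) = \<phi> S o\<^sub>L \<phi> T"
    "S \<in> A \<Longrightarrow> T \<in> A \<Longrightarrow> is_adjoint S T \<Longrightarrow> is_adjoint (\<phi> S) (\<phi> T)"
  using assms by (auto simp: star_aut_def Bij_def dest: bij_betwE)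

lemma star_aut_adj: "\<phi> \<in> star_aut A \<Longrightarrow> T \<in> A \<Longrightarrow> \<phi> (adj T) = adj (\<phi> T)"
  using star_autD(7)[of \<phi> "adj T" T] is_adjoint_adj[of T] adj_eq[of "\<phi> (adj T)" "\<phi> T"] by metis

lemma star_aut_scaleR: "\<phi> \<in> star_aut A \<Longrightarrow> T \<in> A \<Longrightarrow> \<phi> (t *\<^sub>R T) = t *\<^sub>R \<phi> T"
  using star_autD(5)[of \<phi> T "of_real t"] by (simp add: scaleC_op_of_real)

lemma star_aut_diff: "\<phi> \<in> star_aut A \<Longrightarrow> S \<in> A \<Longrightarrow> T \<in> A \<Longrightarrow> \<phi> (S - T) = \<phi> S - \<phi> T"
  using star_autD(4)[of \<phi> S "(-1) *\<^sub>R T"] star_aut_scaleR[of \<phi> T "-1"] A_scaleR[of T "-1"] by simp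

text \<open>The relation for \<open>b\<close> says that \<open>1 - T\<^sup>2\<close> is the square
  of \<open>1 - b\<close>, written without the unit that \<open>A\<close> may lack, so
  \<open>\<phi>\<close> transports it. Evaluated on a vector \<open>x\<close>, it shows that the
  squared norm of \<open>x\<close> minus that of \<open>\<phi> T x\<close> is the squared norm of
  \<open>x - \<phi> b x\<close>.\<close>

lemma star_aut_contractive_selfadjoint:
  assumes \<phi>: "\<phi> \<in> star_aut A" and T: "T \<in> A" "is_adjoint T T"
  shows "norm (\<phi> T) \<le> norm T"
proof -
  have one: "norm (\<phi> T) \<le> 1" if T: "T \<in> A" "is_adjoint T T" "norm T < 1" for T
  proof -
    obtain b where b: "b \<in> A" "is_adjoint b b" "(T o\<^sub>L T) + (b o\<^sub>L b) = b + b"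
      using sqrt_exists[OF T] by blast
    let ?S = "\<phi> T" and ?B = "\<phi> b"
    have "\<phi> ((T o\<^sub>L T) + (b o\<^sub>L b)) = \<phi> (b + b)" by (simp only: b(3))
    then have eq: "(?S o\<^sub>L ?S) + (?B o\<^sub>L ?B) = ?B + ?B"
      by (simp add: star_autD[OF \<phi>] A_compose T b(1))
    have inn: "inner (?S x) y = inner x (?S y)" "inner (?B x) y = inner x (?B y)" for x y
      using star_autD(7)[OF \<phi> T(1,1,2)] star_autD(7)[OF \<phi> b(1,1,2)]
      by (simp_all add: is_adjoint_def inner_ell2_def)
    have "norm (?S x) \<le> 1 * norm x" for x
    proof -
      have "?S (?S x) + ?B (?B x) = ?B x + ?B x"
        using arg_cong[OF eq, of "\<lambda>T. blinfun_apply T x"] by (simp add: plus_blinfun.rep_eq)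
      then have "inner x (?S (?S x)) + inner x (?B (?B x)) = inner x (?B x) + inner x (?B x)"
        by (metis inner_add_right)
      moreover have "inner (x - ?B x) (x - ?B x) = inner x x - 2 * inner x (?B x) + inner x (?B (?B x))"
        by (simp add: inner_diff inn)
      moreover have "inner (?S x) (?S x) = inner x (?S (?S x))" by (rule inn)
      ultimately have "inner (?S x) (?S x) \<le> inner x x"
        using inner_ge_zero[of "x - ?B x"] by linarith
      then show ?thesis by (simp add: norm_eq_sqrt_inner)
    qed
    then show ?thesis by (rule norm_blinfun_bound[rotated]) simp
  qed
  show ?thesis
  proof (rule field_le_epsilon)
    fix e :: real assume e: "0 < e"
    \<comment> \<open>Adding \<open>e\<close> makes the norm after rescaling strictly less than one,
      also when \<open>T\<close> is zero.\<close>
    let ?c = "norm T + e"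
    have c: "0 < ?c" using e by (simp add: add_nonneg_pos)
    have "norm (\<phi> ((1 / ?c) *\<^sub>R T)) \<le> 1"
      by (intro one A_scaleR T is_adjoint_scaleR) (use c e in \<open>simp add: field_simps\<close>)
    then show "norm (\<phi> T) \<le> norm T + e"
      using c by (simp add: star_aut_scaleR[OF \<phi> T(1)] field_simps)
  qed
qed

text \<open>The C*-identity reduces the claim to the self-adjoint product of \<open>adj T\<close>
  and \<open>T\<close>.\<close>

lemma star_aut_contractive:
  assumes \<phi>: "\<phi> \<in> star_aut A" and T: "T \<in> A"
  shows "norm (\<phi> T) \<le> norm T"
proof -
  note ad = is_adjoint_adj[OF T]
  have "(norm (\<phi> T))\<^sup>2 = norm (\<phi> (adj T) o\<^sub>L \<phi> T)"
    by (rule norm_adjoint_compose[symmetric]) (rule star_autD(7)[OF \<phi> ad(2) T ad(1)])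
  also have "\<dots> = norm (\<phi> (adj T o\<^sub>L T))" by (simp add: star_autD(6)[OF \<phi> ad(2) T])
  also have "\<dots> \<le> norm (adj T o\<^sub>L T)"
    by (intro star_aut_contractive_selfadjoint \<phi> A_compose ad T is_adjoint_compose)
      (rule is_adjoint_commute[THEN iffD1], rule ad)
  also have "\<dots> = (norm T)\<^sup>2" by (rule norm_adjoint_compose[OF ad(1)])
  finally show ?thesis by (rule power2_le_imp_le) simp
qed

lemma star_aut_compose:
  assumes "\<phi> \<in> star_aut A" "\<psi> \<in> star_aut A"
  shows "compose A \<phi> \<psi> \<in> star_aut A"
  unfolding star_aut_def
  using assms compose_Bij[of \<phi> A \<psi>]
  by (auto simp: star_aut_def compose_eq star_autD[OF assms(1)] star_autD[OF assms(2)] A_add A_scaleC A_compose)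

text \<open>Adjoint pairs pass to the inverse because the adjoint of a preimage lies in
  \<open>A\<close> and is mapped to the given adjoint.\<close>

lemma star_aut_inv:
  assumes \<phi>: "\<phi> \<in> star_aut A"
  shows "restrict (inv_into A \<phi>) A \<in> star_aut A"
proof -
  define \<psi> where "\<psi> = restrict (inv_into A \<phi>) A"
  note bij = star_autD(1)[OF \<phi>]
  have img: "\<phi> ` A = A" and inj: "inj_on \<phi> A" using bij by (auto simp: bij_betw_def)
  have in_A: "\<psi> T \<in> A" and inv: "\<phi> (\<psi> T) = T" if "T \<in> A" for T
    using that img by (auto simp: \<psi>_def f_inv_into_f inv_into_into)
  have eqI: "\<psi> T = S" if "S \<in> A" "\<phi> S = T" for S T
    using that star_autD(3)[OF \<phi>, of S] inj by (auto simp: \<psi>_def inv_into_f_f)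
  have adj: "is_adjoint (\<psi> S) (\<psi> T)" if "S \<in> A" "T \<in> A" "is_adjoint S T" for S T
  proof -
    have "\<phi> (adj (\<psi> T)) = S"
      using that by (simp add: star_aut_adj[OF \<phi> in_A] inv adj_eq)
    then have "\<psi> S = adj (\<psi> T)" using that by (intro eqI is_adjoint_adj in_A)
    then show ?thesis using is_adjoint_adj(1)[OF in_A[OF that(2)]] by simp
  qed
  show ?thesis
    unfolding star_aut_def \<psi>_def[symmetric]
  proof (intro CollectI conjI ballI allI impI)
    show "\<psi> \<in> Bij A" unfolding \<psi>_def using \<phi> by (intro restrict_inv_into_Bij) (simp add: star_aut_def)
    fix S T assume S: "S \<in> A" and T: "T \<in> A"
    show "\<psi> (S + T) = \<psi> S + \<psi> T"
      by (rule eqI) (simp_all add: A_add in_A S T star_autD(4)[OF \<phi> in_A[OF S] in_A[OF T]] inv)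
    show "\<psi> (S o\<^sub>L T) = \<psi> S o\<^sub>L \<psi> T"
      by (rule eqI) (simp_all add: A_compose in_A S T star_autD(6)[OF \<phi> in_A[OF S] in_A[OF T]] inv)
    show "\<psi> (scaleC_op c T) = scaleC_op c (\<psi> T)" for c
      by (rule eqI) (simp_all add: A_scaleC in_A T star_autD(5)[OF \<phi> in_A[OF T]] inv)
  qed (rule adj)
qed

text \<open>The inverse is a *-automorphism as well, so contractivity applies in both
  directions.\<close>

lemma star_aut_isometric:
  assumes \<phi>: "\<phi> \<in> star_aut A" and T: "T \<in> A"
  shows "norm (\<phi> T) = norm T"
proof (rule antisym[OF star_aut_contractive[OF assms]])
  have "norm (restrict (inv_into A \<phi>) A (\<phi> T)) \<le> norm (\<phi> T)"
    by (rule star_aut_contractive[OF star_aut_inv[OF \<phi>] star_autD(3)[OF \<phi> T]])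
  then show "norm T \<le> norm (\<phi> T)"
    using star_autD(1,3)[OF \<phi>] T by (simp add: bij_betw_def inv_into_f_f)
qed

lemma star_aut_tendsto:
  assumes \<phi>: "\<phi> \<in> star_aut A" and X: "\<And>n. X n \<in> A" "T \<in> A" "X \<longlonglongrightarrow> T"
  shows "(\<lambda>n. \<phi> (X n)) \<longlonglongrightarrow> \<phi> T"
proof -
  have "dist (\<phi> (X n)) (\<phi> T) = dist (X n) T" for n
    using star_aut_isometric[OF \<phi> A_diff[OF X(1,2)], of n] star_aut_diff[OF \<phi> X(1,2), of n]
    by (simp add: dist_norm)
  then show ?thesis using X(3) by (simp add: tendsto_iff)
qed

section \<open>Normalizers of the diagonal\<close>

text \<open>This coefficient is the bridge from the algebra to vectors: it measures the column of
  \<open>T\<close> at \<open>u\<close>, that is, the coefficients on the source fibre of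
  \<open>u\<close>.\<close>

lemma coef_adj_compose_unit:
  assumes "T \<in> A" "u \<in> U\<^sub>0"
  shows "coef (adj T o\<^sub>L T) u = of_real ((norm (T (ket u)))\<^sup>2)"
  using norm_square_adjoint_apply[OF is_adjoint_adj(1)[OF assms(1)], of "ket u"]
  by (simp add: coef_def unitD(1)[OF assms(2)] cinner_ket)

lemma Rep_ket_unit:
  assumes "T \<in> A" "u \<in> U\<^sub>0"
  shows "Rep_ell2 (T (ket u)) a = (if d a = u then coef T a else 0)"
  using assms by (simp add: A_ket unitD)

lemma norm_ket_unit_0:
  assumes "T \<in> A" "u \<in> U\<^sub>0"
  shows "norm (T (ket u)) = 0 \<longleftrightarrow> (\<forall>a. d a = u \<longrightarrow> coef T a = 0)"
  unfolding norm_eq_zero Rep_ell2_inject[symmetric]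
  by (auto simp: fun_eq_iff Rep_ket_unit[OF assms] zero_ell2.rep_eq)

definition support :: "'g op \<Rightarrow> 'g set"
  where "support T = {a. coef T a \<noteq> 0}"

lemma in_support [simp]: "a \<in> support T \<longleftrightarrow> coef T a \<noteq> 0"
  by (simp add: support_def)

lemma norm_ket_bisection:
  assumes "T \<in> A" "bisection (support T)" "coef T a \<noteq> 0"
  shows "norm (T (ket (d a))) = cmod (coef T a)"
proof -
  have "(norm (T (ket (d a))))\<^sup>2 = (cmod (Rep_ell2 (T (ket (d a))) a))\<^sup>2"
    unfolding norm_ell2_square
  proof (rule infsum_single)
    fix b assume "b \<noteq> a"
    then have "coef T b = 0" if "d b = d a"
      using bisectionD(1)[OF assms(2), of b a] that assms(3) by auto
    then show "(cmod (Rep_ell2 (T (ket (d a))) b))\<^sup>2 = 0" by (simp add: Rep_ket_unit assms(1))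
  qed simp
  then show ?thesis by (simp add: Rep_ket_unit assms(1))
qed

text \<open>Defined by supports; \<open>N_normalizes\<close>, together with \<open>N_adj\<close>,
  and \<open>normalizes_N\<close> identify these elements with the algebraic normalizers of the
  diagonal.\<close>

definition normalizers :: "'g op set" ("N")
  where "N = {n \<in> A. bisection (support n)}"

lemma N_A: "n \<in> N \<Longrightarrow> n \<in> A"
  by (simp add: normalizers_def)

lemma N_uniq: "n \<in> N \<Longrightarrow> coef n a \<noteq> 0 \<Longrightarrow> coef n b \<noteq> 0 \<Longrightarrow> d a = d b \<Longrightarrow> a = b"
  "n \<in> N \<Longrightarrow> coef n a \<noteq> 0 \<Longrightarrow> coef n b \<noteq> 0 \<Longrightarrow> r a = r b \<Longrightarrow> a = b"
  using bisectionD[of "support n" a b] by (auto simp: normalizers_def)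

lemma N_subset: "T \<in> A \<Longrightarrow> n \<in> N \<Longrightarrow> support T \<subseteq> support n \<Longrightarrow> T \<in> N"
  by (auto simp: normalizers_def intro: bisection_subset)

lemma L_in_N: "f \<in> Cc W \<Longrightarrow> bisection W \<Longrightarrow> L f \<in> N"
proof -
  assume f: "f \<in> Cc W" and W: "bisection W"
  have "f \<in> Cc UNIV" by (rule Cc_mono[OF f]) simp
  moreover have "{a. f a \<noteq> 0} \<subseteq> W" using CcD(5)[OF f] by auto
  ultimately show ?thesis
    using bisection_subset[OF W] by (simp add: normalizers_def L_in support_def)
qed

lemma D_unit_value: "u \<in> U\<^sub>0 \<Longrightarrow> \<exists>g\<in>D. coef g u = 1"
  by (rule D_bump[of UNIV u]) auto

lemma N_adj: "n \<in> N \<Longrightarrow> adj n \<in> N"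
proof -
  assume n: "n \<in> N"
  have inj: "iv a = iv b \<longleftrightarrow> a = b" for a b by (metis inv_inv)
  have "bisection (support (adj n))"
    using N_uniq[OF n, of "iv _" "iv _"]
    by (simp add: bisection_def inj_on_def coef_adj N_A[OF n] inj)
  then show ?thesis by (simp add: normalizers_def is_adjoint_adj N_A[OF n])
qed

lemma coef_compose_nonzero:
  assumes "S \<in> A" "T \<in> A" "coef (S o\<^sub>L T) a \<noteq> 0"
  obtains b where "d b = d a" "coef S (a \<diamondop> iv b) \<noteq> 0" "coef T b \<noteq> 0"
proof -
  have "\<not> (\<forall>b. d b = d a \<longrightarrow> coef S (a \<diamondop> iv b) * coef T b = 0)"
    using assms(3) infsum_0[of "{b. d b = d a}" "\<lambda>b. coef S (a \<diamondop> iv b) * coef T b"]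
    by (auto simp: coef_compose[OF assms(1,2)])
  then show ?thesis using that by auto
qed

text \<open>A nonzero coefficient of the product at \<open>a\<close> produces \<open>b\<close> and
  \<open>b \<diamondop> iv a\<close> in the support of \<open>n\<close>. They share their range, so
  they coincide and \<open>a\<close> is a unit. Allowing \<open>m\<close> to differ from
  \<open>n\<close> covers both \<open>adj n o\<^sub>L n\<close> and
  \<open>adj n o\<^sub>L (g o\<^sub>L n)\<close>.\<close>

lemma N_adj_compose:
  assumes n: "n \<in> N" and m: "m \<in> A" "support m \<subseteq> support n"
  shows "adj n o\<^sub>L m \<in> D"
proof (rule D_I)
  note nA = N_A[OF n] is_adjoint_adj(2)[OF N_A[OF n]]
  show "adj n o\<^sub>L m \<in> A" by (rule A_compose[OF nA(2) m(1)])
  show "coef (adj n o\<^sub>L m) a = 0" if a: "a \<notin> U\<^sub>0" for a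
  proof (rule ccontr)
    assume "coef (adj n o\<^sub>L m) a \<noteq> 0"
    then obtain b where b: "d b = d a" "coef (adj n) (a \<diamondop> iv b) \<noteq> 0" "coef m b \<noteq> 0"
      using coef_compose_nonzero[OF nA(2) m(1)] by blast
    have "coef n b \<noteq> 0" using b(3) m(2) by auto
    moreover have "coef n (b \<diamondop> iv a) \<noteq> 0"
      using b(1,2) by (simp add: coef_adj nA inv_mult)
    ultimately have "b \<diamondop> iv a = b" using N_uniq(2)[OF n, of "b \<diamondop> iv a" b] b(1) by simp
    then have "iv b \<diamondop> (b \<diamondop> iv a) = iv b \<diamondop> b" by simp
    then have "iv a = d b" using b(1) by simp
    then have "iv a \<in> U\<^sub>0" by simp
    then show False using a by (metis inv_inv inv_unit)
  qed
qed

lemma N_normalizes: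
  assumes n: "n \<in> N" and g: "g \<in> D"
  shows "adj n o\<^sub>L (g o\<^sub>L n) \<in> D"
  by (rule N_adj_compose[OF n A_compose[OF D_A[OF g] N_A[OF n]]]) (auto simp: coef_D_left[OF g])

text \<open>If the ranges differ, diagonal elements \<open>g\<close> and \<open>h\<close> with
  disjoint supports separate them. Then \<open>P g\<close> and \<open>P h\<close> are diagonal and
  nonzero at \<open>d a\<close>, so their product with \<open>k\<close> in between is nonzero there
  too. But that product contains the squares of \<open>g\<close> and \<open>h\<close> with only
  \<open>E\<close> between them, and this vanishes since \<open>E\<close> is diagonal.\<close>

lemma normalizes_same_range:
  assumes n: "n \<in> A" and 1: "\<And>g. g \<in> D \<Longrightarrow> adj n o\<^sub>L (g o\<^sub>L n) \<in> D"
    and 2: "\<And>g. g \<in> D \<Longrightarrow> n o\<^sub>L (g o\<^sub>L adj n) \<in> D"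
    and ab: "coef n a \<noteq> 0" "coef n b \<noteq> 0" "d a = d b"
  shows "r a = r b"
proof (rule ccontr)
  assume "r a \<noteq> r b"
  then obtain V W where VW: "open V" "open W" "r a \<in> V" "r b \<in> W" "V \<inter> W = {}"
    using hausdorff[of "r a" "r b"] by metis
  obtain g where g: "g \<in> D" "coef g (r a) = 1" "\<And>v. coef g v \<noteq> 0 \<Longrightarrow> v \<in> V" "adj g = g"
    using D_bump[OF VW(1,3) r_unit] by metis
  obtain h where h: "h \<in> D" "coef h (r b) = 1" "\<And>v. coef h v \<noteq> 0 \<Longrightarrow> v \<in> W" "adj h = h"
    using D_bump[OF VW(2,4) r_unit] by metis
  \<comment> \<open>\<open>k\<close> stands in for a unit: hypothesis \<open>2\<close> makes
    \<open>n o\<^sub>L (k o\<^sub>L adj n)\<close> diagonal only for \<open>k\<close> in the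
    diagonal.\<close>
  obtain k where k: "k \<in> D" "coef k (d a) = 1"
    using D_unit_value[OF d_unit] by blast
  define E where "E = n o\<^sub>L (k o\<^sub>L adj n)"
  have E: "E \<in> D" unfolding E_def by (rule 2[OF k(1)])
  define P where "P g = adj n o\<^sub>L ((g o\<^sub>L g) o\<^sub>L n)" for g
  have P: "P g \<in> D" if "g \<in> D" for g unfolding P_def by (intro 1 D_compose that)
  have P_pos: "coef (P g) (d c) \<noteq> 0" if g: "g \<in> D" "adj g = g" "coef g (r c) = 1" and c: "coef n c \<noteq> 0" for g c
  proof -
    note gA = D_A[OF g(1)]
    have gn: "g o\<^sub>L n \<in> A" by (intro A_compose gA n)
    have "is_adjoint (adj n o\<^sub>L adj g) (g o\<^sub>L n)"
      by (intro is_adjoint_compose is_adjoint_adj gA n)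
    then have "adj (g o\<^sub>L n) = adj n o\<^sub>L g" using g(2) by (simp add: adj_eq)
    then have "P g = adj (g o\<^sub>L n) o\<^sub>L (g o\<^sub>L n)"
      by (simp add: P_def blinfun_eqI)
    moreover have "norm ((g o\<^sub>L n) (ket (d c))) \<noteq> 0"
      unfolding norm_ket_unit_0[OF gn d_unit] using c g(3) by (auto simp: coef_D_left[OF g(1)])
    ultimately show ?thesis by (simp add: coef_adj_compose_unit[OF gn])
  qed
  have "P g o\<^sub>L (k o\<^sub>L P h) = adj n o\<^sub>L (((g o\<^sub>L g) o\<^sub>L (E o\<^sub>L (h o\<^sub>L h))) o\<^sub>L n)"
    by (rule blinfun_eqI) (simp add: P_def E_def)
  also have "(g o\<^sub>L g) o\<^sub>L (E o\<^sub>L (h o\<^sub>L h)) = 0"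
  proof (rule coef_eqI)
    show "(g o\<^sub>L g) o\<^sub>L (E o\<^sub>L (h o\<^sub>L h)) \<in> A"
      by (intro A_compose D_A g h E)
    fix c
    have "coef g (r c) = 0 \<or> coef h (r c) = 0" using g(3) h(3) VW(5) by blast
    then show "coef ((g o\<^sub>L g) o\<^sub>L (E o\<^sub>L (h o\<^sub>L h))) c = coef 0 c"
      by (auto simp: coef_D_left D_compose g(1) h(1) E coef_linear)
  qed (rule A_zero)
  finally have "P g o\<^sub>L (k o\<^sub>L P h) = 0" by (simp add: blinfun_eqI)
  then have "coef (P g o\<^sub>L (k o\<^sub>L P h)) (d a) = 0" by (simp add: coef_linear)
  then have "coef (P g) (d a) * coef (P h) (d a) = 0"
    using k by (simp add: coef_D_left P g(1) k(1))
  then show False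
    using P_pos[OF g(1,4,2) ab(1)] P_pos[OF h(1,4,2) ab(2)] ab(3) by simp
qed

text \<open>If two arrows of the support have the same source, then the open set of quotients of the
  support lies in the isotropy, hence in the units.\<close>

lemma normalizes_inj_d:
  assumes n: "n \<in> A" and 1: "\<And>g. g \<in> D \<Longrightarrow> adj n o\<^sub>L (g o\<^sub>L n) \<in> D"
    and 2: "\<And>g. g \<in> D \<Longrightarrow> n o\<^sub>L (g o\<^sub>L adj n) \<in> D"
  shows "inj_on d (support n)"
proof (rule inj_onI)
  have op: "open (support n)" unfolding support_def by (rule open_support[OF n])
  fix a b assume ab: "a \<in> support n" "b \<in> support n" "d a = d b"
  have "a \<diamondop> iv b \<in> U\<^sub>0"
  proof (rule effectiveD[OF op open_iv[OF op]])
    fix x y assume x: "x \<in> support n" "y \<in> iv ` support n" "d x = r y"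
    then obtain z where z: "z \<in> support n" "y = iv z" by auto
    have "r x = r z" by (rule normalizes_same_range[OF assms]) (use x z in auto)
    then show "d y = r x" using z by simp
  qed (use ab in auto)
  then show "a = b" using quotient_unit_iff[OF ab(3)] by simp
qed

text \<open>The hypotheses are symmetric in \<open>n\<close> and \<open>adj n\<close>, and inversion
  of arrows exchanges source and range.\<close>

lemma normalizes_N:
  assumes n: "n \<in> A" and 1: "\<And>g. g \<in> D \<Longrightarrow> adj n o\<^sub>L (g o\<^sub>L n) \<in> D"
    and 2: "\<And>g. g \<in> D \<Longrightarrow> n o\<^sub>L (g o\<^sub>L adj n) \<in> D"
  shows "n \<in> N"
proof -
  have "inj_on d (support (adj n))"
    by (rule normalizes_inj_d) (use assms in \<open>auto simp: is_adjoint_adj\<close>)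
  then have "iv a = iv b" if "coef n a \<noteq> 0" "coef n b \<noteq> 0" "r a = r b" for a b
    using inj_onD[of d "support (adj n)" "iv a" "iv b"] that by (simp add: coef_adj n)
  then have "inj_on r (support n)"
    by (intro inj_onI) (metis in_support inv_inv)
  with normalizes_inj_d[OF assms] n show ?thesis by (simp add: normalizers_def bisection_def)
qed

section \<open>Automorphisms preserving the diagonal\<close>

definition aut_D :: "('g op \<Rightarrow> 'g op) set"
  where "aut_D = {\<phi> \<in> star_aut A. \<phi> ` D = D}"

lemma aut_D_star: "\<phi> \<in> aut_D \<Longrightarrow> \<phi> \<in> star_aut A"
  and aut_D_D: "\<phi> \<in> aut_D \<Longrightarrow> g \<in> D \<Longrightarrow> \<phi> g \<in> D"
  by (auto simp: aut_D_def)

text \<open>Supports are not visibly respected by \<open>\<phi>\<close>, but the normalizer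
  conditions are algebraic relations with elements of \<open>D\<close>, which \<open>\<phi>\<close>
  maps onto itself.\<close>

lemma aut_D_N:
  assumes \<phi>: "\<phi> \<in> aut_D" and n: "n \<in> N"
  shows "\<phi> n \<in> N"
proof -
  note st = aut_D_star[OF \<phi>] and nA = N_A[OF n]
  note nA' = is_adjoint_adj(2)[OF nA]
  have im: "\<exists>g'\<in>D. g = \<phi> g'" if "g \<in> D" for g
    using \<phi> that by (auto simp: aut_D_def)
  show ?thesis
  proof (rule normalizes_N)
    show "\<phi> n \<in> A" by (rule star_autD(3)[OF st nA])
    fix g assume "g \<in> D"
    then obtain g' where g': "g' \<in> D" "g = \<phi> g'" using im by blast
    note gA = D_A[OF g'(1)]
    have "adj (\<phi> n) o\<^sub>L (g o\<^sub>L \<phi> n) = \<phi> (adj n o\<^sub>L (g' o\<^sub>L n))"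
      unfolding g'(2) star_autD(6)[OF st nA' A_compose[OF gA nA]] star_autD(6)[OF st gA nA]
        star_aut_adj[OF st nA] ..
    then show "adj (\<phi> n) o\<^sub>L (g o\<^sub>L \<phi> n) \<in> D"
      using aut_D_D[OF \<phi> N_normalizes[OF n g'(1)]] by simp
    have "\<phi> n o\<^sub>L (g o\<^sub>L adj (\<phi> n)) = \<phi> (n o\<^sub>L (g' o\<^sub>L adj n))"
      unfolding g'(2) star_autD(6)[OF st nA A_compose[OF gA nA']] star_autD(6)[OF st gA nA']
        star_aut_adj[OF st nA] ..
    then show "\<phi> n o\<^sub>L (g o\<^sub>L adj (\<phi> n)) \<in> D"
      using aut_D_D[OF \<phi> N_normalizes[OF N_adj[OF n] g'(1)]] by (simp add: nA)
  qed
qed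

abbreviation inv_aut :: "('g op \<Rightarrow> 'g op) \<Rightarrow> 'g op \<Rightarrow> 'g op"
  where "inv_aut \<phi> \<equiv> restrict (inv_into A \<phi>) A"

lemma star_aut_inv_apply:
  assumes "\<phi> \<in> star_aut A" "T \<in> A"
  shows "inv_aut \<phi> (\<phi> T) = T" "\<phi> (inv_aut \<phi> T) = T"
  using star_autD(1,3)[OF assms(1)] assms(2) by (auto simp: bij_betw_def inv_into_f_f f_inv_into_f)

lemma aut_D_inv: "\<phi> \<in> aut_D \<Longrightarrow> inv_aut \<phi> \<in> aut_D"
proof -
  assume \<phi>: "\<phi> \<in> aut_D"
  note st = aut_D_star[OF \<phi>]
  have "inv_aut \<phi> ` D = inv_aut \<phi> ` \<phi> ` D" using \<phi> by (simp add: aut_D_def)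
  also have "\<dots> = (\<lambda>g. g) ` D"
    unfolding image_image by (rule image_cong[OF refl]) (rule star_aut_inv_apply[OF st D_A])
  finally show ?thesis using star_aut_inv[OF st] by (simp add: aut_D_def)
qed

section \<open>The action on the unit space\<close>

text \<open>Gelfand duality in relational form: evaluation at \<open>v\<close> after
  \<open>\<phi>\<close> is evaluation at \<open>u\<close>. The inverse automorphism reverses the
  relation, so existence and uniqueness proved on one side hold on the other.\<close>

definition unit_rel :: "('g op \<Rightarrow> 'g op) \<Rightarrow> 'g \<Rightarrow> 'g \<Rightarrow> bool"
  where "unit_rel \<phi> u v \<longleftrightarrow> u \<in> U\<^sub>0 \<and> v \<in> U\<^sub>0 \<and> (\<forall>g\<in>D. coef (\<phi> g) v = coef g u)"

lemma unit_relD: "unit_rel \<phi> u v \<Longrightarrow> u \<in> U\<^sub>0" "unit_rel \<phi> u v \<Longrightarrow> v \<in> U\<^sub>0"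
  "unit_rel \<phi> u v \<Longrightarrow> g \<in> D \<Longrightarrow> coef (\<phi> g) v = coef g u"
  by (auto simp: unit_rel_def)

lemma unit_rel_inv_iff:
  assumes \<phi>: "\<phi> \<in> aut_D"
  shows "unit_rel (inv_aut \<phi>) v u \<longleftrightarrow> unit_rel \<phi> u v"
proof
  note st = aut_D_star[OF \<phi>]
  show "unit_rel \<phi> u v" if "unit_rel (inv_aut \<phi>) v u"
    unfolding unit_rel_def
  proof (intro conjI ballI)
    fix g assume g: "g \<in> D"
    show "coef (\<phi> g) v = coef g u"
      using unit_relD(3)[OF that aut_D_D[OF \<phi> g]] by (simp only: star_aut_inv_apply[OF st D_A[OF g]])
  qed (use unit_relD[OF that] in auto)
  show "unit_rel (inv_aut \<phi>) v u" if "unit_rel \<phi> u v"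
    unfolding unit_rel_def
  proof (intro conjI ballI)
    fix g assume g: "g \<in> D"
    show "coef (inv_aut \<phi> g) u = coef g v"
      using unit_relD(3)[OF that aut_D_D[OF aut_D_inv[OF \<phi>] g]] by (simp only: star_aut_inv_apply[OF st D_A[OF g]])
  qed (use unit_relD[OF that] in auto)
qed

lemma unit_rel_unique: "unit_rel \<phi> u v \<Longrightarrow> unit_rel \<phi> u' v \<Longrightarrow> u = u'"
proof (rule ccontr)
  assume h: "unit_rel \<phi> u v" "unit_rel \<phi> u' v" and ne: "u \<noteq> u'"
  obtain W where W: "open W" "u \<in> W" "u' \<notin> W" using t1_space[OF ne] by blast
  obtain g where g: "g \<in> D" "coef g u = 1" "\<And>v. coef g v \<noteq> 0 \<Longrightarrow> v \<in> W"
    using D_bump[OF W(1,2) unit_relD(1)[OF h(1)]] by metis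
  have "coef g u = coef g u'" using unit_relD(3)[OF h(1) g(1)] unit_relD(3)[OF h(2) g(1)] by simp
  then show False using g(2) g(3)[of u'] W(3) by auto
qed

lemma unit_rel_functional: "\<phi> \<in> aut_D \<Longrightarrow> unit_rel \<phi> u v \<Longrightarrow> unit_rel \<phi> u v' \<Longrightarrow> v = v'"
  using unit_rel_inv_iff unit_rel_unique by blast

lemma D_compact_level:
  assumes "T \<in> D" "0 < e"
  shows "compact {x \<in> U\<^sub>0. e \<le> cmod (coef T x)}"
proof -
  obtain g where g: "g \<in> C0 U\<^sub>0" "T = diag_op G g" using assms(1) by (auto simp: C0_units_def)
  then have "{x \<in> U\<^sub>0. e \<le> cmod (coef T x)} = {x \<in> U\<^sub>0. e \<le> cmod (g x)}"
    by (auto simp: coef_diag_op)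
  then show ?thesis using g(1) assms(2) by (simp add: C0_def)
qed

text \<open>The map \<open>g \<mapsto> coef (\<phi> g) v\<close> is a character of the diagonal, and
  its kernel must have a common zero. Otherwise compactness gives an \<open>H\<close> in the kernel,
  a finite sum of products of \<open>adj (g u)\<close> and \<open>g u\<close>, without zeros where
  \<open>k\<close> is not small. Dividing a truncation of \<open>k\<close> by \<open>H\<close> leads
  to an \<open>m\<close> in the kernel that is close to \<open>k\<close>, although the character is
  contractive and maps \<open>k\<close> to 1.\<close>

lemma unit_rel_zero_set:
  assumes \<phi>: "\<phi> \<in> aut_D" and v: "v \<in> U\<^sub>0" and k: "k \<in> D" "coef (\<phi> k) v = 1"
  obtains u where "u \<in> U\<^sub>0" "\<And>g. g \<in> D \<Longrightarrow> coef (\<phi> g) v = 0 \<Longrightarrow> coef g u = 0"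
proof (rule ccontr)
  note st = aut_D_star[OF \<phi>]
  have mult: "coef (\<phi> (g o\<^sub>L h)) v = coef (\<phi> g) v * coef (\<phi> h) v" if "g \<in> D" "h \<in> D" for g h
    using that v by (simp add: star_autD(6)[OF st D_A D_A] coef_D_left aut_D_D[OF \<phi>] unitD)
  assume "\<not> thesis"
  then have "\<forall>u\<in>U\<^sub>0. \<exists>g\<in>D. coef (\<phi> g) v = 0 \<and> coef g u \<noteq> 0" using that by blast
  then obtain g where g: "\<And>u. u \<in> U\<^sub>0 \<Longrightarrow> g u \<in> D" "\<And>u. u \<in> U\<^sub>0 \<Longrightarrow> coef (\<phi> (g u)) v = 0"
    "\<And>u. u \<in> U\<^sub>0 \<Longrightarrow> coef (g u) u \<noteq> 0" by metis
  \<comment> \<open>The level 1/4 leaves room for the factor 2 of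
    \<open>norm_le_two_bisections\<close>: the norm of \<open>k - m\<close> will be at most 1/2,
    while the character maps it to 1.\<close>
  define K where "K = {x \<in> U\<^sub>0. 1/4 \<le> cmod (coef k x)}"
  have K: "compact K" unfolding K_def by (rule D_compact_level[OF k(1)]) simp
  have "K \<subseteq> (\<Union>u\<in>K. {x. coef (g u) x \<noteq> 0})" using g(3) by (auto simp: K_def)
  moreover have "open {x. coef (g u) x \<noteq> 0}" if "u \<in> K" for u
    using that g(1) by (intro open_support D_A) (auto simp: K_def)
  ultimately obtain I where I: "I \<subseteq> K" "finite I" "K \<subseteq> (\<Union>u\<in>I. {x. coef (g u) x \<noteq> 0})"
    using compactE_image[OF K, of K "\<lambda>u. {x. coef (g u) x \<noteq> 0}"] by metis
  have IU: "I \<subseteq> U\<^sub>0" using I(1) by (auto simp: K_def)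
  have "\<exists>H\<in>D. coef (\<phi> H) v = 0 \<and> (\<forall>x\<in>U\<^sub>0. coef H x = of_real (\<Sum>u\<in>I. (cmod (coef (g u) x))\<^sup>2))"
    using I(2) IU
  proof induction
    case empty
    have "scaleC_op 0 k \<in> D" by (rule D_scaleC[OF k(1)])
    then show ?case
      using star_autD(5)[OF st D_A[OF k(1)], of 0] by (intro bexI[of _ 0]) (simp_all add: coef_linear)
  next
    case (insert w I)
    then obtain H where H: "H \<in> D" "coef (\<phi> H) v = 0"
      "\<forall>x\<in>U\<^sub>0. coef H x = of_real (\<Sum>u\<in>I. (cmod (coef (g u) x))\<^sup>2)" by auto
    have gw: "g w \<in> D" "adj (g w) \<in> D" "coef (\<phi> (g w)) v = 0" using insert.prems g D_adj by auto
    let ?H = "(adj (g w) o\<^sub>L g w) + H"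
    have D: "adj (g w) o\<^sub>L g w \<in> D" by (rule D_compose[OF gw(2,1)])
    have "coef (\<phi> ?H) v = 0"
      by (simp add: star_autD(4)[OF st D_A[OF D] D_A[OF H(1)]] coef_linear H(2) mult[OF gw(2,1)] gw(3))
    moreover have "coef ?H x = of_real (\<Sum>u\<in>insert w I. (cmod (coef (g u) x))\<^sup>2)" if x: "x \<in> U\<^sub>0" for x
      using H(3) x insert.hyps
      by (simp add: coef_linear coef_D_left[OF gw(2)] coef_adj[OF D_A[OF gw(1)]] unitD
          mult.commute[of "cnj _"] flip: complex_norm_square)
    ultimately show ?case using D_add[OF D H(1)] by blast
  qed
  then obtain H where H: "H \<in> D" "coef (\<phi> H) v = 0"
    "\<And>x. x \<in> U\<^sub>0 \<Longrightarrow> coef H x = of_real (\<Sum>u\<in>I. (cmod (coef (g u) x))\<^sup>2)" by blast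
  have HK: "coef H x \<noteq> 0" if xK: "x \<in> K" for x
  proof -
    obtain u where u: "u \<in> I" "coef (g u) x \<noteq> 0" using xK I(3) by blast
    have "0 < (\<Sum>u\<in>I. (cmod (coef (g u) x))\<^sup>2)"
      by (rule sum_pos2[OF I(2) u(1)]) (use u in auto)
    moreover have "x \<in> U\<^sub>0" using xK by (simp add: K_def)
    ultimately show ?thesis unfolding H(3)[OF \<open>x \<in> U\<^sub>0\<close>] of_real_eq_0_iff by simp
  qed
  have e: "0 < (1/4::real)" by simp
  \<comment> \<open>On \<open>K\<close> the denominator has no zero, and off \<open>K\<close> the
    truncated numerator vanishes.\<close>
  define f where "f x = (if x \<in> U\<^sub>0 then shrink (1/4) (coef k x) / coef H x else 0)" for x
  have f0: "f x = 0" if "x \<notin> K" for x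
    using shrink(2)[OF e, of "coef k x"] that by (auto simp: f_def K_def)
  have f: "f \<in> Cc U\<^sub>0"
  proof (rule CcI[OF _ K])
    show "continuous_on UNIV f"
    proof (rule continuous_extend_zero[of "U\<^sub>0 \<inter> {x. coef H x \<noteq> 0}" _ K])
      show "open (U\<^sub>0 \<inter> {x. coef H x \<noteq> 0})"
        by (intro open_Int open_units open_support D_A H)
      have "continuous_on (U\<^sub>0 \<inter> {x. coef H x \<noteq> 0}) (\<lambda>x. shrink (1/4) (coef k x) / coef H x)"
        by (intro continuous_intros continuous_on_compose2[OF shrink(1)[OF e, of UNIV]]
            continuous_coef D_A k H) auto
      then show "continuous_on (U\<^sub>0 \<inter> {x. coef H x \<noteq> 0}) f"
        by (rule continuous_on_eq) (simp add: f_def)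
    qed (use K compact_imp_closed HK f0 in \<open>auto simp: K_def\<close>)
  qed (use f0 in \<open>auto simp: K_def\<close>)
  have fU: "f \<in> Cc UNIV" by (rule Cc_mono[OF f]) simp
  define m where "m = L f o\<^sub>L H"
  have LD: "L f \<in> D" by (rule L_in_D[OF f])
  have m: "m \<in> D" unfolding m_def by (rule D_compose[OF LD H(1)])
  have coef_m: "coef m x = shrink (1/4) (coef k x)" if x: "x \<in> U\<^sub>0" for x
    using shrink(2)[OF e, of "coef k x"] HK[of x] x
    by (auto simp: m_def coef_D_left[OF LD] fU unitD f_def K_def)
  have km: "k - m \<in> A" by (intro A_diff D_A k m)
  have "norm (k - m) \<le> 2 * (1/4)"
  proof (rule norm_le_two_bisections[OF km bisection_units bisection_units])
    show "c \<in> U\<^sub>0 \<union> U\<^sub>0" if "coef (k - m) c \<noteq> 0" for c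
      using that D_off[OF k(1), of c] D_off[OF m, of c] by (cases "c \<in> U\<^sub>0") (simp_all add: coef_linear)
    show "cmod (coef (k - m) c) \<le> 1/4" for c
      using D_off[OF k(1), of c] D_off[OF m, of c] shrink(3)[OF e, of "coef k c"]
      by (cases "c \<in> U\<^sub>0") (auto simp: coef_linear coef_m)
  qed
  moreover have "coef (\<phi> (k - m)) v = 1"
    using mult[OF LD H(1)] H(2) k(2)
    by (simp add: star_aut_diff[OF st D_A D_A] k(1) m coef_linear m_def[symmetric])
  moreover have "cmod (coef (\<phi> (k - m)) v) \<le> norm (k - m)"
    using coef_le_norm[of "\<phi> (k - m)" v] star_aut_isometric[OF st km] by simp
  ultimately show False by simp
qed

text \<open>Let the character take the value 1 at \<open>k\<close>. Subtracting a multiple of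
  \<open>k\<close> puts any \<open>g\<close> into the kernel, so evaluation at the common zero
  \<open>u\<close> is the character times the value of \<open>k\<close> at \<open>u\<close>. Both
  maps are multiplicative, so this value is idempotent; being nonzero, it is 1.\<close>

lemma unit_rel_exists:
  assumes \<phi>: "\<phi> \<in> aut_D" and v: "v \<in> U\<^sub>0"
  shows "\<exists>u. unit_rel \<phi> u v"
proof -
  note st = aut_D_star[OF \<phi>]
  obtain k' where k': "k' \<in> D" "coef k' v = 1"
    using D_unit_value[OF v] by blast
  define k where "k = inv_aut \<phi> k'"
  have k: "k \<in> D" "coef (\<phi> k) v = 1"
    using aut_D_D[OF aut_D_inv[OF \<phi>] k'(1)] star_aut_inv_apply(2)[OF st D_A[OF k'(1)]] k'(2)
    by (simp_all add: k_def del: restrict_apply restrict_apply')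
  obtain u where u: "u \<in> U\<^sub>0" "\<And>g. g \<in> D \<Longrightarrow> coef (\<phi> g) v = 0 \<Longrightarrow> coef g u = 0"
    by (rule unit_rel_zero_set[OF \<phi> v k]) blast
  have eq: "coef g u = coef (\<phi> g) v * coef k u" if g: "g \<in> D" for g
  proof -
    let ?c = "coef (\<phi> g) v"
    have D: "scaleC_op (- ?c) k \<in> D" by (rule D_scaleC[OF k(1)])
    have "coef (g + scaleC_op (- ?c) k) u = 0"
    proof (rule u(2))
      show "g + scaleC_op (- ?c) k \<in> D" by (rule D_add[OF g D])
      show "coef (\<phi> (g + scaleC_op (- ?c) k)) v = 0"
        by (simp add: star_autD(4)[OF st D_A[OF g] D_A[OF D]] star_autD(5)[OF st D_A[OF k(1)]]
            coef_linear coef_scaleC k(2))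
    qed
    then show ?thesis by (simp add: coef_linear coef_scaleC)
  qed
  obtain g where g: "g \<in> D" "coef g u = 1" using D_unit_value[OF u(1)] by blast
  have "coef k u \<noteq> 0" using eq[OF g(1)] g(2) by auto
  moreover have "coef (k o\<^sub>L k) u = coef (\<phi> (k o\<^sub>L k)) v * coef k u"
    by (rule eq[OF D_compose[OF k(1) k(1)]])
  then have "coef k u * coef k u = coef k u"
    using u(1) v by (simp add: coef_D_left[OF k(1)] star_autD(6)[OF st D_A[OF k(1)] D_A[OF k(1)]]
        coef_D_left[OF aut_D_D[OF \<phi> k(1)]] unitD k(2))
  ultimately have "coef k u = 1" by simp
  then have "unit_rel \<phi> u v" using u(1) v by (simp add: unit_rel_def eq)
  then show ?thesis ..
qed

text \<open>The product of \<open>adj n\<close> and \<open>n\<close> is diagonal, and its value at a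
  unit is the squared norm of the column there.\<close>

lemma unit_rel_norm:
  assumes \<phi>: "\<phi> \<in> aut_D" and n: "n \<in> N" and h: "unit_rel \<phi> u v"
  shows "norm (\<phi> n (ket v)) = norm (n (ket u))"
proof -
  note st = aut_D_star[OF \<phi>] and nA = N_A[OF n]
  have nn: "adj n o\<^sub>L n \<in> D" by (rule N_adj_compose[OF n nA]) simp
  have "\<phi> (adj n o\<^sub>L n) = adj (\<phi> n) o\<^sub>L \<phi> n"
    by (simp add: star_autD(6)[OF st is_adjoint_adj(2)[OF nA] nA] star_aut_adj[OF st nA])
  then have "complex_of_real ((norm (\<phi> n (ket v)))\<^sup>2) = of_real ((norm (n (ket u)))\<^sup>2)"
    using unit_relD(3)[OF h nn] coef_adj_compose_unit[OF star_autD(3)[OF st nA] unit_relD(2)[OF h]]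
      coef_adj_compose_unit[OF nA unit_relD(1)[OF h]] by simp
  then show ?thesis unfolding of_real_eq_iff by (rule power2_eq_imp_eq) simp_all
qed

section \<open>Reconstruction of the groupoid automorphism\<close>

definition arrow_rel :: "('g op \<Rightarrow> 'g op) \<Rightarrow> 'g \<Rightarrow> 'g \<Rightarrow> bool"
  where "arrow_rel \<phi> a b \<longleftrightarrow> unit_rel \<phi> (d a) (d b) \<and> (\<exists>n\<in>N. coef n a \<noteq> 0 \<and> coef (\<phi> n) b \<noteq> 0)"

lemma bump_N:
  assumes "open W" "a \<in> W"
  obtains n where "n \<in> N" "coef n a = 1" "support n \<subseteq> W"
proof -
  obtain U where U: "open U" "a \<in> U" "bisection U" by (rule open_bisection_nhd)
  obtain f where f: "f \<in> Cc (W \<inter> U)" "f a = 1"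
    using bump_Cc[of "W \<inter> U" a] assms U(1,2) by blast
  have fU: "f \<in> Cc UNIV" by (rule Cc_mono[OF f(1)]) simp
  have "L f \<in> N" by (rule L_in_N[OF f(1)]) (rule bisection_subset[OF U(3)], simp)
  moreover have "support (L f) \<subseteq> W" using CcD(5)[OF f(1)] by (auto simp: fU)
  ultimately show ?thesis using f(2) fU by (intro that[of "L f"]) simp_all
qed

lemma arrow_rel_inv_iff:
  assumes \<phi>: "\<phi> \<in> aut_D"
  shows "arrow_rel (inv_aut \<phi>) b a \<longleftrightarrow> arrow_rel \<phi> a b"
proof -
  note st = aut_D_star[OF \<phi>]
  have "(\<exists>n\<in>N. coef n b \<noteq> 0 \<and> coef (inv_aut \<phi> n) a \<noteq> 0) \<longleftrightarrow>
      (\<exists>n\<in>N. coef n a \<noteq> 0 \<and> coef (\<phi> n) b \<noteq> 0)" (is "?P \<longleftrightarrow> ?Q")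
  proof
    assume ?P
    then obtain n where n: "n \<in> N" "coef n b \<noteq> 0" "coef (inv_aut \<phi> n) a \<noteq> 0" by blast
    have "inv_aut \<phi> n \<in> N" by (rule aut_D_N[OF aut_D_inv[OF \<phi>] n(1)])
    moreover have "coef (\<phi> (inv_aut \<phi> n)) b \<noteq> 0"
      using n(2) by (simp only: star_aut_inv_apply[OF st N_A[OF n(1)]] not_False_eq_True)
    ultimately show ?Q using n(3) by blast
  next
    assume ?Q
    then obtain n where n: "n \<in> N" "coef n a \<noteq> 0" "coef (\<phi> n) b \<noteq> 0" by blast
    have "\<phi> n \<in> N" by (rule aut_D_N[OF \<phi> n(1)])
    moreover have "coef (inv_aut \<phi> (\<phi> n)) a \<noteq> 0"
      using n(2) by (simp only: star_aut_inv_apply[OF st N_A[OF n(1)]] not_False_eq_True)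
    ultimately show ?P using n(3) by blast
  qed
  then show ?thesis using unit_rel_inv_iff[OF \<phi>] by (simp add: arrow_rel_def del: restrict_apply restrict_apply')
qed

text \<open>Column norms are preserved, so \<open>\<phi> n\<close> cannot vanish on the whole source
  fibre over \<open>v\<close>.\<close>

lemma arrow_rel_total:
  assumes \<phi>: "\<phi> \<in> aut_D"
  shows "\<exists>b. arrow_rel \<phi> a b"
proof -
  note st = aut_D_star[OF \<phi>]
  obtain v where v: "unit_rel \<phi> (d a) v"
    using unit_rel_exists[OF aut_D_inv[OF \<phi>] d_unit] unit_rel_inv_iff[OF \<phi>] by blast
  obtain n where n: "n \<in> N" "coef n a = 1" using bump_N[of UNIV a] by blast
  have "norm (\<phi> n (ket v)) = norm (n (ket (d a)))" by (rule unit_rel_norm[OF \<phi> n(1) v])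
  moreover have "norm (n (ket (d a))) \<noteq> 0"
    using n(2) unfolding norm_ket_unit_0[OF N_A[OF n(1)] d_unit] by auto
  ultimately obtain b where b: "d b = v" "coef (\<phi> n) b \<noteq> 0"
    using norm_ket_unit_0[OF star_autD(3)[OF st N_A[OF n(1)]] unit_relD(2)[OF v]] by auto
  then have "arrow_rel \<phi> a b" using v n unfolding arrow_rel_def by (intro conjI bexI[of _ n]) auto
  then show ?thesis ..
qed

text \<open>The combination \<open>m\<close> of \<open>n\<close> and \<open>n'\<close>, cut down to the common support, vanishes at \<open>a\<close>,
  hence on the whole source fibre of \<open>a\<close>, so its image vanishes on the source fibre of \<open>b\<close>.\<close>

lemma coef_ratio:
  assumes \<phi>: "\<phi> \<in> aut_D" and n: "n \<in> N" "n' \<in> N" "coef n a \<noteq> 0" "coef n' a \<noteq> 0"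
    and v: "unit_rel \<phi> (d a) (d b)"
  shows "coef (\<phi> n) b * coef n' a = coef n a * coef (\<phi> n') b"
proof -
  note st = aut_D_star[OF \<phi>] and nA = N_A[OF n(1)] N_A[OF n(2)]
  let ?W = "support n \<inter> support n'"
  have "open ?W" unfolding support_def using nA by (intro open_Int open_support)
  then have "open (d ` ?W)" by (rule open_image_d)
  moreover have "d a \<in> d ` ?W" using n by auto
  \<comment> \<open>\<open>g\<close> restricts to the source fibres that meet the common support.
    There each of \<open>n\<close> and \<open>n'\<close> has a single arrow, and it is the same for
    both.\<close>
  ultimately obtain g where g: "g \<in> D" "coef g (d a) = 1" "\<And>v. coef g v \<noteq> 0 \<Longrightarrow> v \<in> d ` ?W"
    using D_bump[of "d ` ?W" "d a"] by (metis d_unit)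
  note gA = D_A[OF g(1)]
  have ng: "n o\<^sub>L g \<in> A" "n' o\<^sub>L g \<in> A" by (intro A_compose nA gA)+
  define m where "m = scaleC_op (coef n' a) (n o\<^sub>L g) - scaleC_op (coef n a) (n' o\<^sub>L g)"
  have mA: "m \<in> A" unfolding m_def by (intro A_diff A_scaleC ng)
  have coef_m: "coef m c = (coef n' a * coef n c - coef n a * coef n' c) * coef g (d c)" for c
    by (simp add: m_def coef_linear coef_scaleC coef_D_right[OF g(1)] nA algebra_simps)
  have supp: "c \<in> ?W" if c: "coef m c \<noteq> 0" for c
  proof -
    have "coef g (d c) \<noteq> 0" using c by (auto simp: coef_m)
    then obtain w where w: "w \<in> ?W" "d c = d w" using g(3) by blast
    have "coef n c \<noteq> 0 \<or> coef n' c \<noteq> 0" using c by (auto simp: coef_m)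
    then have "c = w" using w N_uniq(1)[OF n(1), of c w] N_uniq(1)[OF n(2), of c w] by auto
    then show ?thesis using w(1) by simp
  qed
  have mN: "m \<in> N" by (rule N_subset[OF mA n(1)]) (use supp in auto)
  have "coef m c = 0" if "d c = d a" for c
  proof (rule ccontr)
    assume c: "coef m c \<noteq> 0"
    then have "c = a" using supp[OF c] N_uniq(1)[OF n(1), of c a] n(3) that by simp
    then show False using c by (simp add: coef_m)
  qed
  then have "norm (m (ket (d a))) = 0" unfolding norm_ket_unit_0[OF mA d_unit] by blast
  then have "norm (\<phi> m (ket (d b))) = 0" using unit_rel_norm[OF \<phi> mN v] by simp
  then have "coef (\<phi> m) b = 0" unfolding norm_ket_unit_0[OF star_autD(3)[OF st mA] d_unit] by simp
  moreover have "coef (\<phi> g) (d b) = 1" using unit_relD(3)[OF v g(1)] g(2) by simp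
  ultimately show ?thesis
    by (simp add: m_def star_aut_diff[OF st A_scaleC[OF ng(1)] A_scaleC[OF ng(2)]]
        star_autD(5)[OF st ng(1)] star_autD(5)[OF st ng(2)] star_autD(6)[OF st nA(1) gA] star_autD(6)[OF st nA(2) gA]
        coef_linear coef_scaleC coef_D_right[OF aut_D_D[OF \<phi> g(1)]] star_autD(3)[OF st nA(1)] star_autD(3)[OF st nA(2)]
        mult.commute)
qed

lemma arrow_rel_functional:
  assumes \<phi>: "\<phi> \<in> aut_D" and b: "arrow_rel \<phi> a b" "arrow_rel \<phi> a b'"
  shows "b = b'"
proof -
  obtain n where n: "n \<in> N" "coef n a \<noteq> 0" "coef (\<phi> n) b \<noteq> 0"
    using b(1) by (auto simp: arrow_rel_def)
  obtain n' where n': "n' \<in> N" "coef n' a \<noteq> 0" "coef (\<phi> n') b' \<noteq> 0"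
    using b(2) by (auto simp: arrow_rel_def)
  have h: "unit_rel \<phi> (d a) (d b)" "unit_rel \<phi> (d a) (d b')" using b by (auto simp: arrow_rel_def)
  have "coef (\<phi> n) b' \<noteq> 0"
    using coef_ratio[OF \<phi> n(1) n'(1) n(2) n'(2) h(2)] n(2) n'(2,3) by auto
  then show ?thesis
    using N_uniq(1)[OF aut_D_N[OF \<phi> n(1)] n(3)] unit_rel_functional[OF \<phi> h] by simp
qed

text \<open>By \<open>coef_ratio\<close>, one scalar relates the coefficients of
  \<open>\<phi> m\<close> at \<open>b\<close> and of \<open>m\<close> at \<open>a\<close> for all
  normalizers \<open>m\<close>; it is unimodular because column norms agree. Normalizers span a
  dense subspace, and both sides are linear and continuous in \<open>T\<close>.\<close>

lemma arrow_rel_coef: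
  assumes \<phi>: "\<phi> \<in> aut_D" and b: "arrow_rel \<phi> a b"
  shows "\<exists>c. cmod c = 1 \<and> (\<forall>T\<in>A. coef (\<phi> T) b = c * coef T a)"
proof -
  note st = aut_D_star[OF \<phi>]
  obtain n where n: "n \<in> N" "coef n a \<noteq> 0" "coef (\<phi> n) b \<noteq> 0"
    using b by (auto simp: arrow_rel_def)
  have h: "unit_rel \<phi> (d a) (d b)" using b by (simp add: arrow_rel_def)
  have h': "unit_rel (inv_aut \<phi>) (d b) (d a)" using h unit_rel_inv_iff[OF \<phi>] by simp
  define c where "c = coef (\<phi> n) b / coef n a"
  have "cmod (coef (\<phi> n) b) = cmod (coef n a)"
    using unit_rel_norm[OF \<phi> n(1) h] norm_ket_bisection[OF N_A[OF n(1)] _ n(2)]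
      norm_ket_bisection[OF N_A[OF aut_D_N[OF \<phi> n(1)]] _ n(3)] n(1) aut_D_N[OF \<phi> n(1)]
    by (simp add: normalizers_def)
  then have c1: "cmod c = 1" using n by (simp add: c_def norm_divide)
  have N: "coef (\<phi> m) b = c * coef m a" if m: "m \<in> N" for m
  proof (cases "coef m a = 0")
    case False
    show ?thesis using coef_ratio[OF \<phi> n(1) m n(2) False h] n(2) by (simp add: c_def field_simps)
  next
    case True
    have "coef (\<phi> m) b = 0"
    proof (rule ccontr)
      assume ne: "coef (\<phi> m) b \<noteq> 0"
      \<comment> \<open>\<open>coef_ratio\<close> asks for nonzero values at the starting arrow.
        Here \<open>m\<close> vanishes at \<open>a\<close>, so the inverse automorphism is used,
        from \<open>b\<close> back to \<open>a\<close>.\<close>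
      from coef_ratio[OF aut_D_inv[OF \<phi>] aut_D_N[OF \<phi> n(1)] aut_D_N[OF \<phi> m] n(3) ne h']
      have "coef n a * coef (\<phi> m) b = coef (\<phi> n) b * coef m a"
        by (simp only: star_aut_inv_apply[OF st N_A[OF n(1)]] star_aut_inv_apply[OF st N_A[OF m]])
      then show False using ne n(2) True by simp
    qed
    then show ?thesis using True by simp
  qed
  have Lf: "coef (\<phi> (L f)) b = c * coef (L f) a" if "f \<in> Cc UNIV" for f
    using that
  proof (induction f rule: Cc_induct)
    case (bisection f U)
    then show ?case by (intro N L_in_N[of _ U]) (auto intro: Cc_mono)
  next
    case (add f g)
    then show ?case by (simp add: L_add star_autD(4)[OF st] L_in coef_linear distrib_left)
  next
    case (scale t f)
    then show ?case by (simp add: L_scale star_autD(5)[OF st] L_in coef_scaleC)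
  qed
  have "coef (\<phi> T) b = c * coef T a" if T: "T \<in> A" for T
  proof -
    obtain f where f: "\<And>n. f n \<in> Cc UNIV" "(\<lambda>n. L (f n)) \<longlonglongrightarrow> T"
      using reduced_algebra_seq[OF T] by blast
    have "(\<lambda>n. \<phi> (L (f n))) \<longlonglongrightarrow> \<phi> T"
      by (rule star_aut_tendsto[OF st L_in[OF f(1)] T f(2)])
    then have 1: "(\<lambda>n. coef (\<phi> (L (f n))) b) \<longlonglongrightarrow> coef (\<phi> T) b"
      by (rule bounded_linear.tendsto[OF bounded_linear_coef])
    have 2: "(\<lambda>n. c * coef (L (f n)) a) \<longlonglongrightarrow> c * coef T a"
      by (intro tendsto_intros bounded_linear.tendsto[OF bounded_linear_coef] f(2))
    show ?thesis using LIMSEQ_unique[OF 1] 2 by (simp only: Lf[OF f(1)])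
  qed
  with c1 show ?thesis by blast
qed

text \<open>The unimodular weight of lemma \<open>arrow_rel_coef\<close> is dropped: moduli suffice to determine \<open>\<Phi>\<close>.\<close>

definition implements :: "('g \<Rightarrow> 'g) \<Rightarrow> ('g op \<Rightarrow> 'g op) \<Rightarrow> bool"
  where "implements \<Phi> \<phi> \<longleftrightarrow> bij \<Phi> \<and> (\<forall>T\<in>A. \<forall>a. cmod (coef (\<phi> T) (\<Phi> a)) = cmod (coef T a))"

lemma implements_exists:
  assumes \<phi>: "\<phi> \<in> aut_D"
  shows "\<exists>\<Phi>. implements \<Phi> \<phi>"
proof -
  obtain \<Phi> where \<Phi>: "\<And>a. arrow_rel \<phi> a (\<Phi> a)" using arrow_rel_total[OF \<phi>] by metis
  have "bij \<Phi>"
  proof (rule bijI)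
    show "inj \<Phi>"
    proof (rule injI)
      fix a b assume eq: "\<Phi> a = \<Phi> b"
      have "arrow_rel (inv_aut \<phi>) (\<Phi> a) a" "arrow_rel (inv_aut \<phi>) (\<Phi> a) b"
        using \<Phi>[of a] \<Phi>[of b] eq by (simp_all only: arrow_rel_inv_iff[OF \<phi>])
      then show "a = b" by (rule arrow_rel_functional[OF aut_D_inv[OF \<phi>]])
    qed
    show "surj \<Phi>"
      unfolding surj_def
    proof
      fix b
      obtain a where "arrow_rel (inv_aut \<phi>) b a" using arrow_rel_total[OF aut_D_inv[OF \<phi>]] by blast
      then have "arrow_rel \<phi> a b" by (simp only: arrow_rel_inv_iff[OF \<phi>])
      then have "\<Phi> a = b" using arrow_rel_functional[OF \<phi> \<Phi>] by blast
      then show "\<exists>a. b = \<Phi> a" by blast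
    qed
  qed
  moreover have "cmod (coef (\<phi> T) (\<Phi> a)) = cmod (coef T a)" if "T \<in> A" for T a
    using arrow_rel_coef[OF \<phi> \<Phi>[of a]] that by (auto simp: norm_mult)
  ultimately show ?thesis by (auto simp: implements_def)
qed

lemma implementsD: "implements \<Phi> \<phi> \<Longrightarrow> bij \<Phi>"
  "implements \<Phi> \<phi> \<Longrightarrow> T \<in> A \<Longrightarrow> cmod (coef (\<phi> T) (\<Phi> a)) = cmod (coef T a)"
  by (auto simp: implements_def)

lemma implements_zero: "implements \<Phi> \<phi> \<Longrightarrow> T \<in> A \<Longrightarrow> coef (\<phi> T) (\<Phi> a) = 0 \<longleftrightarrow> coef T a = 0"
  using implementsD(2)[of \<Phi> \<phi> T a] by (metis norm_eq_zero)

text \<open>A normalizer that is nonzero at one candidate image and zero at the other pulls back to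
  an element whose value at \<open>a\<close> would have to be both nonzero and zero.\<close>

lemma implements_unique:
  assumes \<phi>: "\<phi> \<in> star_aut A" and "implements \<Phi> \<phi>" "implements \<Psi> \<phi>"
  shows "\<Phi> = \<Psi>"
proof (rule ext, rule ccontr)
  fix a assume "\<Phi> a \<noteq> \<Psi> a"
  then obtain W where W: "open W" "\<Phi> a \<in> W" "\<Psi> a \<notin> W" using t1_space by metis
  obtain n where n: "n \<in> N" "coef n (\<Phi> a) = 1" "support n \<subseteq> W" by (rule bump_N[OF W(1,2)])
  define T where "T = inv_aut \<phi> n"
  have T: "T \<in> A" "\<phi> T = n"
    using star_autD(3)[OF star_aut_inv[OF \<phi>] N_A[OF n(1)]] star_aut_inv_apply(2)[OF \<phi> N_A[OF n(1)]]
    by (simp_all only: T_def)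
  have "coef T a \<noteq> 0" using implements_zero[OF assms(2) T(1), of a] n(2) T(2) by simp
  then have "coef n (\<Psi> a) \<noteq> 0" using implements_zero[OF assms(3) T(1), of a] T(2) by simp
  then show False using n(3) W(3) by auto
qed

lemma implements_compose:
  assumes "implements \<Phi> \<phi>" "implements \<Psi> \<psi>" "\<psi> \<in> star_aut A"
  shows "implements (\<Phi> \<circ> \<Psi>) (compose A \<phi> \<psi>)"
  using assms(1,2) star_autD(3)[OF assms(3)]
  by (auto simp: implements_def compose_eq intro: bij_comp)

lemma implements_inv:
  assumes "implements \<Phi> \<phi>" "\<phi> \<in> star_aut A"
  shows "implements (inv_into UNIV \<Phi>) (inv_aut \<phi>)"
  unfolding implements_def
proof (intro conjI ballI allI)
  show "bij (inv_into UNIV \<Phi>)" using implementsD(1)[OF assms(1)] by (rule bij_imp_bij_inv)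
  fix T a assume T: "T \<in> A"
  show "cmod (coef (inv_aut \<phi> T) (inv_into UNIV \<Phi> a)) = cmod (coef T a)"
    using implementsD(2)[OF assms(1) star_autD(3)[OF star_aut_inv[OF assms(2)] T], of "inv_into UNIV \<Phi> a"]
    by (simp only: star_aut_inv_apply[OF assms(2) T] surj_f_inv_f[OF bij_is_surj[OF implementsD(1)[OF assms(1)]]])
qed

text \<open>Diagonal factors detect sources and ranges. If \<open>d (\<Phi> a)\<close> came from a
  unit \<open>u\<close> other than \<open>d a\<close>, some \<open>g\<close> equal to 1 at
  \<open>u\<close> and 0 at \<open>d a\<close> would make the product of \<open>n\<close> and
  \<open>g\<close> vanish at \<open>a\<close>, while its image does not vanish at
  \<open>\<Phi> a\<close>. Multiplication from the left treats the ranges.\<close>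

lemma implements_unit_rel:
  assumes \<phi>: "\<phi> \<in> aut_D" and imp: "implements \<Phi> \<phi>"
  shows "unit_rel \<phi> (d a) (d (\<Phi> a))" and "unit_rel \<phi> (r a) (r (\<Phi> a))"
proof -
  note st = aut_D_star[OF \<phi>]
  obtain n where n: "n \<in> N" "coef n a = 1" using bump_N[of UNIV a] by blast
  note nA = N_A[OF n(1)]
  have \<phi>n: "coef (\<phi> n) (\<Phi> a) \<noteq> 0" using implements_zero[OF imp nA] n(2) by simp
  have sep: "\<exists>g\<in>D. coef g u = 1 \<and> coef g u' = 0" if ne: "u \<noteq> u'" and u: "u \<in> U\<^sub>0" for u u'
  proof -
    obtain W where W: "open W" "u \<in> W" "u' \<notin> W" using t1_space[OF ne] by blast
    show ?thesis using D_bump[OF W(1,2) u] W(3) by metis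
  qed
  obtain u where u: "unit_rel \<phi> u (d (\<Phi> a))" using unit_rel_exists[OF \<phi> d_unit] by blast
  have "u = d a"
  proof (rule ccontr)
    assume "u \<noteq> d a"
    then obtain g where g: "g \<in> D" "coef g u = 1" "coef g (d a) = 0" using sep unit_relD(1)[OF u] by blast
    have "coef (n o\<^sub>L g) a = 0" using g(3) by (simp add: coef_D_right[OF g(1) nA])
    then have "coef (\<phi> n o\<^sub>L \<phi> g) (\<Phi> a) = 0"
      using implements_zero[OF imp A_compose[OF nA D_A[OF g(1)]]] star_autD(6)[OF st nA D_A[OF g(1)]] by simp
    then show False using \<phi>n unit_relD(3)[OF u g(1)] g(2)
      by (simp add: coef_D_right[OF aut_D_D[OF \<phi> g(1)] star_autD(3)[OF st nA]])
  qed
  then show "unit_rel \<phi> (d a) (d (\<Phi> a))" using u by simp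
  obtain u where u: "unit_rel \<phi> u (r (\<Phi> a))" using unit_rel_exists[OF \<phi> r_unit] by blast
  have "u = r a"
  proof (rule ccontr)
    assume "u \<noteq> r a"
    then obtain g where g: "g \<in> D" "coef g u = 1" "coef g (r a) = 0" using sep unit_relD(1)[OF u] by blast
    have "coef (g o\<^sub>L n) a = 0" using g(3) by (simp add: coef_D_left[OF g(1)])
    then have "coef (\<phi> g o\<^sub>L \<phi> n) (\<Phi> a) = 0"
      using implements_zero[OF imp A_compose[OF D_A[OF g(1)] nA]] star_autD(6)[OF st D_A[OF g(1)] nA] by simp
    then show False using \<phi>n unit_relD(3)[OF u g(1)] g(2)
      by (simp add: coef_D_left[OF aut_D_D[OF \<phi> g(1)]])
  qed
  then show "unit_rel \<phi> (r a) (r (\<Phi> a))" using u by simp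
qed

lemma implements_unit:
  assumes \<phi>: "\<phi> \<in> aut_D" and imp: "implements \<Phi> \<phi>" and u: "u \<in> U\<^sub>0"
  shows "\<Phi> u \<in> U\<^sub>0" and "unit_rel \<phi> u (\<Phi> u)"
proof -
  obtain g where g: "g \<in> D" "coef g u = 1" using D_unit_value[OF u] by blast
  have "coef (\<phi> g) (\<Phi> u) \<noteq> 0" using implements_zero[OF imp D_A[OF g(1)]] g(2) by simp
  then show 1: "\<Phi> u \<in> U\<^sub>0" using D_off[OF aut_D_D[OF \<phi> g(1)]] by blast
  show "unit_rel \<phi> u (\<Phi> u)"
    using implements_unit_rel(1)[OF \<phi> imp, of u] by (simp add: unitD(1)[OF u] unitD(1)[OF 1])
qed

lemma implements_image_support:
  assumes "implements \<Phi> \<phi>" "T \<in> A"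
  shows "\<Phi> ` support T = support (\<phi> T)"
proof -
  have "b \<in> \<Phi> ` support T" if "b \<in> support (\<phi> T)" for b
  proof -
    obtain a where a: "b = \<Phi> a" using implementsD(1)[OF assms(1)] by (metis bij_pointE)
    then show ?thesis using that implements_zero[OF assms] by simp
  qed
  then show ?thesis using implements_zero[OF assms] by auto
qed

text \<open>Supports of normalizers form a base of the topology, and \<open>\<Phi>\<close> maps them
  onto supports of elements of \<open>A\<close>, which are open.\<close>

lemma implements_open:
  assumes "\<phi> \<in> star_aut A" "implements \<Phi> \<phi>" "open W"
  shows "open (\<Phi> ` W)"
proof (subst open_subopen, intro ballI)
  fix b assume "b \<in> \<Phi> ` W"
  then obtain a where a: "a \<in> W" "b = \<Phi> a" by auto
  obtain n where n: "n \<in> N" "coef n a = 1" "support n \<subseteq> W" by (rule bump_N[OF assms(3) a(1)])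
  have "open (support (\<phi> n))"
    unfolding support_def by (rule open_support[OF star_autD(3)[OF assms(1) N_A[OF n(1)]]])
  moreover have "\<Phi> ` support n = support (\<phi> n)"
    by (rule implements_image_support[OF assms(2) N_A[OF n(1)]])
  ultimately show "\<exists>T. open T \<and> b \<in> T \<and> T \<subseteq> \<Phi> ` W"
    using a(2) n(2,3) by (intro exI[of _ "support (\<phi> n)"]) (metis image_eqI image_mono in_support zero_neq_one)
qed

lemma implements_groupoid_aut:
  assumes \<phi>: "\<phi> \<in> aut_D" and imp: "implements \<Phi> \<phi>"
  shows "\<Phi> \<in> groupoid_aut G"
proof -
  note st = aut_D_star[OF \<phi>]
  note bij = implementsD(1)[OF imp]
  have D: "d (\<Phi> a) = \<Phi> (d a)" and R: "r (\<Phi> a) = \<Phi> (r a)" for a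
    using unit_rel_functional[OF \<phi>] implements_unit_rel[OF \<phi> imp, of a] implements_unit(2)[OF \<phi> imp] d_unit r_unit
    by metis+
  have M: "\<Phi> (a \<diamondop> b) = \<Phi> a \<diamondop> \<Phi> b" if ab: "d a = r b" for a b
  proof -
    obtain n where n: "n \<in> N" "coef n a = 1" using bump_N[of UNIV a] by blast
    obtain m where m: "m \<in> N" "coef m b = 1" using bump_N[of UNIV b] by blast
    note nA = N_A[OF n(1)] and mA = N_A[OF m(1)]
    note nN = aut_D_N[OF \<phi> n(1)] and mN = aut_D_N[OF \<phi> m(1)]
    \<comment> \<open>Since \<open>m\<close> is nonzero at no other arrow with the source of
      \<open>b\<close>, the convolution has a single term and no cancellation can occur.\<close>
    have "coef (n o\<^sub>L m) (a \<diamondop> b) = coef n ((a \<diamondop> b) \<diamondop> iv b) * coef m b"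
      unfolding coef_compose[OF nA mA]
    proof (rule infsum_single)
      fix c assume c: "c \<in> {c. d c = d (a \<diamondop> b)}" "c \<noteq> b"
      have "coef m c = 0" using N_uniq(1)[OF m(1), of c b] m(2) c ab by auto
      then show "coef n ((a \<diamondop> b) \<diamondop> iv c) * coef m c = 0" by simp
    qed (use ab in simp)
    then have "coef (n o\<^sub>L m) (a \<diamondop> b) \<noteq> 0" using ab n m by simp
    then have "coef (\<phi> n o\<^sub>L \<phi> m) (\<Phi> (a \<diamondop> b)) \<noteq> 0"
      using implements_zero[OF imp A_compose[OF nA mA]] star_autD(6)[OF st nA mA] by simp
    \<comment> \<open>The factorization of \<open>\<Phi> (a \<diamondop> b)\<close> found in the
      image is forced: the second factor by its source, the first by its range.\<close>
    then obtain c where c: "d c = d (\<Phi> (a \<diamondop> b))" "coef (\<phi> n) (\<Phi> (a \<diamondop> b) \<diamondop> iv c) \<noteq> 0" "coef (\<phi> m) c \<noteq> 0"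
      using coef_compose_nonzero[OF N_A[OF nN] N_A[OF mN]] by blast
    have dc: "d c = d (\<Phi> b)" using c(1) ab by (simp add: D)
    have "coef (\<phi> m) (\<Phi> b) \<noteq> 0" using implements_zero[OF imp mA] m(2) by simp
    then have cb: "c = \<Phi> b" using N_uniq(1)[OF mN c(3)] dc by simp
    have "coef (\<phi> n) (\<Phi> a) \<noteq> 0" using implements_zero[OF imp nA] n(2) by simp
    moreover have "r (\<Phi> (a \<diamondop> b) \<diamondop> iv c) = r (\<Phi> a)" using c(1) ab by (simp add: R)
    ultimately have "\<Phi> (a \<diamondop> b) \<diamondop> iv c = \<Phi> a" using N_uniq(2)[OF nN c(2)] by simp
    then have "(\<Phi> (a \<diamondop> b) \<diamondop> iv c) \<diamondop> c = \<Phi> a \<diamondop> \<Phi> b" using cb by simp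
    then show ?thesis using c(1) by simp
  qed
  have "open_map euclidean euclidean \<Phi>"
    using implements_open[OF st imp] by (simp add: open_map_def)
  moreover have "continuous_on UNIV \<Phi>"
    unfolding continuous_on_open_vimage[OF open_UNIV]
  proof (intro allI impI)
    fix W :: "'g set" assume "open W"
    then have "open (inv_into UNIV \<Phi> ` W)" by (rule implements_open[OF star_aut_inv[OF st] implements_inv[OF imp st]])
    then show "open (\<Phi> -` W \<inter> UNIV)" using bij_vimage_eq_inv_image[OF bij] by simp
  qed
  ultimately have "homeomorphic_map euclidean euclidean \<Phi>"
    using bij by (intro bijective_open_imp_homeomorphic_map) (auto simp: bij_def)
  then show ?thesis using D R M by (simp add: groupoid_aut_def)
qed

text \<open>If the diagonal is fixed, \<open>\<Phi>\<close> preserves source and range. The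
  quotients of \<open>\<Phi> a\<close> by \<open>a\<close>, for \<open>a\<close> in an open
  bisection, are then isotropy arrows filling an open set, so effectiveness makes them units. For
  the other direction, \<open>unit_rel\<close> between each unit and itself says that diagonal
  elements keep all their values.\<close>

lemma implements_id_iff:
  assumes \<phi>: "\<phi> \<in> aut_D"
  shows "implements id \<phi> \<longleftrightarrow> (\<forall>g\<in>D. \<phi> g = g)"
proof
  note st = aut_D_star[OF \<phi>]
  assume imp: "implements id \<phi>"
  show "\<forall>g\<in>D. \<phi> g = g"
  proof (intro ballI coef_eqI)
    fix g a assume g: "g \<in> D"
    show "coef (\<phi> g) a = coef g a"
      using unit_relD(3)[OF implements_unit(2)[OF \<phi> imp] g] D_off[OF g] D_off[OF aut_D_D[OF \<phi> g]]
      by (cases "a \<in> U\<^sub>0") auto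
  qed (auto intro: star_autD(3)[OF st] D_A)
next
  note st = aut_D_star[OF \<phi>]
  assume fixed: "\<forall>g\<in>D. \<phi> g = g"
  obtain \<Phi> where imp: "implements \<Phi> \<phi>" using implements_exists[OF \<phi>] by blast
  have "unit_rel \<phi> u u" if "u \<in> U\<^sub>0" for u using that fixed by (simp add: unit_rel_def)
  then have dr: "d (\<Phi> a) = d a" "r (\<Phi> a) = r a" for a
    using unit_rel_functional[OF \<phi>] implements_unit_rel[OF \<phi> imp, of a] d_unit r_unit by metis+
  have "\<Phi> a = a" for a
  proof -
    obtain U where U: "open U" "a \<in> U" "bisection U" by (rule open_bisection_nhd)
    have "\<Phi> a \<diamondop> iv a \<in> U\<^sub>0"
    proof (rule effectiveD[OF implements_open[OF st imp U(1)] open_iv[OF U(1)]])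
      fix x y assume xy: "x \<in> \<Phi> ` U" "y \<in> iv ` U" "d x = r y"
      then obtain z w where zw: "z \<in> U" "x = \<Phi> z" "w \<in> U" "y = iv w" by blast
      have "d z = d w" using xy(3) zw dr by simp
      then have "z = w" using bisectionD(1)[OF U(3) zw(1,3)] by simp
      then show "d y = r x" using zw dr by simp
    qed (use U dr in auto)
    then show ?thesis using quotient_unit_iff[of "\<Phi> a" a] dr by simp
  qed
  then have "\<Phi> = id" by auto
  with imp show "implements id \<phi>" by simp
qed

end

section \<open>Permutation operators\<close>

definition permute :: "('a \<Rightarrow> 'a) \<Rightarrow> 'a op"
  where "permute \<Psi> = Blinfun (\<lambda>x. Abs_ell2 (\<lambda>a. Rep_ell2 x (\<Psi> a)))"

lemma Rep_permute:
  assumes "inj \<Psi>"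
  shows "Rep_ell2 (permute \<Psi> x) a = Rep_ell2 x (\<Psi> a)"
proof -
  have "(\<Sum>a\<in>F. (cmod (Rep_ell2 x (\<Psi> a)))\<^sup>2) \<le> 1\<^sup>2 * (norm x)\<^sup>2" if F: "finite F" for F x
  proof -
    have inj: "inj_on \<Psi> F" using assms by (rule inj_on_subset) simp
    have "(\<Sum>a\<in>F. (cmod (Rep_ell2 x (\<Psi> a)))\<^sup>2) = (\<Sum>b\<in>\<Psi> ` F. (cmod (Rep_ell2 x b))\<^sup>2)"
      by (simp add: sum.reindex[OF inj])
    also have "\<dots> \<le> (norm x)\<^sup>2" by (rule ell2_finite_sum_le) (simp add: F)
    finally show ?thesis by simp
  qed
  then have "Rep_ell2 (permute \<Psi> x) = (\<lambda>a. Rep_ell2 x (\<Psi> a))"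
    unfolding permute_def by (rule ell2_operatorI) simp_all
  then show ?thesis by simp
qed

lemma permute_complex_linear: "inj \<Psi> \<Longrightarrow> complex_linear_op (permute \<Psi>)"
  by (simp add: complex_linear_op_def Rep_ell2_inject[symmetric] fun_eq_iff Rep_permute scaleC_ell2.rep_eq)

lemma permute_ket: "bij \<Phi> \<Longrightarrow> permute \<Phi> (ket b) = ket (inv_into UNIV \<Phi> b)"
  by (auto simp: Rep_ell2_inject[symmetric] fun_eq_iff Rep_permute[OF bij_is_inj] ket.rep_eq
      bij_inv_eq_iff)

lemma is_adjoint_permute:
  assumes "bij \<Phi>"
  shows "is_adjoint (permute (inv_into UNIV \<Phi>)) (permute \<Phi>)"
proof -
  have inj: "inj \<Phi>" "inj (inv_into UNIV \<Phi>)"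
    using assms bij_imp_bij_inv bij_is_inj by blast+
  show ?thesis
    by (rule is_adjoint_ketI)
      (use assms surj_f_inv_f[OF bij_is_surj[OF assms]] in \<open>auto simp: permute_complex_linear inj Rep_permute ket.rep_eq bij_inv_eq_iff\<close>)
qed

text \<open>Conjugation by a permutation unitary acts on all operators at once, so the induced
  automorphism is available without extending it by continuity from compactly supported
  functions.\<close>

definition conj_op :: "('a \<Rightarrow> 'a) \<Rightarrow> 'a op \<Rightarrow> 'a op"
  where "conj_op \<Phi> T = permute (inv_into UNIV \<Phi>) o\<^sub>L (T o\<^sub>L permute \<Phi>)"

lemma conj_op_apply:
  assumes "bij \<Phi>"
  shows "Rep_ell2 (conj_op \<Phi> T x) a = Rep_ell2 (T (permute \<Phi> x)) (inv_into UNIV \<Phi> a)"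
  by (simp add: conj_op_def Rep_permute[OF bij_is_inj[OF bij_imp_bij_inv[OF assms]]])

lemma permute_inverse:
  assumes "bij \<Phi>"
  shows "permute \<Phi> (permute (inv_into UNIV \<Phi>) x) = x" "permute (inv_into UNIV \<Phi>) (permute \<Phi> x) = x"
  using assms bij_imp_bij_inv[OF assms]
  by (simp_all add: Rep_ell2_inject[symmetric] fun_eq_iff Rep_permute bij_is_inj bij_is_surj surj_f_inv_f)

lemma bounded_linear_conj_op: "bounded_linear (conj_op \<Phi>)"
  unfolding conj_op_def
  by (rule bounded_linear_compose[OF bounded_bilinear.bounded_linear_right[OF bounded_bilinear_blinfun_compose]
        bounded_bilinear.bounded_linear_left[OF bounded_bilinear_blinfun_compose]])

lemma conj_op_scaleC: "bij \<Phi> \<Longrightarrow> conj_op \<Phi> (scaleC_op c T) = scaleC_op c (conj_op \<Phi> T)"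
  by (rule blinfun_eqI) (simp add: Rep_ell2_inject[symmetric] fun_eq_iff conj_op_apply Rep_scaleC_op)

lemma conj_op_compose: "bij \<Phi> \<Longrightarrow> conj_op \<Phi> (S o\<^sub>L T) = conj_op \<Phi> S o\<^sub>L conj_op \<Phi> T"
  by (rule blinfun_eqI) (simp add: conj_op_def permute_inverse)

lemma conj_op_inverse:
  "bij \<Phi> \<Longrightarrow> conj_op \<Phi> (conj_op (inv_into UNIV \<Phi>) T) = T"
  "bij \<Phi> \<Longrightarrow> conj_op (inv_into UNIV \<Phi>) (conj_op \<Phi> T) = T"
  by (rule blinfun_eqI, simp add: conj_op_def permute_inverse inv_inv_eq)+

lemma is_adjoint_conj_op:
  assumes "bij \<Phi>" "is_adjoint S T"
  shows "is_adjoint (conj_op \<Phi> S) (conj_op \<Phi> T)"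
proof -
  have "is_adjoint ((permute (inv_into UNIV \<Phi>) o\<^sub>L S) o\<^sub>L permute \<Phi>)
      (permute (inv_into UNIV \<Phi>) o\<^sub>L (T o\<^sub>L permute \<Phi>))"
    using is_adjoint_commute[of "permute \<Phi>"] is_adjoint_permute[OF assms(1)] assms(2)
    by (intro is_adjoint_compose) simp_all
  moreover have "(permute (inv_into UNIV \<Phi>) o\<^sub>L S) o\<^sub>L permute \<Phi> = conj_op \<Phi> S"
    by (rule blinfun_eqI) (simp add: conj_op_def)
  ultimately show ?thesis by (simp add: conj_op_def)
qed

context effective_etale_groupoid
begin

section \<open>Automorphisms induced by groupoid automorphisms\<close>

lemma groupoid_autD:
  assumes "\<Phi> \<in> groupoid_aut G"
  shows "bij \<Phi>" "continuous_on UNIV \<Phi>" "open W \<Longrightarrow> open (\<Phi> ` W)"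
    "d (\<Phi> a) = \<Phi> (d a)" "r (\<Phi> a) = \<Phi> (r a)" "d a = r b \<Longrightarrow> \<Phi> (a \<diamondop> b) = \<Phi> a \<diamondop> \<Phi> b"
proof -
  have h: "homeomorphic_map euclidean euclidean \<Phi>" using assms by (simp add: groupoid_aut_def)
  show "bij \<Phi>" "continuous_on UNIV \<Phi>" "open W \<Longrightarrow> open (\<Phi> ` W)"
    using h unfolding homeomorphic_eq_everything_map
    by (auto simp: bij_def open_map_def)
qed (use assms in \<open>auto simp: groupoid_aut_def\<close>)

lemma groupoid_aut_iv:
  assumes "\<Phi> \<in> groupoid_aut G"
  shows "\<Phi> (iv a) = iv (\<Phi> a)"
proof -
  note \<Phi> = groupoid_autD[OF assms]
  have "\<Phi> a \<diamondop> \<Phi> (iv a) = \<Phi> a \<diamondop> iv (\<Phi> a)"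
    using \<Phi>(6)[of a "iv a"] by (simp add: \<Phi>(4,5))
  then show ?thesis by (rule left_cancel[rotated 2]) (simp_all add: \<Phi>(4,5))
qed

lemma groupoid_autI:
  assumes "bij \<Phi>" "continuous_on UNIV \<Phi>" "\<And>W. open W \<Longrightarrow> open (\<Phi> ` W)"
    "\<And>a. d (\<Phi> a) = \<Phi> (d a)" "\<And>a. r (\<Phi> a) = \<Phi> (r a)" "\<And>a b. d a = r b \<Longrightarrow> \<Phi> (a \<diamondop> b) = \<Phi> a \<diamondop> \<Phi> b"
  shows "\<Phi> \<in> groupoid_aut G"
proof -
  have "homeomorphic_map euclidean euclidean \<Phi>"
    using assms(1-3) by (intro bijective_open_imp_homeomorphic_map) (auto simp: bij_def open_map_def)
  then show ?thesis using assms(4-6) by (simp add: groupoid_aut_def)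
qed

lemma groupoid_aut_inv:
  assumes "\<Phi> \<in> groupoid_aut G"
  shows "inv_into UNIV \<Phi> \<in> groupoid_aut G"
proof -
  note \<Phi> = groupoid_autD[OF assms]
  let ?\<Psi> = "inv_into UNIV \<Phi>"
  note [simp] = inv_f_f[OF bij_is_inj[OF \<Phi>(1)]] surj_f_inv_f[OF bij_is_surj[OF \<Phi>(1)]]
  have eqI: "?\<Psi> a = b" if "a = \<Phi> b" for a b using that by simp
  show ?thesis
  proof (rule groupoid_autI)
    show "bij ?\<Psi>" by (rule bij_imp_bij_inv[OF \<Phi>(1)])
    show "continuous_on UNIV ?\<Psi>"
      unfolding continuous_on_open_vimage[OF open_UNIV]
      using \<Phi>(3) by (auto simp: bij_vimage_eq_inv_image[OF bij_imp_bij_inv[OF \<Phi>(1)]] inv_inv_eq \<Phi>(1))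
    show "open (?\<Psi> ` W)" if "open W" for W
      using that \<Phi>(2) bij_vimage_eq_inv_image[OF \<Phi>(1), of W] by (metis open_UNIV continuous_on_open_vimage inf_top.right_neutral)
    show d: "d (?\<Psi> a) = ?\<Psi> (d a)" for a by (rule eqI[symmetric]) (simp flip: \<Phi>(4))
    show r: "r (?\<Psi> a) = ?\<Psi> (r a)" for a by (rule eqI[symmetric]) (simp flip: \<Phi>(5))
    show "?\<Psi> (a \<diamondop> b) = ?\<Psi> a \<diamondop> ?\<Psi> b" if "d a = r b" for a b
      by (rule eqI) (simp add: \<Phi>(6) d r that)
  qed
qed

lemma groupoid_aut_comp:
  assumes "\<Phi> \<in> groupoid_aut G" "\<Psi> \<in> groupoid_aut G"
  shows "\<Phi> \<circ> \<Psi> \<in> groupoid_aut G"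
proof -
  note \<Phi> = groupoid_autD[OF assms(1)] and \<Psi> = groupoid_autD[OF assms(2)]
  show ?thesis
  proof (rule groupoid_autI)
    show "continuous_on UNIV (\<Phi> \<circ> \<Psi>)"
      by (intro continuous_on_compose \<Psi>(2) continuous_on_subset[OF \<Phi>(2)]) simp
    show "open ((\<Phi> \<circ> \<Psi>) ` W)" if "open W" for W
      unfolding image_comp[symmetric] by (intro \<Phi>(3) \<Psi>(3) that)
  qed (simp_all add: \<Phi> \<Psi> bij_comp)
qed

lemma Cc_comp:
  assumes \<Phi>: "\<Phi> \<in> groupoid_aut G" and f: "f \<in> Cc UNIV"
  shows "f \<circ> inv_into UNIV \<Phi> \<in> Cc UNIV"
proof (rule CcI[where K = "\<Phi> ` closure {a. f a \<noteq> 0}"])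
  note inv = groupoid_autD[OF groupoid_aut_inv[OF \<Phi>]]
  show "continuous_on UNIV (f \<circ> inv_into UNIV \<Phi>)"
    by (intro continuous_on_compose inv(2) continuous_on_subset[OF CcD(1)[OF f]]) simp
  show "compact (\<Phi> ` closure {a. f a \<noteq> 0})"
    by (intro compact_continuous_image CcD(2)[OF f] continuous_on_subset[OF groupoid_autD(2)[OF \<Phi>]]) simp
  show "a \<in> \<Phi> ` closure {a. f a \<noteq> 0}" if "(f \<circ> inv_into UNIV \<Phi>) a \<noteq> 0" for a
    by (rule image_eqI[of _ _ "inv_into UNIV \<Phi> a"])
      (use that CcD(4)[OF f] surj_f_inv_f[OF bij_is_surj[OF groupoid_autD(1)[OF \<Phi>]]] in auto)
qed simp

text \<open>The two matrices agree entrywise: a groupoid automorphism commutes with forming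
  quotients of arrows and respects equality of sources.\<close>

lemma conj_op_L:
  assumes \<Phi>: "\<Phi> \<in> groupoid_aut G" and f: "f \<in> Cc UNIV"
  shows "conj_op \<Phi> (L f) = L (f \<circ> inv_into UNIV \<Phi>)"
proof (rule op_eqI)
  note bij = groupoid_autD(1)[OF \<Phi>]
  note inv = groupoid_aut_inv[OF \<Phi>]
  note inv' = groupoid_autD[OF inv]
  have f': "f \<circ> inv_into UNIV \<Phi> \<in> Cc UNIV" by (rule Cc_comp[OF \<Phi> f])
  show "complex_linear_op (conj_op \<Phi> (L f))"
    unfolding conj_op_def using bij
    by (intro complex_linear_op_compose permute_complex_linear L_complex_linear f bij_is_inj bij_imp_bij_inv)
  show "complex_linear_op (L (f \<circ> inv_into UNIV \<Phi>))" by (rule L_complex_linear[OF f'])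
  show "conj_op \<Phi> (L f) (ket b) = L (f \<circ> inv_into UNIV \<Phi>) (ket b)" for b
    unfolding Rep_ell2_inject[symmetric]
  proof
    fix a
    have "inv_into UNIV \<Phi> (d a) = inv_into UNIV \<Phi> (d b) \<longleftrightarrow> d a = d b"
      using inj_eq[OF bij_is_inj[OF inv'(1)]] by simp
    then show "Rep_ell2 (conj_op \<Phi> (L f) (ket b)) a = Rep_ell2 (L (f \<circ> inv_into UNIV \<Phi>) (ket b)) a"
      by (auto simp: conj_op_apply[OF bij] permute_ket[OF bij] L_ket[OF f] L_ket[OF f'] inv'(4,6)
          groupoid_aut_iv[OF inv])
  qed
qed

lemma conj_op_A:
  assumes \<Phi>: "\<Phi> \<in> groupoid_aut G" and T: "T \<in> A"
  shows "conj_op \<Phi> T \<in> A"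
  using T
proof (induction T rule: reduced_algebra_induct)
  case closed
  show ?case
    using continuous_closed_vimage[OF reduced_algebra_closed linear_continuous_at[OF bounded_linear_conj_op]]
    by (simp add: vimage_def)
qed (simp add: conj_op_L[OF \<Phi>] L_in Cc_comp[OF \<Phi>])

lemma coef_conj_op:
  assumes \<Phi>: "\<Phi> \<in> groupoid_aut G" and T: "T \<in> A"
  shows "coef (conj_op \<Phi> T) (\<Phi> a) = coef T a"
  using T
proof (induction T rule: reduced_algebra_induct)
  case closed
  show ?case
    by (intro closed_Collect_eq continuous_intros bounded_linear.continuous_on[OF bounded_linear_conj_op])
next
  case (L f)
  then show ?case
    by (simp add: conj_op_L[OF \<Phi>] Cc_comp[OF \<Phi>] inv_f_f[OF bij_is_inj[OF groupoid_autD(1)[OF \<Phi>]]])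
qed

definition aut_of :: "('g \<Rightarrow> 'g) \<Rightarrow> 'g op \<Rightarrow> 'g op"
  where "aut_of \<Phi> = restrict (conj_op \<Phi>) A"

lemma aut_of_apply: "T \<in> A \<Longrightarrow> aut_of \<Phi> T = conj_op \<Phi> T"
  by (simp add: aut_of_def)

lemma aut_of_star:
  assumes \<Phi>: "\<Phi> \<in> groupoid_aut G"
  shows "aut_of \<Phi> \<in> star_aut A"
proof -
  note bij = groupoid_autD(1)[OF \<Phi>]
  have "bij_betw (conj_op \<Phi>) A A"
    by (rule bij_betw_byWitness[where f' = "conj_op (inv_into UNIV \<Phi>)"])
      (use bij \<Phi> in \<open>auto simp: conj_op_inverse intro: conj_op_A groupoid_aut_inv\<close>)
  then have "bij_betw (aut_of \<Phi>) A A"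
    by (subst bij_betw_cong[of A _ "conj_op \<Phi>"]) (simp_all add: aut_of_apply)
  then have "aut_of \<Phi> \<in> Bij A" by (simp add: Bij_def aut_of_def)
  then show ?thesis
    using bij
    by (simp add: star_aut_def linear_simps(1)[OF bounded_linear_conj_op] aut_of_apply A_add A_scaleC A_compose conj_op_scaleC conj_op_compose is_adjoint_conj_op)
qed

lemma implements_aut_of: "\<Phi> \<in> groupoid_aut G \<Longrightarrow> implements \<Phi> (aut_of \<Phi>)"
  by (simp add: implements_def groupoid_autD(1) aut_of_apply coef_conj_op)

lemma groupoid_aut_units:
  assumes "\<Phi> \<in> groupoid_aut G"
  shows "\<Phi> u \<in> U\<^sub>0 \<longleftrightarrow> u \<in> U\<^sub>0"
  using groupoid_autD(1,4)[OF assms] unfolding unit_iff by (metis bij_is_inj injD)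

lemma aut_of_aut_D:
  assumes \<Phi>: "\<Phi> \<in> groupoid_aut G"
  shows "aut_of \<Phi> \<in> aut_D"
proof -
  have in_D: "conj_op \<Psi> g \<in> D" if \<Psi>: "\<Psi> \<in> groupoid_aut G" and g: "g \<in> D" for \<Psi> g
  proof (rule D_I)
    show "conj_op \<Psi> g \<in> A" by (rule conj_op_A[OF \<Psi> D_A[OF g]])
    fix b assume b: "b \<notin> U\<^sub>0"
    obtain a where a: "b = \<Psi> a" using groupoid_autD(1)[OF \<Psi>] by (metis bij_pointE)
    then have "a \<notin> U\<^sub>0" using b groupoid_aut_units[OF \<Psi>] by simp
    then show "coef (conj_op \<Psi> g) b = 0"
      unfolding a coef_conj_op[OF \<Psi> D_A[OF g]] by (rule D_off[OF g])
  qed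
  have "aut_of \<Phi> ` D = conj_op \<Phi> ` D"
    by (intro image_cong) (auto simp: aut_of_apply D_A)
  also have "\<dots> = D"
  proof
    show "conj_op \<Phi> ` D \<subseteq> D" using in_D[OF \<Phi>] by blast
    show "D \<subseteq> conj_op \<Phi> ` D"
    proof
      fix g assume "g \<in> D"
      then have "conj_op (inv_into UNIV \<Phi>) g \<in> D" by (rule in_D[OF groupoid_aut_inv[OF \<Phi>]])
      then show "g \<in> conj_op \<Phi> ` D"
        by (rule image_eqI[rotated]) (simp add: conj_op_inverse[OF groupoid_autD(1)[OF \<Phi>]])
    qed
  qed
  finally show ?thesis using aut_of_star[OF \<Phi>] by (simp add: aut_D_def)
qed

text \<open>Automorphisms are isometric, hence determined on a dense set; extensionality settles the
  arguments outside \<open>A\<close>.\<close>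

lemma star_aut_eqI:
  assumes \<phi>: "\<phi> \<in> star_aut A" and \<psi>: "\<psi> \<in> star_aut A" and eq: "\<And>f. f \<in> Cc UNIV \<Longrightarrow> \<phi> (L f) = \<psi> (L f)"
  shows "\<phi> = \<psi>"
proof (rule extensionalityI[OF star_autD(2)[OF \<phi>] star_autD(2)[OF \<psi>]])
  fix T assume T: "T \<in> A"
  obtain f where f: "\<And>n. f n \<in> Cc UNIV" "(\<lambda>n. L (f n)) \<longlonglongrightarrow> T"
    using reduced_algebra_seq[OF T] by blast
  have "(\<lambda>n. \<phi> (L (f n))) \<longlonglongrightarrow> \<psi> T"
    using star_aut_tendsto[OF \<psi> L_in[OF f(1)] T f(2)] by (simp only: eq[OF f(1)])
  then show "\<phi> T = \<psi> T"
    by (rule LIMSEQ_unique[OF star_aut_tendsto[OF \<phi> L_in[OF f(1)] T f(2)]])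
qed

lemma induced_star_aut_eq:
  assumes \<Phi>: "\<Phi> \<in> groupoid_aut G"
  shows "induced_star_aut G \<Phi> = aut_of \<Phi>"
  unfolding induced_star_aut_def
proof (rule the_equality)
  show "aut_of \<Phi> \<in> star_aut A \<and> (\<forall>f\<in>Cc UNIV. aut_of \<Phi> (L f) = L (f \<circ> inv_into UNIV \<Phi>))"
    by (simp add: aut_of_star[OF \<Phi>] aut_of_apply L_in conj_op_L[OF \<Phi>])
  then show "\<phi> = aut_of \<Phi>"
    if "\<phi> \<in> star_aut A \<and> (\<forall>f\<in>Cc UNIV. \<phi> (L f) = L (f \<circ> inv_into UNIV \<Phi>))" for \<phi>
    using that by (intro star_aut_eqI) auto
qed

lemma aut_of_comp:
  assumes "\<Phi> \<in> groupoid_aut G" "\<Psi> \<in> groupoid_aut G"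
  shows "aut_of (\<Phi> \<circ> \<Psi>) = compose A (aut_of \<Phi>) (aut_of \<Psi>)"
proof (rule star_aut_eqI)
  show "aut_of (\<Phi> \<circ> \<Psi>) \<in> star_aut A" by (rule aut_of_star[OF groupoid_aut_comp[OF assms]])
  show "compose A (aut_of \<Phi>) (aut_of \<Psi>) \<in> star_aut A" by (intro star_aut_compose aut_of_star assms)
  fix f :: "'g \<Rightarrow> complex" assume f: "f \<in> Cc UNIV"
  have "inv_into UNIV (\<Phi> \<circ> \<Psi>) = inv_into UNIV \<Psi> \<circ> inv_into UNIV \<Phi>"
    by (rule o_inv_distrib) (use assms groupoid_autD(1) in auto)
  then show "aut_of (\<Phi> \<circ> \<Psi>) (L f) = compose A (aut_of \<Phi>) (aut_of \<Psi>) (L f)"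
    using f assms
    by (simp add: compose_eq aut_of_apply L_in conj_op_A conj_op_L groupoid_aut_comp Cc_comp comp_assoc)
qed

lemma aut_of_inv:
  assumes "\<Phi> \<in> groupoid_aut G"
  shows "aut_of (inv_into UNIV \<Phi>) = inv_aut (aut_of \<Phi>)"
proof (rule star_aut_eqI)
  show "aut_of (inv_into UNIV \<Phi>) \<in> star_aut A" by (rule aut_of_star[OF groupoid_aut_inv[OF assms]])
  show "inv_aut (aut_of \<Phi>) \<in> star_aut A" by (rule star_aut_inv[OF aut_of_star[OF assms]])
  fix f :: "'g \<Rightarrow> complex" assume f: "f \<in> Cc UNIV"
  have A: "conj_op (inv_into UNIV \<Phi>) (L f) \<in> A" by (rule conj_op_A[OF groupoid_aut_inv[OF assms] L_in[OF f]])
  have "inv_aut (aut_of \<Phi>) (aut_of \<Phi> (conj_op (inv_into UNIV \<Phi>) (L f))) = conj_op (inv_into UNIV \<Phi>) (L f)"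
    by (rule star_aut_inv_apply[OF aut_of_star[OF assms] A])
  then show "aut_of (inv_into UNIV \<Phi>) (L f) = inv_aut (aut_of \<Phi>) (L f)"
    by (simp only: aut_of_apply[OF A] conj_op_inverse(1)[OF groupoid_autD(1)[OF assms]] aut_of_apply[OF L_in[OF f]])
qed

end

section \<open>Topological groups\<close>

text \<open>The majorant \<open>h\<close> may depend on the point and on \<open>e\<close>. This form
  suits the point-norm topology, where the natural majorants are distances between values at fixed
  elements.\<close>

lemma continuous_map_dist_le:
  fixes f :: "'a \<Rightarrow> 'b::metric_space"
  assumes "\<And>x e. x \<in> topspace X \<Longrightarrow> 0 < e \<Longrightarrow>
    \<exists>h. continuous_map X euclideanreal h \<and> h x < e \<and> (\<forall>y\<in>topspace X. dist (f y) (f x) \<le> h y)"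
  shows "continuous_map X euclidean f"
  unfolding continuous_map_def
proof (intro conjI allI impI)
  fix U :: "'b set" assume "openin euclidean U"
  then have U: "open U" by simp
  show "openin X {x \<in> topspace X. f x \<in> U}"
  proof (subst openin_subopen, intro ballI)
    fix x assume x: "x \<in> {x \<in> topspace X. f x \<in> U}"
    then have "f x \<in> U" by simp
    then obtain e where e: "0 < e" "ball (f x) e \<subseteq> U" using U open_contains_ball by blast
    obtain h where h: "continuous_map X euclideanreal h" "h x < e" "\<forall>y\<in>topspace X. dist (f y) (f x) \<le> h y"
      using assms[of x e] x e(1) by auto
    have "openin X {y \<in> topspace X. h y \<in> {..<e}}"
      by (rule openin_continuous_map_preimage[OF h(1)]) simp
    moreover have "f y \<in> U" if "y \<in> topspace X" "h y < e" for y
    proof -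
      have "dist (f y) (f x) \<le> h y" using h(3) that(1) by blast
      then have "f y \<in> ball (f x) e" using that(2) by (simp add: dist_commute)
      then show ?thesis using e(2) by blast
    qed
    ultimately show "\<exists>T. openin X T \<and> x \<in> T \<and> T \<subseteq> {x \<in> topspace X. f x \<in> U}"
      using x h(2) by (intro exI[of _ "{y \<in> topspace X. h y \<in> {..<e}}"]) auto
  qed
qed simp

lemma continuous_map_dist_const:
  fixes f :: "'a \<Rightarrow> 'b::metric_space"
  assumes "continuous_map X euclidean f"
  shows "continuous_map X euclideanreal (\<lambda>x. dist (f x) c)"
proof -
  have "continuous_on UNIV (\<lambda>y. dist y c)" by (intro continuous_intros)
  then have "continuous_map euclidean euclideanreal (\<lambda>y. dist y c)" by simp
  from continuous_map_compose[OF assms this] show ?thesis by (simp add: o_def)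
qed

text \<open>Meant for the quotient group: continuity of its operations is carried back from
  \<open>L\<close> along the homeomorphic isomorphism instead of being checked on cosets.\<close>

lemma topological_group_transfer:
  assumes L: "topological_group L Y" and K: "group K" and h: "h \<in> iso K L" "homeomorphic_map X Y h"
    and X: "topspace X = carrier K"
  shows "topological_group K X"
proof -
  interpret L: group L using L by (simp add: topological_group_def)
  interpret K: group K by (rule K)
  have hom: "h \<in> hom K L" using h(1) by (simp add: iso_def)
  interpret gh: group_hom K L h by unfold_locales (rule hom)
  obtain g where g: "homeomorphic_maps X Y h g" using h(2) homeomorphic_map_maps by blast
  have gh: "g (h x) = x" if "x \<in> carrier K" for x
    using g that X by (simp add: homeomorphic_maps_def)
  have contg: "continuous_map Y X g" and conth: "continuous_map X Y h"
    using g by (auto simp: homeomorphic_maps_def)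
  have m: "continuous_map (prod_topology Y Y) Y (\<lambda>(x, y). x \<otimes>\<^bsub>L\<^esub> y)" and i: "continuous_map Y Y (\<lambda>x. inv\<^bsub>L\<^esub> x)"
    using L by (auto simp: topological_group_def)
  have "continuous_map (prod_topology X X) (prod_topology Y Y) (\<lambda>z. (h (fst z), h (snd z)))"
    using continuous_map_compose[OF continuous_map_fst conth] continuous_map_compose[OF continuous_map_snd conth]
    by (intro continuous_map_pairedI) (simp_all add: o_def)
  from continuous_map_compose[OF continuous_map_compose[OF this m] contg]
  have "continuous_map (prod_topology X X) X (\<lambda>z. g (h (fst z) \<otimes>\<^bsub>L\<^esub> h (snd z)))"
    by (simp add: o_def)
  then have "continuous_map (prod_topology X X) X (\<lambda>(x, y). x \<otimes>\<^bsub>K\<^esub> y)"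
  proof (rule continuous_map_eq)
    fix z assume "z \<in> topspace (prod_topology X X)"
    then have "fst z \<in> carrier K" "snd z \<in> carrier K" by (simp_all add: mem_Times_iff X)
    then show "g (h (fst z) \<otimes>\<^bsub>L\<^esub> h (snd z)) = (case z of (x, y) \<Rightarrow> x \<otimes>\<^bsub>K\<^esub> y)"
      using gh[of "fst z \<otimes>\<^bsub>K\<^esub> snd z"] by (simp add: case_prod_beta)
  qed
  moreover from continuous_map_compose[OF continuous_map_compose[OF conth i] contg]
  have "continuous_map X X (\<lambda>x. g (inv\<^bsub>L\<^esub> (h x)))" by (simp add: o_def)
  then have "continuous_map X X (\<lambda>x. inv\<^bsub>K\<^esub> x)"
  proof (rule continuous_map_eq)
    fix x assume "x \<in> topspace X"
    then show "g (inv\<^bsub>L\<^esub> (h x)) = inv\<^bsub>K\<^esub> x"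
      using gh[of "inv\<^bsub>K\<^esub> x"] X by simp
  qed
  ultimately show ?thesis using K X by (simp add: topological_group_def)
qed

text \<open>A continuous map with a continuous section is a quotient map.\<close>

lemma topological_group_isomorphic_quotient:
  assumes K: "group K" and p: "p \<in> hom K L" and L: "topological_group L Y"
    and X: "topspace X = carrier K"
    and cont: "continuous_map X Y p" and sec: "continuous_map Y X s" "\<And>y. y \<in> carrier L \<Longrightarrow> p (s y) = y"
    and N: "N = kernel K L p"
  shows "topological_group_isomorphic (K Mod N) (quotient_topology X (\<lambda>x. N #>\<^bsub>K\<^esub> x)) L Y"
proof -
  let ?\<pi> = "\<lambda>x. N #>\<^bsub>K\<^esub> x" and ?h = "\<lambda>Z. the_elem (p ` Z)"
  let ?Q = "quotient_topology X ?\<pi>"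
  have gL: "group L" and Y: "topspace Y = carrier L" using L by (auto simp: topological_group_def)
  interpret gh: group_hom K L p by (intro group_hom.intro group_hom_axioms.intro K gL p)
  have quot: "quotient_map X Y p"
    by (rule retraction_imp_quotient_map)
      (use cont sec Y in \<open>auto simp: retraction_map_def retraction_maps_def\<close>)
  have surj: "p ` carrier K = carrier L"
    using quotient_imp_surjective_map[OF quot] X Y by simp
  have iso: "?h \<in> iso (K Mod N) L" unfolding N by (rule gh.FactGroup_iso_set[OF surj])
  have grp: "group (K Mod N)"
    unfolding N using gh.normal_kernel by (rule normal.factorgroup_is_group)
  have \<pi>: "quotient_map X ?Q ?\<pi>" by (rule quotient_map_quotient_topology)
  have h\<pi>: "?h (?\<pi> x) = p x" if x: "x \<in> carrier K" for x
  proof -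
    have "p ` ?\<pi> x = {p x}"
    proof
      show "p ` ?\<pi> x \<subseteq> {p x}"
        using x by (auto simp: N kernel_def r_coset_def)
      have "\<one>\<^bsub>K\<^esub> \<in> N" by (simp add: N kernel_def)
      then have "\<one>\<^bsub>K\<^esub> \<otimes>\<^bsub>K\<^esub> x \<in> ?\<pi> x" by (auto simp: r_coset_def)
      then show "{p x} \<subseteq> p ` ?\<pi> x" using x by auto
    qed
    then show ?thesis by simp
  qed
  \<comment> \<open>The composite of the induced map with the projection is the quotient map
    \<open>p\<close>, so the induced bijection is a quotient map itself and thus a
    homeomorphism.\<close>
  have "quotient_map X Y (?h \<circ> ?\<pi>)"
    by (rule quotient_map_eq[OF quot]) (simp add: X h\<pi>)
  then have qh: "quotient_map ?Q Y ?h"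
    using quotient_map_compose_eq[OF \<pi>] by blast
  have "carrier (K Mod N) = ?\<pi> ` carrier K" by (auto simp: FactGroup_def RCOSETS_def)
  then have Q: "topspace ?Q = carrier (K Mod N)"
    using quotient_imp_surjective_map[OF \<pi>] X by simp
  have "homeomorphic_map ?Q Y ?h"
    unfolding homeomorphic_map_def Q using qh iso by (simp add: iso_def bij_betw_def)
  then show ?thesis
    unfolding topological_group_isomorphic_def
    using topological_group_transfer[OF L grp iso _ Q] iso L by blast
qed

context effective_etale_groupoid
begin

section \<open>The point-norm topology and the topological group of groupoid automorphisms\<close>

lemma topspace_point_norm: "topspace (point_norm_topology A) = star_aut A"
  using star_autD(2) by (auto simp: point_norm_topology_def PiE_def)

lemma continuous_map_into_point_norm:
  assumes "\<And>x. x \<in> topspace X \<Longrightarrow> F x \<in> star_aut A" "\<And>T. T \<in> A \<Longrightarrow> continuous_map X euclidean (\<lambda>x. F x T)"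
  shows "continuous_map X (point_norm_topology A) F"
  unfolding point_norm_topology_def continuous_map_in_subtopology continuous_map_componentwise
  using assms star_autD(2) by auto

lemma continuous_map_eval: "T \<in> A \<Longrightarrow> continuous_map (point_norm_topology A) euclidean (\<lambda>\<phi>. \<phi> T)"
  unfolding point_norm_topology_def
  by (intro continuous_map_from_subtopology continuous_map_product_projection)

lemma topspace_groupoid_aut: "topspace (groupoid_aut_topology G) = groupoid_aut G"
  by (auto simp: groupoid_aut_topology_def topspace_pullback_topology topspace_point_norm induced_star_aut_eq aut_of_star)

lemma continuous_map_into_groupoid_aut:
  assumes F: "\<And>x. x \<in> topspace X \<Longrightarrow> F x \<in> groupoid_aut G"
    and cont: "\<And>T. T \<in> A \<Longrightarrow> continuous_map X euclidean (\<lambda>x. aut_of (F x) T)"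
  shows "continuous_map X (groupoid_aut_topology G) F"
  unfolding groupoid_aut_topology_def
proof (rule continuous_map_pullback')
  have "continuous_map X (point_norm_topology A) (\<lambda>x. aut_of (F x))"
    by (intro continuous_map_into_point_norm aut_of_star F cont)
  then show "continuous_map X (point_norm_topology A) (induced_star_aut G \<circ> F)"
    by (rule continuous_map_eq) (simp add: F induced_star_aut_eq)
  show "topspace X \<subseteq> F -` groupoid_aut G" using F by auto
qed

lemma continuous_map_aut_of: "continuous_map (groupoid_aut_topology G) (point_norm_topology A) aut_of"
proof -
  have "continuous_map (groupoid_aut_topology G) (point_norm_topology A) ((\<lambda>\<phi>. \<phi>) \<circ> induced_star_aut G)"
    unfolding groupoid_aut_topology_def by (rule continuous_map_pullback) simp
  then show ?thesis
    by (rule continuous_map_eq) (simp add: topspace_groupoid_aut induced_star_aut_eq)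
qed

lemma continuous_map_aut_of_apply:
  "T \<in> A \<Longrightarrow> continuous_map (groupoid_aut_topology G) euclidean (\<lambda>\<Phi>. aut_of \<Phi> T)"
  using continuous_map_compose[OF continuous_map_aut_of continuous_map_eval] by (simp add: o_def)

lemma group_BijGroup_UNIV_restrict:
  assumes S: "S \<subseteq> groupoid_aut G" "id \<in> S" and comp: "\<And>\<Phi> \<Psi>. \<Phi> \<in> S \<Longrightarrow> \<Psi> \<in> S \<Longrightarrow> \<Phi> \<circ> \<Psi> \<in> S"
    and inv: "\<And>\<Phi>. \<Phi> \<in> S \<Longrightarrow> inv_into UNIV \<Phi> \<in> S"
  shows "group (BijGroup UNIV \<lparr>carrier := S\<rparr>)"
    and "\<Phi> \<in> S \<Longrightarrow> \<Psi> \<in> S \<Longrightarrow> \<Phi> \<otimes>\<^bsub>BijGroup UNIV \<lparr>carrier := S\<rparr>\<^esub> \<Psi> = \<Phi> \<circ> \<Psi>"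
    and "\<Phi> \<in> S \<Longrightarrow> inv\<^bsub>BijGroup UNIV \<lparr>carrier := S\<rparr>\<^esub> \<Phi> = inv_into UNIV \<Phi>"
    and "\<one>\<^bsub>BijGroup UNIV \<lparr>carrier := S\<rparr>\<^esub> = id"
proof -
  have Bij: "\<Phi> \<in> Bij UNIV" if "\<Phi> \<in> S" for \<Phi>
    using groupoid_autD(1) S(1) that by (auto simp: Bij_def)
  have mult: "\<Phi> \<otimes>\<^bsub>BijGroup UNIV\<^esub> \<Psi> = \<Phi> \<circ> \<Psi>" if "\<Phi> \<in> S" "\<Psi> \<in> S" for \<Phi> \<Psi>
    using Bij that by (auto simp: BijGroup_def compose_def)
  have one: "\<one>\<^bsub>BijGroup UNIV\<^esub> = id" by (auto simp: BijGroup_def)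
  have minv: "inv\<^bsub>BijGroup UNIV\<^esub> \<Phi> = inv_into UNIV \<Phi>" if "\<Phi> \<in> S" for \<Phi>
    using inv_BijGroup[OF Bij[OF that]] by (auto simp: fun_eq_iff)
  have sub: "subgroup S (BijGroup UNIV)"
  proof
    show "S \<subseteq> carrier (BijGroup UNIV)" using Bij by (auto simp: BijGroup_def)
  qed (simp_all add: mult one minv S comp inv)
  show "group (BijGroup UNIV \<lparr>carrier := S\<rparr>)"
    by (rule subgroup.subgroup_is_group[OF sub group_BijGroup])
  show "\<Phi> \<in> S \<Longrightarrow> \<Psi> \<in> S \<Longrightarrow> \<Phi> \<otimes>\<^bsub>BijGroup UNIV \<lparr>carrier := S\<rparr>\<^esub> \<Psi> = \<Phi> \<circ> \<Psi>"
    by (simp add: mult)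
  show "\<Phi> \<in> S \<Longrightarrow> inv\<^bsub>BijGroup UNIV \<lparr>carrier := S\<rparr>\<^esub> \<Phi> = inv_into UNIV \<Phi>"
    by (simp add: group.m_inv_consistent[OF group_BijGroup sub] minv)
  show "\<one>\<^bsub>BijGroup UNIV \<lparr>carrier := S\<rparr>\<^esub> = id" by (simp add: one)
qed

text \<open>Isometry gives joint continuity: the distance of two products at \<open>T\<close> splits
  into a change of the right factor at \<open>T\<close>, on which the left factor acts
  isometrically, and a change of the left factor at one fixed element.\<close>

lemma topological_group_aut:
  assumes S: "S \<subseteq> groupoid_aut G" "id \<in> S" "\<And>\<Phi> \<Psi>. \<Phi> \<in> S \<Longrightarrow> \<Psi> \<in> S \<Longrightarrow> \<Phi> \<circ> \<Psi> \<in> S"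
    "\<And>\<Phi>. \<Phi> \<in> S \<Longrightarrow> inv_into UNIV \<Phi> \<in> S"
  shows "topological_group (BijGroup UNIV \<lparr>carrier := S\<rparr>) (subtopology (groupoid_aut_topology G) S)"
proof -
  let ?L = "BijGroup UNIV \<lparr>carrier := S\<rparr>" and ?Y = "subtopology (groupoid_aut_topology G) S"
  note L = group_BijGroup_UNIV_restrict[of S, OF S]
  have Y: "topspace ?Y = S" using S(1) by (auto simp: topspace_groupoid_aut)
  have SD: "\<Phi> \<in> groupoid_aut G" if "\<Phi> \<in> S" for \<Phi> using S(1) that by blast
  have eval: "continuous_map ?Y euclidean (\<lambda>\<Phi>. aut_of \<Phi> T)" if "T \<in> A" for T
    by (rule continuous_map_from_subtopology[OF continuous_map_aut_of_apply[OF that]])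
  have in_A: "aut_of \<Phi> T \<in> A" if "\<Phi> \<in> S" "T \<in> A" for \<Phi> T
    by (rule star_autD(3)[OF aut_of_star[OF SD[OF that(1)]] that(2)])
  have isom: "dist (aut_of \<Phi> T) (aut_of \<Phi> T') = dist T T'" if "\<Phi> \<in> S" "T \<in> A" "T' \<in> A" for \<Phi> T T'
  proof -
    note st = aut_of_star[OF SD[OF that(1)]]
    show ?thesis
      using star_aut_isometric[OF st A_diff[OF that(2,3)]] star_aut_diff[OF st that(2,3)] by (simp add: dist_norm)
  qed
  have mult: "continuous_map (prod_topology ?Y ?Y) ?Y (\<lambda>z. fst z \<circ> snd z)"
    unfolding continuous_map_in_subtopology
  proof
    show "(\<lambda>z. fst z \<circ> snd z) \<in> topspace (prod_topology ?Y ?Y) \<rightarrow> S"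
      using S(3) by (auto simp: Y)
    show "continuous_map (prod_topology ?Y ?Y) (groupoid_aut_topology G) (\<lambda>z. fst z \<circ> snd z)"
    proof (rule continuous_map_into_groupoid_aut)
      show "fst z \<circ> snd z \<in> groupoid_aut G" if "z \<in> topspace (prod_topology ?Y ?Y)" for z
        using that SD S(3) by (auto simp: Y)
      fix T assume T: "T \<in> A"
      show "continuous_map (prod_topology ?Y ?Y) euclidean (\<lambda>z. aut_of (fst z \<circ> snd z) T)"
      proof (rule continuous_map_dist_le)
        fix w and e :: real assume "w \<in> topspace (prod_topology ?Y ?Y)" and e: "0 < e"
        then have w: "fst w \<in> S" "snd w \<in> S" by (auto simp: Y)
        let ?T = "aut_of (snd w) T"
        let ?h = "\<lambda>z. dist (aut_of (snd z) T) ?T + dist (aut_of (fst z) ?T) (aut_of (fst w) ?T)"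
        have "continuous_map (prod_topology ?Y ?Y) euclideanreal ?h"
          using continuous_map_compose[OF continuous_map_snd continuous_map_dist_const[OF eval[OF T]]]
            continuous_map_compose[OF continuous_map_fst continuous_map_dist_const[OF eval[OF in_A[OF w(2) T]]]]
          by (intro continuous_map_add) (simp_all add: o_def)
        moreover have "dist (aut_of (fst z \<circ> snd z) T) (aut_of (fst w \<circ> snd w) T) \<le> ?h z"
          if "z \<in> topspace (prod_topology ?Y ?Y)" for z
        proof -
          have z: "fst z \<in> S" "snd z \<in> S" using that by (auto simp: Y)
          have "aut_of (fst z \<circ> snd z) T = aut_of (fst z) (aut_of (snd z) T)"
            "aut_of (fst w \<circ> snd w) T = aut_of (fst w) ?T"
            using aut_of_comp[OF SD[OF z(1)] SD[OF z(2)]] aut_of_comp[OF SD[OF w(1)] SD[OF w(2)]] T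
            by (simp_all add: compose_eq)
          then have "dist (aut_of (fst z \<circ> snd z) T) (aut_of (fst w \<circ> snd w) T) \<le>
              dist (aut_of (fst z) (aut_of (snd z) T)) (aut_of (fst z) ?T) +
              dist (aut_of (fst z) ?T) (aut_of (fst w) ?T)"
            by (simp add: dist_triangle)
          then show ?thesis by (simp only: isom[OF z(1) in_A[OF z(2) T] in_A[OF w(2) T]])
        qed
        ultimately show "\<exists>h. continuous_map (prod_topology ?Y ?Y) euclideanreal h \<and> h w < e \<and>
            (\<forall>z\<in>topspace (prod_topology ?Y ?Y). dist (aut_of (fst z \<circ> snd z) T) (aut_of (fst w \<circ> snd w) T) \<le> h z)"
          using e by (intro exI[of _ ?h]) auto
      qed
    qed
  qed
  have inv: "continuous_map ?Y ?Y (\<lambda>\<Phi>. inv_into UNIV \<Phi>)"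
    unfolding continuous_map_in_subtopology
  proof
    show "(\<lambda>\<Phi>. inv_into UNIV \<Phi>) \<in> topspace ?Y \<rightarrow> S"
      using S(4) by (auto simp: Y)
    show "continuous_map ?Y (groupoid_aut_topology G) (\<lambda>\<Phi>. inv_into UNIV \<Phi>)"
    proof (rule continuous_map_into_groupoid_aut)
      show "inv_into UNIV \<Phi> \<in> groupoid_aut G" if "\<Phi> \<in> topspace ?Y" for \<Phi>
        using that SD S(4) by (auto simp: Y)
      fix T assume T: "T \<in> A"
      show "continuous_map ?Y euclidean (\<lambda>\<Phi>. aut_of (inv_into UNIV \<Phi>) T)"
      proof (rule continuous_map_dist_le)
        fix \<Psi> and e :: real assume \<Psi>: "\<Psi> \<in> topspace ?Y" and e: "0 < e"
        then have w: "\<Psi> \<in> S" by (simp add: Y)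
        let ?T = "aut_of (inv_into UNIV \<Psi>) T"
        have TA: "?T \<in> A" by (rule in_A[OF S(4)[OF w] T])
        have undo: "aut_of \<Phi> (aut_of (inv_into UNIV \<Phi>) T) = T" if "\<Phi> \<in> S" for \<Phi>
          unfolding aut_of_inv[OF SD[OF that]] by (rule star_aut_inv_apply(2)[OF aut_of_star[OF SD[OF that]] T])
        \<comment> \<open>Applying the isometric \<open>aut_of \<Phi>\<close> turns the distance of
          the inverses at \<open>T\<close> into the distance of \<open>aut_of \<Phi> ?T\<close> from
          \<open>T\<close>, where \<open>?T\<close> is fixed.\<close>
        let ?h = "\<lambda>\<Phi>. dist (aut_of \<Phi> ?T) T"
        have "continuous_map ?Y euclideanreal ?h"
          by (rule continuous_map_dist_const[OF eval[OF TA]])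
        moreover have "dist (aut_of (inv_into UNIV \<Phi>) T) ?T \<le> ?h \<Phi>" if "\<Phi> \<in> topspace ?Y" for \<Phi>
        proof -
          have z: "\<Phi> \<in> S" using that by (simp add: Y)
          show ?thesis
            using isom[OF z in_A[OF S(4)[OF z] T] TA] undo[OF z] by (simp add: dist_commute)
        qed
        ultimately show "\<exists>h. continuous_map ?Y euclideanreal h \<and> h \<Psi> < e \<and>
            (\<forall>\<Phi>\<in>topspace ?Y. dist (aut_of (inv_into UNIV \<Phi>) T) ?T \<le> h \<Phi>)"
          using e undo[OF w] by (intro exI[of _ ?h]) simp
      qed
    qed
  qed
  have "continuous_map (prod_topology ?Y ?Y) ?Y (\<lambda>(x, y). x \<otimes>\<^bsub>?L\<^esub> y)"
  proof (rule continuous_map_eq[OF mult])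
    fix z assume "z \<in> topspace (prod_topology ?Y ?Y)"
    then have "fst z \<in> S" "snd z \<in> S" by (simp_all add: Y mem_Times_iff del: topspace_subtopology)
    then show "fst z \<circ> snd z = (case z of (x, y) \<Rightarrow> x \<otimes>\<^bsub>?L\<^esub> y)"
      using L(2)[of "fst z" "snd z"] by (simp add: case_prod_beta)
  qed
  moreover have "continuous_map ?Y ?Y (\<lambda>x. inv\<^bsub>?L\<^esub> x)"
    by (rule continuous_map_eq[OF inv]) (simp add: Y L(3) del: topspace_subtopology)
  ultimately show ?thesis using L(1) Y by (simp add: topological_group_def)
qed

section \<open>The restricted Weyl group of an open set of arrows\<close>

lemma coef_off: "T \<in> reduced_algebra G H \<Longrightarrow> c \<notin> H \<Longrightarrow> coef T c = 0"
proof (induction T rule: reduced_algebra_induct)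
  case closed
  show ?case by (cases "c \<in> H") (auto intro!: closed_Collect_eq continuous_intros)
next
  case (L f)
  have "f \<in> Cc UNIV" by (rule Cc_mono[OF L(1)]) simp
  then show ?case using CcD(5)[OF L(1)] L(2) by auto
qed

text \<open>The coefficients of \<open>\<phi> (L f)\<close> are continuous and supported in the
  compact image of the support of \<open>f\<close>. So \<open>\<phi>\<close> maps \<open>L f\<close>
  to some \<open>L k\<close>, whatever phases it introduces.\<close>

lemma implements_reduced_algebra:
  assumes \<phi>: "\<phi> \<in> star_aut A" and \<Phi>: "continuous_on UNIV \<Phi>" and imp: "implements \<Phi> \<phi>"
    and T: "T \<in> reduced_algebra G H"
  shows "\<phi> T \<in> reduced_algebra G (\<Phi> ` H)"
proof -
  obtain f where f: "\<And>n. f n \<in> Cc H" "(\<lambda>n. L (f n)) \<longlonglongrightarrow> T"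
    using reduced_algebra_seq[OF T] by blast
  have fU: "f n \<in> Cc UNIV" for n by (rule Cc_mono[OF f(1)]) simp
  have TA: "T \<in> A" using T reduced_algebra_mono[of H UNIV] by auto
  have "\<phi> (L (f n)) \<in> reduced_algebra G (\<Phi> ` H)" for n
  proof -
    let ?k = "coef (\<phi> (L (f n)))"
    have A: "\<phi> (L (f n)) \<in> A" by (rule star_autD(3)[OF \<phi> L_in[OF fU]])
    have k: "?k \<in> Cc (\<Phi> ` H)"
    proof (rule CcI[where K = "\<Phi> ` closure {a. f n a \<noteq> 0}"])
      show "continuous_on UNIV ?k" by (rule continuous_coef[OF A])
      show "compact (\<Phi> ` closure {a. f n a \<noteq> 0})"
        by (intro compact_continuous_image CcD(2)[OF f(1)] continuous_on_subset[OF \<Phi>]) simp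
      show "\<Phi> ` closure {a. f n a \<noteq> 0} \<subseteq> \<Phi> ` H" by (rule image_mono[OF CcD(3)[OF f(1)]])
      show "b \<in> \<Phi> ` closure {a. f n a \<noteq> 0}" if b: "?k b \<noteq> 0" for b
      proof -
        have "b \<in> \<Phi> ` support (L (f n))"
          using b implements_image_support[OF imp L_in[OF fU], of n] by simp
        then show ?thesis using CcD(4)[OF f(1)] fU by auto
      qed
    qed
    have kU: "?k \<in> Cc UNIV" by (rule Cc_mono[OF k]) simp
    have "\<phi> (L (f n)) = L ?k" by (rule coef_eqI[OF A L_in[OF kU]]) (simp add: kU)
    then show ?thesis using L_in[OF k] by simp
  qed
  then show ?thesis
    by (rule closed_sequentially[OF reduced_algebra_closed]) (rule star_aut_tendsto[OF \<phi> L_in[OF fU] TA f(2)])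
qed

text \<open>Inclusion of algebras is equivalent to inclusion of sets of arrows: a bump function on
  \<open>H\<close> around \<open>a\<close> detects an arrow that leaves \<open>H\<close>. Equality
  combines the inclusions for \<open>\<phi>\<close> and for its inverse.\<close>

lemma implements_reduced_algebra_iff:
  assumes \<phi>: "\<phi> \<in> aut_D" and imp: "implements \<Phi> \<phi>" and H: "open H"
  shows "\<phi> ` reduced_algebra G H = reduced_algebra G H \<longleftrightarrow> \<Phi> ` H = H"
proof -
  let ?B = "reduced_algebra G H"
  have BA: "?B \<subseteq> A" by (rule reduced_algebra_mono) simp
  have one: "\<Psi> ` H \<subseteq> H \<longleftrightarrow> \<psi> ` ?B \<subseteq> ?B" if \<psi>: "\<psi> \<in> aut_D" and i: "implements \<Psi> \<psi>" for \<psi> \<Psi>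
  proof
    assume "\<Psi> ` H \<subseteq> H"
    then show "\<psi> ` ?B \<subseteq> ?B"
      using implements_reduced_algebra[OF aut_D_star[OF \<psi>] _ i] reduced_algebra_mono
        groupoid_autD(2)[OF implements_groupoid_aut[OF \<psi> i]] by blast
  next
    assume B: "\<psi> ` ?B \<subseteq> ?B"
    show "\<Psi> ` H \<subseteq> H"
    proof (rule image_subsetI, rule ccontr)
      fix a assume a: "a \<in> H" "\<Psi> a \<notin> H"
      obtain f where f: "f \<in> Cc H" "f a = 1" using bump_Cc[OF H a(1)] by metis
      have fU: "f \<in> Cc UNIV" by (rule Cc_mono[OF f(1)]) simp
      have "\<psi> (L f) \<in> ?B" using B L_in[OF f(1)] by blast
      then have "coef (\<psi> (L f)) (\<Psi> a) = 0" using coef_off a(2) by blast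
      then show False using implements_zero[OF i L_in[OF fU], of a] f(2) fU by simp
    qed
  qed
  have two: "?B \<subseteq> \<phi> ` ?B \<longleftrightarrow> inv_aut \<phi> ` ?B \<subseteq> ?B"
  proof
    assume sub: "?B \<subseteq> \<phi> ` ?B"
    show "inv_aut \<phi> ` ?B \<subseteq> ?B"
    proof (rule image_subsetI)
      fix T assume "T \<in> ?B"
      then obtain S where S: "S \<in> ?B" "T = \<phi> S" using sub by blast
      then show "inv_aut \<phi> T \<in> ?B"
        using star_aut_inv_apply(1)[OF aut_D_star[OF \<phi>], of S] BA by auto
    qed
  next
    assume sub: "inv_aut \<phi> ` ?B \<subseteq> ?B"
    show "?B \<subseteq> \<phi> ` ?B"
    proof
      fix T assume T: "T \<in> ?B"
      then have "T = \<phi> (inv_aut \<phi> T)" using star_aut_inv_apply(2)[OF aut_D_star[OF \<phi>], of T] BA by auto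
      then show "T \<in> \<phi> ` ?B" using sub T by blast
    qed
  qed
  have "x = \<Phi> y \<longleftrightarrow> inv_into UNIV \<Phi> x = y" for x y
    using bij_inv_eq_iff[OF implementsD(1)[OF imp]] by metis
  then have "H \<subseteq> \<Phi> ` H \<longleftrightarrow> inv_into UNIV \<Phi> ` H \<subseteq> H" by (auto simp: subset_eq image_iff)
  then show ?thesis
    using one[OF \<phi> imp] one[OF aut_D_inv[OF \<phi>] implements_inv[OF imp aut_D_star[OF \<phi>]]] two by blast
qed

lemma star_aut_id: "(\<lambda>T\<in>A. T) \<in> star_aut A"
  by (auto simp: star_aut_def id_Bij A_add A_scaleC A_compose)

lemma implements_id: "implements id (\<lambda>T\<in>A. T)"
  by (simp add: implements_def)

lemma groupoid_aut_id: "id \<in> groupoid_aut G"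
  by (rule groupoid_autI) simp_all

definition stabilizer :: "'g set \<Rightarrow> ('g \<Rightarrow> 'g) set"
  where "stabilizer H = {\<Phi> \<in> groupoid_aut G. \<Phi> ` H = H}"

lemma stabilizer_group:
  shows "stabilizer H \<subseteq> groupoid_aut G" "id \<in> stabilizer H"
    "\<Phi> \<in> stabilizer H \<Longrightarrow> \<Psi> \<in> stabilizer H \<Longrightarrow> \<Phi> \<circ> \<Psi> \<in> stabilizer H"
    "\<Phi> \<in> stabilizer H \<Longrightarrow> inv_into UNIV \<Phi> \<in> stabilizer H"
proof -
  show "\<Phi> \<in> stabilizer H \<Longrightarrow> inv_into UNIV \<Phi> \<in> stabilizer H"
    using groupoid_autD(1)[of \<Phi>] groupoid_aut_inv[of \<Phi>] image_inv_f_f[OF bij_is_inj, of \<Phi> H]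
    by (auto simp: stabilizer_def)
  show "\<Phi> \<in> stabilizer H \<Longrightarrow> \<Psi> \<in> stabilizer H \<Longrightarrow> \<Phi> \<circ> \<Psi> \<in> stabilizer H"
    using image_comp[of \<Phi> \<Psi> H] by (simp add: stabilizer_def groupoid_aut_comp)
qed (auto simp: stabilizer_def groupoid_aut_id)

definition groupoid_of :: "('g op \<Rightarrow> 'g op) \<Rightarrow> 'g \<Rightarrow> 'g"
  where "groupoid_of \<phi> = (THE \<Phi>. implements \<Phi> \<phi>)"

lemma groupoid_of_eq: "\<phi> \<in> star_aut A \<Longrightarrow> implements \<Phi> \<phi> \<Longrightarrow> groupoid_of \<phi> = \<Phi>"
  unfolding groupoid_of_def using implements_unique by blast

lemma implements_groupoid_of: "\<phi> \<in> aut_D \<Longrightarrow> implements (groupoid_of \<phi>) \<phi>"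
  using implements_exists groupoid_of_eq aut_D_star by metis

lemma star_aut_preserving_iff:
  "\<phi> \<in> star_aut_preserving A (reduced_algebra G H) D \<longleftrightarrow> \<phi> \<in> aut_D \<and> \<phi> ` reduced_algebra G H = reduced_algebra G H"
  by (auto simp: star_aut_preserving_def aut_D_def)

lemma aut_D_preserving_iff:
  "open H \<Longrightarrow> \<phi> \<in> star_aut_preserving A (reduced_algebra G H) D \<longleftrightarrow> \<phi> \<in> aut_D \<and> groupoid_of \<phi> \<in> stabilizer H"
  unfolding star_aut_preserving_iff stabilizer_def
  using implements_reduced_algebra_iff[OF _ implements_groupoid_of] implements_groupoid_aut[OF _ implements_groupoid_of]
  by blast

lemma aut_D_compose:
  assumes "\<phi> \<in> aut_D" "\<psi> \<in> aut_D"
  shows "compose A \<phi> \<psi> \<in> aut_D"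
proof -
  have "compose A \<phi> \<psi> ` D = \<phi> ` \<psi> ` D"
    unfolding image_image by (intro image_cong) (auto simp: compose_eq D_A)
  then show ?thesis using assms star_aut_compose by (auto simp: aut_D_def)
qed

lemma groupoid_of_compose:
  "\<phi> \<in> aut_D \<Longrightarrow> \<psi> \<in> aut_D \<Longrightarrow> groupoid_of (compose A \<phi> \<psi>) = groupoid_of \<phi> \<circ> groupoid_of \<psi>"
  by (intro groupoid_of_eq implements_compose implements_groupoid_of aut_D_star aut_D_compose)

lemma groupoid_of_inv:
  "\<phi> \<in> aut_D \<Longrightarrow> groupoid_of (inv_aut \<phi>) = inv_into UNIV (groupoid_of \<phi>)"
  by (intro groupoid_of_eq implements_inv implements_groupoid_of aut_D_star aut_D_inv)

lemma groupoid_of_aut_of: "\<Phi> \<in> groupoid_aut G \<Longrightarrow> groupoid_of (aut_of \<Phi>) = \<Phi>"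
  by (intro groupoid_of_eq aut_of_star implements_aut_of)

lemma group_weyl_numerator:
  assumes H: "open H"
  shows "group (weyl_numerator G H)"
    and "groupoid_of \<in> hom (weyl_numerator G H) (BijGroup UNIV \<lparr>carrier := stabilizer H\<rparr>)"
proof -
  let ?N = "star_aut_preserving A (reduced_algebra G H) D"
  note iff = aut_D_preserving_iff[OF H]
  have Bij: "\<phi> \<in> Bij A" if "\<phi> \<in> ?N" for \<phi>
    using that by (simp add: star_aut_preserving_def star_aut_def)
  have mult: "\<phi> \<otimes>\<^bsub>BijGroup A\<^esub> \<psi> = compose A \<phi> \<psi>" if "\<phi> \<in> ?N" "\<psi> \<in> ?N" for \<phi> \<psi>
    using Bij that by (simp add: BijGroup_def)
  have comp: "compose A \<phi> \<psi> \<in> ?N" if "\<phi> \<in> ?N" "\<psi> \<in> ?N" for \<phi> \<psi>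
    using that unfolding iff by (simp add: aut_D_compose groupoid_of_compose stabilizer_group)
  have "subgroup ?N (BijGroup A)"
  proof
    show "?N \<subseteq> carrier (BijGroup A)" using Bij by (auto simp: BijGroup_def)
    show "\<one>\<^bsub>BijGroup A\<^esub> \<in> ?N"
      using star_aut_id groupoid_of_eq[OF star_aut_id implements_id] stabilizer_group(2)[of H]
      by (auto simp: iff BijGroup_def aut_D_def D_A)
    show "\<phi> \<otimes>\<^bsub>BijGroup A\<^esub> \<psi> \<in> ?N" if "\<phi> \<in> ?N" "\<psi> \<in> ?N" for \<phi> \<psi>
      using that by (simp add: mult comp)
    show "inv\<^bsub>BijGroup A\<^esub> \<phi> \<in> ?N" if "\<phi> \<in> ?N" for \<phi>
    proof -
      have \<phi>: "\<phi> \<in> aut_D" "groupoid_of \<phi> \<in> stabilizer H" using that by (simp_all add: iff)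
      have "inv_aut \<phi> \<in> ?N"
        unfolding iff groupoid_of_inv[OF \<phi>(1)] by (intro conjI aut_D_inv stabilizer_group(4) \<phi>)
      then show ?thesis by (simp only: inv_BijGroup[OF Bij[OF that]])
    qed
  qed
  then show "group (weyl_numerator G H)"
    unfolding weyl_numerator_def by (rule subgroup.subgroup_is_group[OF _ group_BijGroup])
  show "groupoid_of \<in> hom (weyl_numerator G H) (BijGroup UNIV \<lparr>carrier := stabilizer H\<rparr>)"
  proof (rule homI)
    fix \<phi> \<psi> assume "\<phi> \<in> carrier (weyl_numerator G H)" "\<psi> \<in> carrier (weyl_numerator G H)"
    then have *: "\<phi> \<in> ?N" "\<psi> \<in> ?N" by (simp_all add: weyl_numerator_def)
    then have **: "\<phi> \<in> aut_D" "\<psi> \<in> aut_D" "groupoid_of \<phi> \<in> stabilizer H" "groupoid_of \<psi> \<in> stabilizer H"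
      by (simp_all add: iff)
    have "\<phi> \<otimes>\<^bsub>weyl_numerator G H\<^esub> \<psi> = compose A \<phi> \<psi>"
      using mult[OF *] by (simp add: weyl_numerator_def)
    then show "groupoid_of (\<phi> \<otimes>\<^bsub>weyl_numerator G H\<^esub> \<psi>) =
        groupoid_of \<phi> \<otimes>\<^bsub>BijGroup UNIV \<lparr>carrier := stabilizer H\<rparr>\<^esub> groupoid_of \<psi>"
      by (simp only: groupoid_of_compose[OF **(1,2)]
          group_BijGroup_UNIV_restrict(2)[of "stabilizer H", OF stabilizer_group **(3,4)])
  qed (simp add: weyl_numerator_def iff)
qed

text \<open>Fixing the diagonal means that \<open>\<Phi>\<close> is the identity, by
  \<open>implements_id_iff\<close>. The identity stabilizes every \<open>H\<close>, so such
  automorphisms belong to the numerator for each open \<open>H\<close>.\<close>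

lemma weyl_denominator_eq_kernel:
  assumes H: "open H"
  shows "weyl_denominator G =
    kernel (weyl_numerator G H) (BijGroup UNIV \<lparr>carrier := stabilizer H\<rparr>) groupoid_of"
proof -
  have "\<phi> \<in> star_aut_fixing A D \<longleftrightarrow>
      \<phi> \<in> star_aut_preserving A (reduced_algebra G H) D \<and> groupoid_of \<phi> = id" for \<phi>
  proof -
    have "\<phi> \<in> star_aut_fixing A D \<longleftrightarrow> \<phi> \<in> aut_D \<and> (\<forall>g\<in>D. \<phi> g = g)"
      by (auto simp: star_aut_fixing_def aut_D_def)
    also have "\<dots> \<longleftrightarrow> \<phi> \<in> aut_D \<and> implements id \<phi>" using implements_id_iff by blast
    also have "\<dots> \<longleftrightarrow> \<phi> \<in> aut_D \<and> groupoid_of \<phi> = id"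
      using groupoid_of_eq[OF aut_D_star] implements_groupoid_of by metis
    also have "\<dots> \<longleftrightarrow> \<phi> \<in> star_aut_preserving A (reduced_algebra G H) D \<and> groupoid_of \<phi> = id"
      unfolding aut_D_preserving_iff[OF H] using stabilizer_group(2)[of H] by metis
    finally show ?thesis .
  qed
  then have "star_aut_fixing A D =
      {\<phi> \<in> star_aut_preserving A (reduced_algebra G H) D. groupoid_of \<phi> = id}"
    by auto
  then show ?thesis
    using group_BijGroup_UNIV_restrict(4)[of "stabilizer H", OF stabilizer_group]
    by (simp add: kernel_def weyl_denominator_def weyl_numerator_def)
qed

text \<open>Both sides are the modulus of \<open>f\<close> at the preimage of \<open>b\<close>:
  \<open>\<phi>\<close> contributes only a phase, and a nonnegative \<open>f\<close> equals its
  modulus.\<close>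

lemma coef_aut_of_nonneg:
  assumes imp: "implements \<Phi> \<phi>" and \<Phi>: "\<Phi> \<in> groupoid_aut G"
    and f: "f \<in> Cc UNIV" "\<And>x. of_real (cmod (f x)) = f x"
  shows "coef (aut_of \<Phi> (L f)) b = of_real (cmod (coef (\<phi> (L f)) b))"
proof -
  obtain a where a: "b = \<Phi> a" using implementsD(1)[OF imp] by (metis bij_pointE)
  show ?thesis
    unfolding a aut_of_apply[OF L_in[OF f(1)]] coef_conj_op[OF \<Phi> L_in[OF f(1)]]
      implementsD(2)[OF imp L_in[OF f(1)]]
    by (simp add: f)
qed

text \<open>The difference is supported on the union of two bisections, so its norm is controlled by its
  supremum norm; passing from \<open>\<phi>\<close> to \<open>aut_of \<Phi>\<close> replaces coefficients by their moduli.\<close>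

lemma dist_aut_of_le:
  assumes \<phi>: "\<phi> \<in> aut_D" and \<psi>: "\<psi> \<in> aut_D" and U: "bisection U"
    and f: "f \<in> Cc U" "\<And>x. of_real (cmod (f x)) = f x"
  shows "dist (aut_of (groupoid_of \<phi>) (L f)) (aut_of (groupoid_of \<psi>) (L f)) \<le> 2 * dist (\<phi> (L f)) (\<psi> (L f))"
proof -
  let ?T = "L f"
  have fU: "f \<in> Cc UNIV" by (rule Cc_mono[OF f(1)]) simp
  have TN: "?T \<in> N" by (rule L_in_N[OF f(1) U])
  have gr: "groupoid_of \<phi> \<in> groupoid_aut G" "groupoid_of \<psi> \<in> groupoid_aut G"
    using \<phi> \<psi> by (simp_all add: implements_groupoid_aut implements_groupoid_of)
  note c\<phi> = coef_aut_of_nonneg[OF implements_groupoid_of[OF \<phi>] gr(1) fU f(2)]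
  note c\<psi> = coef_aut_of_nonneg[OF implements_groupoid_of[OF \<psi>] gr(2) fU f(2)]
  have "norm (aut_of (groupoid_of \<phi>) ?T - aut_of (groupoid_of \<psi>) ?T) \<le> 2 * norm (\<phi> ?T - \<psi> ?T)"
  proof (rule norm_le_two_bisections[where S = "support (\<phi> ?T)" and S' = "support (\<psi> ?T)"])
    show "aut_of (groupoid_of \<phi>) ?T - aut_of (groupoid_of \<psi>) ?T \<in> A"
      by (intro A_diff star_autD(3)[OF aut_of_star] gr L_in fU)
    show "bisection (support (\<phi> ?T))" "bisection (support (\<psi> ?T))"
      using aut_D_N[OF \<phi> TN] aut_D_N[OF \<psi> TN] by (simp_all add: normalizers_def)
    show "c \<in> support (\<phi> ?T) \<union> support (\<psi> ?T)"
      if "coef (aut_of (groupoid_of \<phi>) ?T - aut_of (groupoid_of \<psi>) ?T) c \<noteq> 0" for c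
      using that by (auto simp: coef_linear c\<phi> c\<psi>)
    show "cmod (coef (aut_of (groupoid_of \<phi>) ?T - aut_of (groupoid_of \<psi>) ?T) c) \<le> norm (\<phi> ?T - \<psi> ?T)" for c
    proof -
      have "cmod (coef (aut_of (groupoid_of \<phi>) ?T - aut_of (groupoid_of \<psi>) ?T) c) =
          \<bar>cmod (coef (\<phi> ?T) c) - cmod (coef (\<psi> ?T) c)\<bar>"
        unfolding coef_linear c\<phi> c\<psi> of_real_diff[symmetric] norm_of_real ..
      also have "\<dots> \<le> cmod (coef (\<phi> ?T - \<psi> ?T) c)"
        unfolding coef_linear by (rule norm_triangle_ineq3)
      also have "\<dots> \<le> norm (\<phi> ?T - \<psi> ?T)" by (rule coef_le_norm)
      finally show ?thesis .
    qed
  qed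
  then show ?thesis by (simp add: dist_norm)
qed

text \<open>The estimate \<open>dist_aut_of_le\<close> covers nonnegative functions on bisections.
  Continuity of the evaluations extends from there to every \<open>L f\<close> by addition and
  scaling, and to \<open>A\<close> by uniform approximation, since every \<open>aut_of\<close> is
  isometric.\<close>

lemma continuous_map_groupoid_of:
  assumes X: "topspace X \<subseteq> aut_D" and eval: "\<And>T. T \<in> A \<Longrightarrow> continuous_map X euclidean (\<lambda>\<phi>. \<phi> T)"
  shows "continuous_map X (groupoid_aut_topology G) groupoid_of"
proof (rule continuous_map_into_groupoid_aut)
  have gr: "groupoid_of \<phi> \<in> groupoid_aut G" if "\<phi> \<in> topspace X" for \<phi>
    using that X implements_groupoid_aut[OF _ implements_groupoid_of] by blast
  then show "groupoid_of \<phi> \<in> groupoid_aut G" if "\<phi> \<in> topspace X" for \<phi> using that .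
  let ?F = "\<lambda>T \<phi>. aut_of (groupoid_of \<phi>) T"
  note st = aut_of_star[OF gr]
  have Lf: "continuous_map X euclidean (?F (L f))" if "f \<in> Cc UNIV" for f
    using that
  proof (induction f rule: Cc_induct)
    case (bisection f U)
    let ?T = "L f"
    have TA: "?T \<in> A" by (rule L_in) (rule Cc_mono[OF bisection(4)], simp)
    show ?case
    proof (rule continuous_map_dist_le)
      fix \<psi> and e :: real assume \<psi>: "\<psi> \<in> topspace X" and e: "0 < e"
      have "continuous_map X euclideanreal (\<lambda>\<phi>. dist (\<phi> ?T) (\<psi> ?T) + dist (\<phi> ?T) (\<psi> ?T))"
        by (intro continuous_map_add continuous_map_dist_const eval TA)
      moreover have "dist (?F ?T \<phi>) (?F ?T \<psi>) \<le> dist (\<phi> ?T) (\<psi> ?T) + dist (\<phi> ?T) (\<psi> ?T)"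
        if "\<phi> \<in> topspace X" for \<phi>
        using dist_aut_of_le[of \<phi> \<psi> U f] that \<psi> X bisection(2,3,4) by auto
      ultimately show "\<exists>h. continuous_map X euclideanreal h \<and> h \<psi> < e \<and>
          (\<forall>\<phi>\<in>topspace X. dist (?F ?T \<phi>) (?F ?T \<psi>) \<le> h \<phi>)"
        using e by (intro exI[of _ "\<lambda>\<phi>. dist (\<phi> ?T) (\<psi> ?T) + dist (\<phi> ?T) (\<psi> ?T)"]) auto
    qed
  next
    case (add f g)
    have "continuous_map X euclidean (\<lambda>\<phi>. ?F (L f) \<phi> + ?F (L g) \<phi>)"
      by (intro continuous_map_add add)
    then show ?case
      by (rule continuous_map_eq) (use add in \<open>simp add: L_add star_autD(4)[OF st] L_in\<close>)
  next
    case (scale c f)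
    have "continuous_map euclidean euclidean (scaleC_op c :: 'g op \<Rightarrow> 'g op)"
      using bounded_linear.continuous_on[OF bounded_linear_scaleC_op continuous_on_id, of UNIV c] by simp
    from continuous_map_compose[OF scale(2) this]
    have "continuous_map X euclidean (\<lambda>\<phi>. scaleC_op c (?F (L f) \<phi>))" by (simp add: o_def)
    then show ?case
      by (rule continuous_map_eq) (use scale in \<open>simp add: L_scale star_autD(5)[OF st] L_in\<close>)
  qed
  show "continuous_map X euclidean (?F T)" if T: "T \<in> A" for T
  proof (rule continuous_map_dist_le)
    fix \<psi> and e :: real assume \<psi>: "\<psi> \<in> topspace X" and e: "0 < e"
    have "T \<in> closure (L ` Cc UNIV)" using T by (simp add: reduced_algebra_def)
    then have "\<exists>S\<in>L ` Cc UNIV. dist S T < e/2"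
      using half_gt_zero[OF e] unfolding closure_approachable by blast
    then obtain f where f: "f \<in> Cc UNIV" "dist (L f) T < e/2" by auto
    let ?S = "L f"
    have SA: "?S \<in> A" by (rule L_in[OF f(1)])
    have isom: "dist (?F ?S \<phi>) (?F T \<phi>) = dist ?S T" if "\<phi> \<in> topspace X" for \<phi>
      using star_aut_isometric[OF st[OF that] A_diff[OF SA T]] star_aut_diff[OF st[OF that] SA T]
      by (simp add: dist_norm)
    \<comment> \<open>Replacing \<open>T\<close> by \<open>?S\<close> costs \<open>dist ?S T\<close>
      at each of the two ends, independently of \<open>\<phi>\<close>.\<close>
    let ?h = "\<lambda>\<phi>. dist (?F ?S \<phi>) (?F ?S \<psi>) + 2 * dist ?S T"
    have "continuous_map X euclideanreal ?h"
      by (intro continuous_map_add continuous_map_dist_const Lf f(1)) simp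
    moreover have "dist (?F T \<phi>) (?F T \<psi>) \<le> ?h \<phi>" if "\<phi> \<in> topspace X" for \<phi>
      using isom[OF that] isom[OF \<psi>] dist_triangle[of "?F T \<phi>" "?F T \<psi>" "?F ?S \<phi>"]
        dist_triangle[of "?F ?S \<phi>" "?F T \<psi>" "?F ?S \<psi>"] by (simp add: dist_commute)
    ultimately show "\<exists>h. continuous_map X euclideanreal h \<and> h \<psi> < e \<and>
        (\<forall>\<phi>\<in>topspace X. dist (?F T \<phi>) (?F T \<psi>) \<le> h \<phi>)"
      using f(2) by (intro exI[of _ ?h]) auto
  qed
qed

theorem restricted_weyl_isomorphic_stabilizer:
  assumes H: "open H"
  shows "topological_group_isomorphic (restricted_weyl_group G H) (restricted_weyl_topology G H)
    (BijGroup UNIV \<lparr>carrier := stabilizer H\<rparr>) (subtopology (groupoid_aut_topology G) (stabilizer H))"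
  unfolding restricted_weyl_group_def restricted_weyl_topology_def
proof (rule topological_group_isomorphic_quotient[where p = groupoid_of and s = aut_of])
  let ?K = "weyl_numerator G H" and ?L = "BijGroup UNIV \<lparr>carrier := stabilizer H\<rparr>"
  let ?X = "subtopology (point_norm_topology A) (carrier ?K)"
  let ?Y = "subtopology (groupoid_aut_topology G) (stabilizer H)"
  have K: "carrier ?K = {\<phi> \<in> aut_D. groupoid_of \<phi> \<in> stabilizer H}"
    using aut_D_preserving_iff[OF H] by (auto simp: weyl_numerator_def)
  show X: "topspace ?X = carrier ?K"
    using aut_D_star by (auto simp: topspace_point_norm K)
  show "group ?K" "groupoid_of \<in> hom ?K ?L" by (rule group_weyl_numerator[OF H])+
  show "topological_group ?L ?Y" by (rule topological_group_aut[OF stabilizer_group])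
  show "weyl_denominator G = kernel ?K ?L groupoid_of" by (rule weyl_denominator_eq_kernel[OF H])
  show "continuous_map ?X ?Y groupoid_of"
    unfolding continuous_map_in_subtopology
  proof
    show "continuous_map ?X (groupoid_aut_topology G) groupoid_of"
      by (rule continuous_map_groupoid_of)
        (use X in \<open>auto simp: K intro: continuous_map_from_subtopology continuous_map_eval\<close>)
    show "groupoid_of \<in> topspace ?X \<rightarrow> stabilizer H" unfolding X K by auto
  qed
  show "continuous_map ?Y ?X aut_of"
    unfolding continuous_map_in_subtopology
  proof
    show "continuous_map ?Y (point_norm_topology A) aut_of"
      by (rule continuous_map_from_subtopology[OF continuous_map_aut_of])
    show "aut_of \<in> topspace ?Y \<rightarrow> carrier ?K"
      by (auto simp: topspace_groupoid_aut K aut_of_aut_D groupoid_of_aut_of)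
  qed
  show "groupoid_of (aut_of \<Phi>) = \<Phi>" if "\<Phi> \<in> carrier ?L" for \<Phi>
    using that stabilizer_group(1) by (intro groupoid_of_aut_of) auto
qed

section \<open>Automorphisms compatible with the cocycle\<close>

text \<open>By transitivity of the kernel, arrows of arbitrary degrees can be moved, without changing
  their degrees, so as to be connected by an arrow of the kernel.\<close>

lemma cocycle_kernel_connect:
  assumes \<Gamma>: "group \<Gamma>" and \<sigma>: "cocycle G \<Gamma> \<sigma>"
    and cont: "continuous_map euclidean (discrete_topology (carrier \<Gamma>)) \<sigma>"
    and trans: "topologically_transitive G (cocycle_kernel \<Gamma> \<sigma>)"
    and \<Phi>: "\<Phi> \<in> groupoid_aut G" and K: "\<Phi> ` cocycle_kernel \<Gamma> \<sigma> = cocycle_kernel \<Gamma> \<sigma>"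
  shows "\<exists>c. \<sigma> c = \<sigma> a \<otimes>\<^bsub>\<Gamma>\<^esub> \<sigma> b \<and> \<sigma> (\<Phi> c) = \<sigma> (\<Phi> a) \<otimes>\<^bsub>\<Gamma>\<^esub> \<sigma> (\<Phi> b)"
proof -
  interpret \<Gamma>: group \<Gamma> by (rule \<Gamma>)
  note \<Phi>D = groupoid_autD[OF \<Phi>]
  have mem: "\<sigma> x \<in> carrier \<Gamma>" for x using \<sigma> by (auto simp: cocycle_def)
  have mult: "\<sigma> (x \<diamondop> y) = \<sigma> x \<otimes>\<^bsub>\<Gamma>\<^esub> \<sigma> y" if "d x = r y" for x y
    using \<sigma> that by (auto simp: cocycle_def)
  have unit: "\<sigma> u = \<one>\<^bsub>\<Gamma>\<^esub>" if "u \<in> U\<^sub>0" for u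
    using mult[of u u] that mem[of u] by (simp add: unitD \<Gamma>.l_cancel_one')
  have op: "open {y. \<sigma> y = \<sigma> x}" for x
    using openin_continuous_map_preimage[OF cont, of "{\<sigma> x}"] mem by simp
  \<comment> \<open>The cocycle takes values in a discrete space, so prescribing degrees both before
    and after \<open>\<Phi>\<close> is an open condition on arrows.\<close>
  have op': "open {y. \<sigma> y = \<sigma> x \<and> \<sigma> (\<Phi> y) = \<sigma> (\<Phi> x)}" for x
  proof -
    have "open (\<Phi> -` {y. \<sigma> y = \<sigma> (\<Phi> x)})"
      using op[of "\<Phi> x"] \<Phi>D(2) unfolding continuous_on_open_vimage[OF open_UNIV] Int_UNIV_right by blast
    from open_Int[OF op[of x] this] show ?thesis by (simp add: vimage_def Collect_conj_eq)
  qed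
  let ?U = "{y. \<sigma> y = \<sigma> a \<and> \<sigma> (\<Phi> y) = \<sigma> (\<Phi> a)}" and ?V = "{y. \<sigma> y = \<sigma> b \<and> \<sigma> (\<Phi> y) = \<sigma> (\<Phi> b)}"
  have sub: "U\<^sub>0 \<subseteq> cocycle_kernel \<Gamma> \<sigma>" using unit by (auto simp: cocycle_kernel_def)
  then have U0: "U\<^sub>0 \<inter> cocycle_kernel \<Gamma> \<sigma> = U\<^sub>0" by blast
  have "openin (top_of_set U\<^sub>0) (r ` ?V)"
    by (rule open_subset[OF _ open_image_r[OF op']]) auto
  moreover have "r ` ?V \<noteq> {}" by auto
  \<comment> \<open>Arrows of the kernel that start in the ranges of \<open>?V\<close> reach a dense
    set of units, and therefore the open set of sources of \<open>?U\<close>.\<close>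
  ultimately have dense: "U\<^sub>0 \<subseteq> closure (r ` {x \<in> cocycle_kernel \<Gamma> \<sigma>. d x \<in> r ` ?V})"
    using trans unfolding topologically_transitive_def U0 by blast
  then have "d a \<in> closure (r ` {x \<in> cocycle_kernel \<Gamma> \<sigma>. d x \<in> r ` ?V})" using d_unit by blast
  then have "d ` ?U \<inter> r ` {x \<in> cocycle_kernel \<Gamma> \<sigma>. d x \<in> r ` ?V} \<noteq> {}"
    using open_Int_closure_eq_empty[OF open_image_d[OF op']] by blast
  then obtain x y z where xyz: "x \<in> ?U" "y \<in> cocycle_kernel \<Gamma> \<sigma>" "z \<in> ?V" "d x = r y" "d y = r z"
    by auto
  have "\<Phi> y \<in> cocycle_kernel \<Gamma> \<sigma>" using K xyz(2) by blast
  then have y: "\<sigma> y = \<one>\<^bsub>\<Gamma>\<^esub>" "\<sigma> (\<Phi> y) = \<one>\<^bsub>\<Gamma>\<^esub>" using xyz(2) by (simp_all add: cocycle_kernel_def)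
  have "\<sigma> (x \<diamondop> (y \<diamondop> z)) = \<sigma> a \<otimes>\<^bsub>\<Gamma>\<^esub> \<sigma> b"
    using xyz y by (simp add: mult mem)
  moreover have "\<sigma> (\<Phi> (x \<diamondop> (y \<diamondop> z))) = \<sigma> (\<Phi> a) \<otimes>\<^bsub>\<Gamma>\<^esub> \<sigma> (\<Phi> b)"
    using xyz y by (simp add: \<Phi>D(4,5,6) mult mem)
  ultimately show ?thesis by blast
qed

text \<open>The automorphism \<open>\<tau>\<close> must send \<open>\<sigma> x\<close> to
  \<open>\<sigma> (\<Phi> x)\<close>. The connecting arrow for \<open>x\<close> and
  \<open>iv y\<close> shows that this is well defined and injective, the one for \<open>x\<close>
  and \<open>y\<close> that it is multiplicative. Surjectivity of \<open>\<sigma>\<close> makes it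
  defined everywhere and, with that of \<open>\<Phi>\<close>, onto.\<close>

lemma cocycle_preserving_aut_eq_stabilizer:
  assumes \<Gamma>: "group \<Gamma>" and \<sigma>: "cocycle G \<Gamma> \<sigma>"
    and cont: "continuous_map euclidean (discrete_topology (carrier \<Gamma>)) \<sigma>"
    and surj: "range \<sigma> = carrier \<Gamma>"
    and trans: "topologically_transitive G (cocycle_kernel \<Gamma> \<sigma>)"
  shows "cocycle_preserving_aut G \<Gamma> \<sigma> = stabilizer (cocycle_kernel \<Gamma> \<sigma>)"
proof -
  interpret \<Gamma>: group \<Gamma> by (rule \<Gamma>)
  let ?K = "cocycle_kernel \<Gamma> \<sigma>"
  have mem: "\<sigma> x \<in> carrier \<Gamma>" for x using surj by auto
  have mult: "\<sigma> (x \<diamondop> y) = \<sigma> x \<otimes>\<^bsub>\<Gamma>\<^esub> \<sigma> y" if "d x = r y" for x y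
    using \<sigma> that by (auto simp: cocycle_def)
  have unit: "\<sigma> u = \<one>\<^bsub>\<Gamma>\<^esub>" if "u \<in> U\<^sub>0" for u
    using mult[of u u] that mem[of u] by (simp add: unitD \<Gamma>.l_cancel_one')
  have quot: "\<sigma> x \<otimes>\<^bsub>\<Gamma>\<^esub> \<sigma> (iv y) = \<one>\<^bsub>\<Gamma>\<^esub> \<longleftrightarrow> \<sigma> x = \<sigma> y" for x y
  proof -
    have "\<sigma> (iv y) \<otimes>\<^bsub>\<Gamma>\<^esub> \<sigma> y = \<one>\<^bsub>\<Gamma>\<^esub>" using mult[of "iv y" y] unit[OF d_unit, of y] by simp
    then have "\<sigma> (iv y) = inv\<^bsub>\<Gamma>\<^esub> \<sigma> y" using \<Gamma>.inv_equality mem by metis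
    then show ?thesis using \<Gamma>.inv_solve_right'[of "\<one>\<^bsub>\<Gamma>\<^esub>" "\<sigma> x" "\<sigma> y"] mem by auto
  qed
  have "\<Phi> ` ?K = ?K" if \<Phi>: "\<Phi> \<in> groupoid_aut G" and \<tau>: "\<tau> \<in> auto \<Gamma>" "\<tau> \<circ> \<sigma> = \<sigma> \<circ> \<Phi>" for \<Phi> \<tau>
  proof -
    have hom: "\<tau> \<in> hom \<Gamma> \<Gamma>" and inj: "inj_on \<tau> (carrier \<Gamma>)"
      using \<tau>(1) by (auto simp: auto_def Bij_def bij_betw_def)
    have one: "\<tau> \<one>\<^bsub>\<Gamma>\<^esub> = \<one>\<^bsub>\<Gamma>\<^esub>" by (rule hom_one[OF hom \<Gamma> \<Gamma>])
    have eq: "\<sigma> (\<Phi> x) = \<tau> (\<sigma> x)" for x using \<tau>(2) by (metis comp_apply)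
    have "\<tau> (\<sigma> x) = \<one>\<^bsub>\<Gamma>\<^esub> \<longleftrightarrow> \<sigma> x = \<one>\<^bsub>\<Gamma>\<^esub>" for x
      using inj_onD[OF inj, of "\<sigma> x" "\<one>\<^bsub>\<Gamma>\<^esub>"] one mem by auto
    then have iff: "\<Phi> x \<in> ?K \<longleftrightarrow> x \<in> ?K" for x by (simp add: cocycle_kernel_def eq)
    show ?thesis
    proof (intro equalityI subsetI)
      fix y assume y: "y \<in> ?K"
      obtain x where "y = \<Phi> x" using groupoid_autD(1)[OF \<Phi>] by (metis bij_pointE)
      then show "y \<in> \<Phi> ` ?K" using y iff by blast
    qed (use iff in auto)
  qed
  moreover have "\<exists>\<tau>\<in>auto \<Gamma>. \<tau> \<circ> \<sigma> = \<sigma> \<circ> \<Phi>" if \<Phi>: "\<Phi> \<in> groupoid_aut G" and K: "\<Phi> ` ?K = ?K" for \<Phi>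
  proof -
    note connect = cocycle_kernel_connect[OF \<Gamma> \<sigma> cont trans \<Phi> K]
    note bij = groupoid_autD(1)[OF \<Phi>]
    have K_iff: "\<sigma> (\<Phi> x) = \<one>\<^bsub>\<Gamma>\<^esub> \<longleftrightarrow> \<sigma> x = \<one>\<^bsub>\<Gamma>\<^esub>" for x
    proof -
      have "\<Phi> x \<in> \<Phi> ` ?K \<longleftrightarrow> x \<in> ?K" by (rule inj_image_mem_iff[OF bij_is_inj[OF bij]])
      then show ?thesis unfolding K by (simp add: cocycle_kernel_def)
    qed
    have wd: "\<sigma> (\<Phi> x) = \<sigma> (\<Phi> y) \<longleftrightarrow> \<sigma> x = \<sigma> y" for x y
    proof -
      obtain c where c: "\<sigma> c = \<sigma> x \<otimes>\<^bsub>\<Gamma>\<^esub> \<sigma> (iv y)" "\<sigma> (\<Phi> c) = \<sigma> (\<Phi> x) \<otimes>\<^bsub>\<Gamma>\<^esub> \<sigma> (\<Phi> (iv y))"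
        using connect by blast
      have "\<sigma> x = \<sigma> y \<longleftrightarrow> \<sigma> c = \<one>\<^bsub>\<Gamma>\<^esub>" using quot[of x y] c(1) by simp
      also have "\<dots> \<longleftrightarrow> \<sigma> (\<Phi> c) = \<one>\<^bsub>\<Gamma>\<^esub>" using K_iff by simp
      also have "\<dots> \<longleftrightarrow> \<sigma> (\<Phi> x) = \<sigma> (\<Phi> y)"
        using quot[of "\<Phi> x" "\<Phi> y"] c(2) by (simp add: groupoid_aut_iv[OF \<Phi>])
      finally show ?thesis by simp
    qed
    define \<tau> where "\<tau> = (\<lambda>\<gamma>\<in>carrier \<Gamma>. \<sigma> (\<Phi> (SOME x. \<sigma> x = \<gamma>)))"
    have \<tau>: "\<tau> (\<sigma> x) = \<sigma> (\<Phi> x)" for x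
    proof -
      have "\<sigma> (SOME y. \<sigma> y = \<sigma> x) = \<sigma> x" by (rule someI) (rule refl)
      then show ?thesis using wd mem by (simp add: \<tau>_def)
    qed
    have im: "\<exists>x. \<gamma> = \<sigma> x" if "\<gamma> \<in> carrier \<Gamma>" for \<gamma> using that surj by auto
    have "\<tau> \<in> hom \<Gamma> \<Gamma>"
    proof (rule homI)
      show "\<tau> \<gamma> \<in> carrier \<Gamma>" if "\<gamma> \<in> carrier \<Gamma>" for \<gamma> using im[OF that] \<tau> mem by auto
      fix \<gamma> \<delta> assume "\<gamma> \<in> carrier \<Gamma>" "\<delta> \<in> carrier \<Gamma>"
      then obtain x y where xy: "\<gamma> = \<sigma> x" "\<delta> = \<sigma> y" using im by metis
      obtain c where c: "\<sigma> c = \<sigma> x \<otimes>\<^bsub>\<Gamma>\<^esub> \<sigma> y" "\<sigma> (\<Phi> c) = \<sigma> (\<Phi> x) \<otimes>\<^bsub>\<Gamma>\<^esub> \<sigma> (\<Phi> y)"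
        using connect by blast
      show "\<tau> (\<gamma> \<otimes>\<^bsub>\<Gamma>\<^esub> \<delta>) = \<tau> \<gamma> \<otimes>\<^bsub>\<Gamma>\<^esub> \<tau> \<delta>" using \<tau>[of c] unfolding xy \<tau> c .
    qed
    moreover have "bij_betw \<tau> (carrier \<Gamma>) (carrier \<Gamma>)"
      unfolding bij_betw_def
    proof
      show "inj_on \<tau> (carrier \<Gamma>)"
      proof (rule inj_onI)
        fix \<gamma> \<delta> assume gd: "\<gamma> \<in> carrier \<Gamma>" "\<delta> \<in> carrier \<Gamma>" "\<tau> \<gamma> = \<tau> \<delta>"
        then obtain x y where xy: "\<gamma> = \<sigma> x" "\<delta> = \<sigma> y" using im by metis
        then show "\<gamma> = \<delta>" using gd(3) wd by (simp add: \<tau>)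
      qed
      show "\<tau> ` carrier \<Gamma> = carrier \<Gamma>"
      proof -
        have "\<tau> ` carrier \<Gamma> = \<sigma> ` range \<Phi>" unfolding surj[symmetric] image_image \<tau> ..
        then show ?thesis using bij surj by (simp add: bij_is_surj)
      qed
    qed
    ultimately have "\<tau> \<in> auto \<Gamma>" by (simp add: auto_def Bij_def \<tau>_def)
    moreover have "\<tau> \<circ> \<sigma> = \<sigma> \<circ> \<Phi>" using \<tau> by auto
    ultimately show ?thesis by blast
  qed
  ultimately show ?thesis unfolding cocycle_preserving_aut_def stabilizer_def by blast
qed

end

theorem corollary4p2p9:
  fixes G :: "'g::t2_space groupoid"
    and \<Gamma> :: "('c, 'm) monoid_scheme"
    and \<sigma> :: "'g \<Rightarrow> 'c"
  assumes "locally_compact_space (euclidean :: 'g topology)"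
    and "topological_groupoid G"
    and "etale G"
    and "group \<Gamma>"
    and "cocycle G \<Gamma> \<sigma>"
    and "continuous_map euclidean (discrete_topology (carrier \<Gamma>)) \<sigma>"
    and "range \<sigma> = carrier \<Gamma>"
    and "effective G"
    and "topologically_transitive G (cocycle_kernel \<Gamma> \<sigma>)"
  shows "topological_group_isomorphic
    (restricted_weyl_group G (cocycle_kernel \<Gamma> \<sigma>))
    (restricted_weyl_topology G (cocycle_kernel \<Gamma> \<sigma>))
    (BijGroup UNIV \<lparr>carrier := cocycle_preserving_aut G \<Gamma> \<sigma>\<rparr>)
    (subtopology (groupoid_aut_topology G) (cocycle_preserving_aut G \<Gamma> \<sigma>))"
proof -
  interpret effective_etale_groupoid G
    using assms(1,2,3,8) by unfold_locales
  interpret \<Gamma>: group \<Gamma> by (rule assms(4))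
  have "openin euclidean {x \<in> topspace euclidean. \<sigma> x \<in> {\<one>\<^bsub>\<Gamma>\<^esub>}}"
    by (rule openin_continuous_map_preimage[OF assms(6)]) simp
  then have "open (cocycle_kernel \<Gamma> \<sigma>)" by (simp add: cocycle_kernel_def)
  from restricted_weyl_isomorphic_stabilizer[OF this] show ?thesis
    by (simp only: cocycle_preserving_aut_eq_stabilizer[OF assms(4-7,9)])
qed

end
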